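(* Suppose $1\leq s^*\leq p$ are natural numbers and $\gamma\in[0,1)$. If $\eta\in(0,1)$, then there exists a constant $C_\eta>0$ depending only on $\eta$ such that for all $C>C_\eta$ the test $$\varphi_{\text{adaptive}}:=\Big(\max_{1\leq s<\sqrt{p}}\varphi_{t(s),r(s)}\Big)\vee\varphi^{\chi^2}_{r_{\chi^2}}\vee\Big(\max_{p-\sqrt{p}<s<p}\varphi_{\widetilde{t}(s),\widetilde{r}(s)}\Big)\vee\varphi^{\mathbf{1}_p}_{r_{\mathbf{1}_p}}$$ with the choices $t(s)=\sqrt{2\log(1+\frac{p}{s^2})}$, $\widetilde{t}(s)=\sqrt{2\log(1+\frac{p}{(p-s)^2})}$, $r(s)=\frac{C^2}{32}s\log(1+\frac{p}{s^2})$, $\widetilde{r}(s)=\frac{C^2}{8}(p-s)\log(1+\frac{p}{(p-s)^2})$, $r_{\chi^2}=\frac{C^2}{2}$, $r_{\mathbf{1}_p}=\frac{C^2}{2}$ satisfies $$P_{0,\gamma}\{\varphi_{\text{adaptive}}=1\}+\sup_{\theta\in\Theta(p,s^*,C\psi)}P_{\theta,\gamma}\{\varphi_{\text{adaptive}}=0\}\leq\eta,$$ where $$\psi^2=\begin{cases}(1-\gamma)s^*\log\left(1+\frac{p}{(s^* )^2}\right)&\text{if }s^*<\sqrt{p},\\(1-\gamma)\sqrt{p}+\left[\frac{(1-\gamma)p^{3/2}}{p-s^*}\wedge(1-\gamma+\gamma p)\right]&\text{if }\sqrt{p}\leq s^*\leq p-\sqrt{p},\\(1-\gamma)\sqrt{p}+\left[(1-\gamma)p\log\left(1+\frac{p}{(p-s^*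 )^2}\right)\wedge(1-\gamma+\gamma p)\right]&\text{if }p-\sqrt{p}<s^*\leq p.\end{cases}$$
   Context: Notation: $a\wedge b=\min(a,b)$, $a\vee b=\max(a,b)$; $\mathbb{1}_A$ is an indicator; $\|\cdot\|$ is the Euclidean norm; $\|\theta\|_0$ is the number of nonzero coordinates; $\mathbf{1}_p\in\mathbb{R}^p$ is the all-ones vector. $P_{\theta,\gamma}$ is the law under which $X\sim N(\theta,(1-\gamma)I_p+\gamma\mathbf{1}_p\mathbf{1}_p^\intercal)$ and, independently, $\xi\sim N(0,1)$. $\Theta(p,s,\varepsilon)=\{\theta\in\mathbb{R}^p:\|\theta\|\geq\varepsilon,\ \|\theta\|_0\leq s\}$. Transformed data: $\widetilde{X}:=\frac{1}{\sqrt{1-\gamma}}\left(I_p-\frac1p\mathbf{1}_p\mathbf{1}_p^\intercal\right)X+\frac{\xi}{\sqrt p}\mathbf{1}_p$. For $t\geq0$, $\alpha_t:=\frac{E(g^2\mathbb{1}_{\{|g|\geq t\}})}{P\{|g|\geq t\}}$ with $g\sim N(0,1)$, and $Y_t:=\sum_{i=1}^p(\widetilde{X}_i^2-\alpha_t)\mathbb{1}_{\{|\widetilde{X}_i|\geq t\}}$. Tests: $\varphi_{t,r}:=\mathbb{1}_{\{Y_t>r\}}$; $\varphi_r^{\chi^2}:=\mathbb{1}_{\{\|\widetilde{X}\|^2>p+r\sqrt p\}}$; $\varphi_r^{\mathbf{1}_p}:=\mathbb{1}_{\{\langle p^{-1/2}\mathbf{1}_p,X\rangle^2>(1-\gamma+\gamma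 p)(1+r)\}}$. The maxima in $\varphi_{\text{adaptive}}$ run over integers $s$ (a maximum over an empty set is $0$). For $s^*=p$ the logarithmic expression in $\psi^2$ is read as $+\infty$, so the minimum equals $1-\gamma+\gamma p$. If more than one case of $\psi^2$ applies (only $p=2$, $s^*=1$), the first applicable one is used. *)

theory Defs
  imports "HOL-Probability.Probability" "Jordan_Normal_Form.Gauss_Jordan_Elimination"
    "Jordan_Normal_Form.Determinant"
begin

text \<open>
  Vectors in \<open>\<real>\<^sup>p\<close> are functions in \<open>{..<p} \<rightarrow>\<^sub>E UNIV\<close>, so the coordinates \<open>1, \<dots>, p\<close> are
  numbered \<open>0, \<dots>, p - 1\<close>; the dimension is a term and can be quantified over.
\<close>

text \<open>
  The normal law \<open>N(\<mu>, \<Sigma>)\<close> on \<open>\<real>\<^sup>p\<close>, by its Lebesgue density. Meaningful only for a (symmetric)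
  positive definite \<open>p \<times> p\<close> matrix \<open>S\<close>, in which case the inverse exists and \<open>det S > 0\<close>.
\<close>

definition multivariate_normal :: "nat \<Rightarrow> (nat \<Rightarrow> real) \<Rightarrow> real mat \<Rightarrow> (nat \<Rightarrow> real) measure" where
  "multivariate_normal p \<mu> S =
     density (PiM {..<p} (\<lambda>_. lborel))
       (\<lambda>x. let v = Matrix.vec p (\<lambda>i. x i - \<mu> i) in
          ennreal (exp (- scalar_prod v (mult_mat_vec (the (mat_inverse S)) v) / 2)
                    / sqrt ((2 * pi) ^ p * Determinant.det S)))"

definition equicorrelation :: "nat \<Rightarrow> real \<Rightarrow> real mat" where
  "equicorrelation p \<gamma> = (1 - \<gamma>) \<cdot>\<^sub>m 1\<^sub>m p + \<gamma> \<cdot>\<^sub>m Matrix.mat p p (\<lambda>_. 1)"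

text \<open>The joint law \<open>P\<^bsub>\<theta>,\<gamma>\<^esub>\<close> of the pair \<open>(X, \<xi>)\<close>.\<close>

definition sample_law :: "nat \<Rightarrow> real \<Rightarrow> (nat \<Rightarrow> real) \<Rightarrow> ((nat \<Rightarrow> real) \<times> real) measure" where
  "sample_law p \<gamma> \<theta> = multivariate_normal p \<theta> (equicorrelation p \<gamma>) \<Otimes>\<^sub>M std_normal_distribution"

definition zero_vector :: "nat \<Rightarrow> nat \<Rightarrow> real" where
  "zero_vector p = (\<lambda>i\<in>{..<p}. 0)"

definition Theta :: "nat \<Rightarrow> nat \<Rightarrow> real \<Rightarrow> (nat \<Rightarrow> real) set" where
  "Theta p s \<epsilon> = {\<theta> \<in> {..<p} \<rightarrow>\<^sub>E UNIV. L2_set \<theta> {..<p} \<ge> \<epsilon> \<and> card {i \<in> {..<p}. \<theta> i \<noteq> 0} \<le> s}"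

fun X_tilde :: "nat \<Rightarrow> real \<Rightarrow> (nat \<Rightarrow> real) \<times> real \<Rightarrow> nat \<Rightarrow> real" where
  "X_tilde p \<gamma> (x, \<xi>) i =
     1 / sqrt (1 - \<gamma>) * (x i - 1 / real p * (\<Sum>j<p. x j)) + \<xi> / sqrt (real p)"

definition alpha :: "real \<Rightarrow> real" where
  "alpha t = (LINT g|std_normal_distribution. g\<^sup>2 * indicat_real {g. \<bar>g\<bar> \<ge> t} g)
               / measure std_normal_distribution {g. \<bar>g\<bar> \<ge> t}"

definition Y_stat :: "nat \<Rightarrow> real \<Rightarrow> real \<Rightarrow> (nat \<Rightarrow> real) \<times> real \<Rightarrow> real" where
  "Y_stat p \<gamma> t \<omega> =
     (\<Sum>i<p. ((X_tilde p \<gamma> \<omega> i)\<^sup>2 - alpha t) * indicat_real {x. \<bar>x\<bar> \<ge> t} (X_tilde p \<gamma> \<omega> i))"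

definition phi :: "nat \<Rightarrow> real \<Rightarrow> real \<Rightarrow> real \<Rightarrow> (nat \<Rightarrow> real) \<times> real \<Rightarrow> nat" where
  "phi p \<gamma> t r \<omega> = of_bool (Y_stat p \<gamma> t \<omega> > r)"

definition phi_chi2 :: "nat \<Rightarrow> real \<Rightarrow> real \<Rightarrow> (nat \<Rightarrow> real) \<times> real \<Rightarrow> nat" where
  "phi_chi2 p \<gamma> r \<omega> = of_bool ((L2_set (X_tilde p \<gamma> \<omega>) {..<p})\<^sup>2 > real p + r * sqrt (real p))"

definition phi_ones :: "nat \<Rightarrow> real \<Rightarrow> real \<Rightarrow> (nat \<Rightarrow> real) \<times> real \<Rightarrow> nat" where
  "phi_ones p \<gamma> r \<omega> =
     of_bool ((\<Sum>i<p. 1 / sqrt (real p) * fst \<omega> i)\<^sup>2 > (1 - \<gamma> + \<gamma> * real p) * (1 + r))"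

definition t_sparse :: "nat \<Rightarrow> nat \<Rightarrow> real" where
  "t_sparse p s = sqrt (2 * ln (1 + real p / (real s)\<^sup>2))"

definition t_dense :: "nat \<Rightarrow> nat \<Rightarrow> real" where
  "t_dense p s = sqrt (2 * ln (1 + real p / (real p - real s)\<^sup>2))"

definition r_sparse :: "real \<Rightarrow> nat \<Rightarrow> nat \<Rightarrow> real" where
  "r_sparse C p s = C\<^sup>2 / 32 * real s * ln (1 + real p / (real s)\<^sup>2)"

definition r_dense :: "real \<Rightarrow> nat \<Rightarrow> nat \<Rightarrow> real" where
  "r_dense C p s = C\<^sup>2 / 8 * (real p - real s) * ln (1 + real p / (real p - real s)\<^sup>2)"

text \<open>Inserting \<open>0\<close> gives the value \<open>0\<close> to a maximum of tests over an empty set.\<close>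

definition phi_adaptive :: "real \<Rightarrow> nat \<Rightarrow> real \<Rightarrow> (nat \<Rightarrow> real) \<times> real \<Rightarrow> nat" where
  "phi_adaptive C p \<gamma> \<omega> =
     max (Max (insert 0 ((\<lambda>s. phi p \<gamma> (t_sparse p s) (r_sparse C p s) \<omega>) `
            {s. 1 \<le> s \<and> real s < sqrt (real p)})))
    (max (phi_chi2 p \<gamma> (C\<^sup>2 / 2) \<omega>)
    (max (Max (insert 0 ((\<lambda>s. phi p \<gamma> (t_dense p s) (r_dense C p s) \<omega>) `
            {s. real p - sqrt (real p) < real s \<and> s < p})))
         (phi_ones p \<gamma> (C\<^sup>2 / 2) \<omega>)))"

text \<open>
  For \<open>s = p\<close> the logarithmic term of the last case is \<open>+\<infinity>\<close>, and the minimum is its other argument.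
\<close>

definition psi2 :: "nat \<Rightarrow> real \<Rightarrow> nat \<Rightarrow> real" where
  "psi2 p \<gamma> s =
     (if real s < sqrt (real p) then
        (1 - \<gamma>) * real s * ln (1 + real p / (real s)\<^sup>2)
      else if real s \<le> real p - sqrt (real p) then
        (1 - \<gamma>) * sqrt (real p)
          + min ((1 - \<gamma>) * real p powr (3/2) / (real p - real s)) (1 - \<gamma> + \<gamma> * real p)
      else
        (1 - \<gamma>) * sqrt (real p)
          + (if s = p then 1 - \<gamma> + \<gamma> * real p
             else min ((1 - \<gamma>) * real p * ln (1 + real p / (real p - real s)\<^sup>2))
                      (1 - \<gamma> + \<gamma> * real p)))"

definition psi :: "nat \<Rightarrow> real \<Rightarrow> nat \<Rightarrow> real" where
  "psi p \<gamma> s = sqrt (psi2 p \<gamma> s)"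

end

theory Submission
  imports Defs "HOL-Real_Asymp.Real_Asymp"
begin

text \<open>
  Write \<open>\<theta>'\<close> for the mean of the coordinates of \<open>\<theta>\<close>. Under \<open>P\<^bsub>\<theta>,\<gamma>\<^esub>\<close> the data admit the one-factor
  representation \<open>X = \<theta> + sqrt (1 - \<gamma>) z + sqrt \<gamma> w\<close> with independent standard normal \<open>z\<close> (a vector)
  and \<open>w\<close> (a common scalar). Centring removes \<open>w\<close>, and \<open>\<xi>\<close> supplies a fresh standard normal component
  in the direction of the constant vectors, so the transformed data are exactly \<open>N(\<mu>, I)\<close> with
  \<open>\<mu> = (\<theta> - \<theta>') / sqrt (1 - \<gamma>)\<close> (lemma \<open>X_tilde_law\<close>). Moreover
  \<open>(1 - \<gamma>) \<bar>\<mu>\<bar>\<^sup>2 + p \<theta>'\<^sup>2 = \<bar>\<theta>\<bar>\<^sup>2\<close>. Apart from one use of a maximal inequality, the error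
  probabilities are bounded with first and second moments and Chebyshev's inequality.

  The analysis of \<open>Y\<^sub>t\<close> reduces to a single coordinate. Let \<open>f(x) = (x\<^sup>2 - \<alpha>\<^sub>t) 1{\<bar>x\<bar> \<ge> t}\<close>. The value
  \<open>\<alpha>\<^sub>t\<close> makes \<open>E f(g) = 0\<close>, and \<open>t\<^sup>2 \<le> \<alpha>\<^sub>t \<le> t\<^sup>2 + 2\<close> for \<open>t \<ge> 1\<close> by the Mills ratio;
  all levels in use satisfy \<open>t\<^sup>2 \<ge> 2 log 2 \<ge> 1\<close>. Since \<open>f\<close> is even,
  \<open>E f(m + g)\<close> is the mean of \<open>f(g) cosh(m g)\<close> up to a factor; \<open>f\<close> and \<open>cosh(m x) - cosh(m sqrt \<alpha>\<^sub>t)\<close>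
  have the same sign, hence \<open>E f(m + g) \<ge> 0\<close> for every \<open>m\<close>, and a quantitative form of this remark
  gives the variance bound \<open>Var f(m + g) \<le> 54 t\<^sup>2 E f(m + g) + const * exp (- t\<^sup>2 / 2)\<close>
  (lemma \<open>thr_variance_le\<close>). Coordinates outside the part of the signal one looks at thus can only
  help, and their variance is paid for by their mean: if some set of at most \<open>k\<close> coordinates carries
  \<open>\<Sum> \<mu>\<^sub>i\<^sup>2 \<ge> B k log (1 + p / k\<^sup>2)\<close>, then the test with threshold \<open>t(k)\<close> misses the signal with probability
  \<open>O(1 / B)\<close> (lemma \<open>thr_sum_power\<close>).

  Under the null hypothesis the tests indexed by \<open>s > p - sqrt p\<close> are dominated by those indexed by
  \<open>p - s < sqrt p\<close>. A union bound over all \<open>s < sqrt p\<close> would not be uniform in \<open>p\<close>, because about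
  \<open>sqrt p\<close> of these tests have comparable error probabilities that do not decrease with \<open>p\<close>. However,
  with \<open>g\<close> for the transformed data, \<open>\<bar>g\<bar>\<^sup>2 - Y\<^sub>t\<close> is the conditional expectation of \<open>\<bar>g\<bar>\<^sup>2\<close> given the
  truncations \<open>min \<bar>g\<^sub>i\<bar> t\<close>, that is, a martingale in \<open>t\<close>. Kolmogorov's maximal inequality therefore
  controls a whole dyadic block
  \<open>sqrt p / 2^(i+1) \<le> s < sqrt p / 2^i\<close> at once, with error probability \<open>O(1 / (i + 1)\<^sup>2)\<close>, which is
  summable (lemmas \<open>thr_sum_maximal_inequality\<close> and \<open>thr_sum_null_tail\<close>).

  For the alternative there are three regimes. In the sparse one, at least a quarter of
  \<open>\<bar>\<theta>\<bar>\<^sup>2 / (1 - \<gamma>)\<close> remains in the coordinates of \<open>\<mu>\<close> on the support of \<open>\<theta>\<close>. In the other two, if neither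
  the chi-square test nor the test along the constant direction succeeds, then \<open>\<theta>'\<^sup>2\<close> is large compared
  with \<open>1 - \<gamma>\<close>, and each of the \<open>p - s\<close> zeros of \<open>\<theta>\<close> is a coordinate with \<open>\<mu>\<^sub>i\<^sup>2 = \<theta>'\<^sup>2 / (1 - \<gamma>)\<close>: this is
  impossible in the intermediate regime and detected by the dense test in the last one.
\<close>

section \<open>The standard normal distribution\<close>

abbreviation std :: "real measure" where "std \<equiv> std_normal_distribution"

lemma prob_space_std: "prob_space std"
  by (rule prob_space_normal_density) simp

lemma sets_std [simp, measurable_cong]: "sets std = sets borel" by simp

lemma integrable_std_iff:
  assumes [measurable]: "f \<in> borel_measurable borel"
  shows "integrable std f \<longleftrightarrow> integrable lborel (\<lambda>x. std_normal_density x * (f x :: real))"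
  by (subst integrable_real_density) (auto simp: normal_density_nonneg)

lemma integral_std:
  assumes [measurable]: "f \<in> borel_measurable borel"
  shows "integral\<^sup>L std f = (\<integral>x. std_normal_density x * (f x :: real) \<partial>lborel)"
  by (subst integral_real_density) (auto simp: normal_density_nonneg)

lemma std_normal_density_shift:
  "std_normal_density (m + x) * exp (m * (m + x) - m\<^sup>2 / 2) = std_normal_density x"
proof -
  have "exp (- (m + x)\<^sup>2 / 2) * exp (m * (m + x) - m\<^sup>2 / 2) = exp (- x\<^sup>2 / 2)"
    unfolding exp_add[symmetric] by (simp add: power2_eq_square algebra_simps add_divide_distrib diff_divide_distrib)
  then show ?thesis unfolding std_normal_density_def by (simp add: mult.assoc)
qed

text \<open>
  The one-dimensional Cameron--Martin formula.
\<close>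

lemma
  fixes f :: "real \<Rightarrow> real"
  assumes [measurable]: "f \<in> borel_measurable borel"
  shows integrable_std_shift:
      "integrable std (\<lambda>x. f (m + x)) \<longleftrightarrow> integrable std (\<lambda>x. exp (m * x - m\<^sup>2 / 2) * f x)"
    and integral_std_shift:
      "(\<integral>x. f (m + x) \<partial>std) = (\<integral>x. exp (m * x - m\<^sup>2 / 2) * f x \<partial>std)"
proof -
  let ?g = "\<lambda>x. std_normal_density x * (exp (m * x - m\<^sup>2 / 2) * f x)"
  have *: "?g (m + 1 * x) = std_normal_density x * f (m + x)" for x
    using std_normal_density_shift[of m x] by (simp flip: mult.assoc)
  show "integrable std (\<lambda>x. f (m + x)) \<longleftrightarrow> integrable std (\<lambda>x. exp (m * x - m\<^sup>2 / 2) * f x)"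
    using lborel_integrable_real_affine_iff[of 1 ?g m]
    by (subst (1 2) integrable_std_iff) (simp_all only: *, simp_all)
  show "(\<integral>x. f (m + x) \<partial>std) = (\<integral>x. exp (m * x - m\<^sup>2 / 2) * f x \<partial>std)"
    using lborel_integral_real_affine[of 1 ?g m]
    by (subst (1 2) integral_std) (simp_all only: *, simp_all)
qed

lemma
  fixes f :: "real \<Rightarrow> real"
  assumes [measurable]: "f \<in> borel_measurable borel"
  shows integrable_std_reflect: "integrable std (\<lambda>x. f (- x)) \<longleftrightarrow> integrable std f"
    and integral_std_reflect: "(\<integral>x. f (- x) \<partial>std) = integral\<^sup>L std f"
proof -
  let ?g = "\<lambda>x. std_normal_density x * f x"
  have *: "?g (0 + (-1) * x) = std_normal_density x * f (- x)" for x
    by (simp add: std_normal_density_def)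
  show "integrable std (\<lambda>x. f (- x)) \<longleftrightarrow> integrable std f"
    using lborel_integrable_real_affine_iff[of "-1" ?g 0]
    by (subst (1 2) integrable_std_iff) (simp_all only: *, simp_all)
  show "(\<integral>x. f (- x) \<partial>std) = integral\<^sup>L std f"
    using lborel_integral_real_affine[of "-1" ?g 0]
    by (subst (1 2) integral_std) (simp_all only: *, simp_all)
qed

text \<open>
  For an even function the Cameron--Martin density may be averaged over \<open>x\<close> and \<open>- x\<close>, which turns the
  exponential into a hyperbolic cosine.
\<close>

lemma
  fixes f :: "real \<Rightarrow> real"
  assumes f[measurable]: "f \<in> borel_measurable borel" and even: "\<And>x. f (- x) = f x"
    and int: "integrable std (\<lambda>x. f (m + x))"
  shows integrable_std_tilt: "integrable std (\<lambda>x. f x * cosh (m * x))"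
    and integral_std_tilt: "(\<integral>x. f (m + x) \<partial>std) = exp (- m\<^sup>2 / 2) * (\<integral>x. f x * cosh (m * x) \<partial>std)"
proof -
  let ?g = "\<lambda>x. exp (m * x - m\<^sup>2 / 2) * f x"
  have g: "integrable std ?g" using int by (simp add: integrable_std_shift)
  have g': "integrable std (\<lambda>x. ?g (- x))" using g by (subst integrable_std_reflect) auto
  have eq: "f x * cosh (m * x) = exp (m\<^sup>2 / 2) / 2 * (?g x + ?g (- x))" for x
  proof -
    have "exp (m\<^sup>2 / 2) * exp (m * x - m\<^sup>2 / 2) = exp (m * x)"
         "exp (m\<^sup>2 / 2) * exp (m * (- x) - m\<^sup>2 / 2) = exp (- (m * x))"
      unfolding exp_add[symmetric] by simp_all
    moreover have "exp (m\<^sup>2 / 2) / 2 * (?g x + ?g (- x))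
        = (exp (m\<^sup>2 / 2) * exp (m * x - m\<^sup>2 / 2) + exp (m\<^sup>2 / 2) * exp (m * (- x) - m\<^sup>2 / 2)) / 2 * f x"
      by (simp only: even) (simp add: algebra_simps)
    ultimately show ?thesis by (simp add: cosh_field_def)
  qed
  show "integrable std (\<lambda>x. f x * cosh (m * x))"
    unfolding eq using g g' by (intro integrable_mult_right integrable_add) auto
  have "(\<integral>x. f x * cosh (m * x) \<partial>std) = exp (m\<^sup>2 / 2) / 2 * (integral\<^sup>L std ?g + (\<integral>x. ?g (- x) \<partial>std))"
    unfolding eq using g g' by (subst integral_mult_right_zero) (simp add: Bochner_Integration.integral_add)
  also have "(\<integral>x. ?g (- x) \<partial>std) = integral\<^sup>L std ?g"
    by (rule integral_std_reflect) simp
  also have "integral\<^sup>L std ?g = (\<integral>x. f (m + x) \<partial>std)" by (simp add: integral_std_shift)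
  finally show "(\<integral>x. f (m + x) \<partial>std) = exp (- m\<^sup>2 / 2) * (\<integral>x. f x * cosh (m * x) \<partial>std)"
    by (simp add: exp_minus field_simps)
qed

lemma std_moments [simp]:
  "(\<integral>x. x \<partial>std) = 0" "(\<integral>x. x\<^sup>2 \<partial>std) = 1" "(\<integral>x. x ^ 3 \<partial>std) = 0" "(\<integral>x. x ^ 4 \<partial>std) = 3"
proof -
  show "(\<integral>x. x \<partial>std) = 0" using integral_std_normal_distribution_moment_odd[of 1] by simp
  show "(\<integral>x. x ^ 3 \<partial>std) = 0" using integral_std_normal_distribution_moment_odd[of 3] by simp
  show "(\<integral>x. x\<^sup>2 \<partial>std) = 1" using std_normal_distribution_even_moments(1)[of 1] by simp
  show "(\<integral>x. x ^ 4 \<partial>std) = 3" using std_normal_distribution_even_moments(1)[of 2]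
    by (simp add: fact_numeral)
qed

lemma integrable_std_powers [simp]:
  "integrable std (\<lambda>x. x)" "integrable std (\<lambda>x. x\<^sup>2)" "integrable std (\<lambda>x. x ^ 3)" "integrable std (\<lambda>x. x ^ 4)"
  using integrable_std_normal_distribution_moment[of 1] by (auto intro: integrable_std_normal_distribution_moment)

lemma measure_std_UNIV [simp]: "measure std UNIV = 1"
proof -
  interpret prob_space std by (rule prob_space_std)
  show ?thesis using prob_space by simp
qed

lemma integrable_std_const [simp]: "integrable std (\<lambda>_. c :: real)"
proof -
  interpret prob_space std by (rule prob_space_std)
  show ?thesis by simp
qed

lemmas integrable_std_intros =
  Bochner_Integration.integrable_add integrable_mult_right integrable_std_const integrable_std_powers

lemma power4_add_le: "(a + b) ^ 4 \<le> 8 * (a ^ 4 + b ^ 4)" for a b :: real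
proof -
  have "(a + b)\<^sup>2 \<le> 2 * (a\<^sup>2 + b\<^sup>2)" using sum_squares_bound[of a b] by (simp add: power2_sum)
  then have "((a + b)\<^sup>2)\<^sup>2 \<le> (2 * (a\<^sup>2 + b\<^sup>2))\<^sup>2" by (intro power_mono) auto
  also have "\<dots> = 4 * (a\<^sup>2 + b\<^sup>2)\<^sup>2" by (simp only: power_mult_distrib) simp
  also have "(a\<^sup>2 + b\<^sup>2)\<^sup>2 \<le> 2 * ((a\<^sup>2)\<^sup>2 + (b\<^sup>2)\<^sup>2)" using sum_squares_bound[of "a\<^sup>2" "b\<^sup>2"] by (simp add: power2_sum)
  finally show ?thesis by (simp flip: power_mult)
qed

lemma integrable_std_quartic:
  assumes [measurable]: "f \<in> borel_measurable borel" and bound: "\<And>x. \<bar>f x\<bar> \<le> a + b * x ^ 4"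
  shows "integrable std (\<lambda>x. f (m + x) :: real)"
proof (rule Bochner_Integration.integrable_bound)
  show "integrable std (\<lambda>x. \<bar>a\<bar> + \<bar>b\<bar> * (8 * (m ^ 4 + x ^ 4)))"
    by (intro integrable_std_intros)
  have "\<bar>f (m + x)\<bar> \<le> \<bar>a\<bar> + \<bar>b\<bar> * (8 * (m ^ 4 + x ^ 4))" for x
  proof -
    have "\<bar>f (m + x)\<bar> \<le> a + b * (m + x) ^ 4" by (rule bound)
    also have "\<dots> \<le> \<bar>a\<bar> + \<bar>b\<bar> * (m + x) ^ 4" by (intro add_mono mult_right_mono) auto
    also have "\<dots> \<le> \<bar>a\<bar> + \<bar>b\<bar> * (8 * (m ^ 4 + x ^ 4))" by (intro add_mono mult_left_mono power4_add_le) auto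
    finally show ?thesis .
  qed
  then show "AE x in std. norm (f (m + x)) \<le> norm (\<bar>a\<bar> + \<bar>b\<bar> * (8 * (m ^ 4 + x ^ 4)))"
    by (intro AE_I2) (smt (verit) real_norm_def)
qed simp

section \<open>The thresholded statistic in one coordinate\<close>

text \<open>
  The contribution of one coordinate to the statistic \<open>Y\<^sub>t\<close>.
\<close>

definition thr :: "real \<Rightarrow> real \<Rightarrow> real" where
  "thr t x = (x\<^sup>2 - alpha t) * indicat_real {x. \<bar>x\<bar> \<ge> t} x"

lemma thr_measurable [measurable]: "thr t \<in> borel_measurable borel"
  unfolding thr_def by measurable

lemma thr_even: "thr t (- x) = thr t x" by (simp add: thr_def indicator_def)

lemma square_le_quartic: "x\<^sup>2 \<le> 1 + x ^ 4" for x :: real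
proof -
  have "2 * x\<^sup>2 \<le> x ^ 4 + 1" using sum_squares_bound[of "x\<^sup>2" 1] by (simp flip: power_mult)
  then show ?thesis using zero_le_power2[of x] by linarith
qed

lemma thr_square_le: "(thr t x)\<^sup>2 \<le> 2 * (alpha t)\<^sup>2 + 2 * x ^ 4"
proof -
  have "(thr t x)\<^sup>2 \<le> (x\<^sup>2 - alpha t)\<^sup>2" by (simp add: thr_def indicator_def)
  also have "\<dots> \<le> 2 * (alpha t)\<^sup>2 + 2 * (x\<^sup>2)\<^sup>2"
    using sum_squares_bound[of "x\<^sup>2" "- alpha t"] by (simp add: power2_diff)
  finally show ?thesis by (simp flip: power_mult)
qed

lemma integrable_thr_square: "integrable std (\<lambda>x. (thr t (m + x))\<^sup>2)"
  by (rule integrable_std_quartic[where f = "\<lambda>x. (thr t x)\<^sup>2" and a = "2 * (alpha t)\<^sup>2" and b = 2])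
     (use thr_square_le in auto)

lemma integrable_thr: "integrable std (\<lambda>x. thr t (m + x))"
proof (rule integrable_std_quartic[where a = "1 + \<bar>alpha t\<bar>" and b = 1])
  fix x
  have "\<bar>thr t x\<bar> \<le> \<bar>x\<^sup>2 - alpha t\<bar>" by (simp add: thr_def indicator_def)
  also have "\<dots> \<le> x\<^sup>2 + \<bar>alpha t\<bar>" using zero_le_power2[of x] by linarith
  finally show "\<bar>thr t x\<bar> \<le> 1 + \<bar>alpha t\<bar> + 1 * x ^ 4" using square_le_quartic[of x] by simp
qed simp

lemma measure_std_tail_pos: "measure std {g. \<bar>g\<bar> \<ge> t} > 0"
proof (rule ccontr)
  assume "\<not> ?thesis"
  then have "measure std {g. \<bar>g\<bar> \<ge> t} = 0" using measure_nonneg[of std "{g. \<bar>g\<bar> \<ge> t}"] by linarith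
  interpret prob_space std by (rule prob_space_std)
  have "{g. \<bar>g\<bar> \<ge> t} \<in> null_sets std"
    using \<open>measure std {g. \<bar>g\<bar> \<ge> t} = 0\<close> by (auto simp: null_sets_def emeasure_eq_measure)
  then have "AE x in lborel. x \<notin> {g. \<bar>g\<bar> \<ge> t}"
    by (subst (asm) null_sets_density_iff) (auto simp: normal_density_pos not_le less_imp_neq[symmetric])
  then have "emeasure lborel {g. \<bar>g\<bar> \<ge> t} = 0"
    by (subst (asm) AE_iff_measurable[where N = "{g. \<bar>g\<bar> \<ge> t}"]) auto
  moreover have "emeasure lborel {\<bar>t\<bar>..\<bar>t\<bar> + 1} \<le> emeasure lborel {g. \<bar>g\<bar> \<ge> t}"
    by (intro emeasure_mono) auto
  ultimately show False by simp
qed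

lemma integrable_std_indicator [simp]:
  "integrable std (indicat_real {x. \<bar>x\<bar> \<ge> t})" "integrable std (\<lambda>x. x\<^sup>2 * indicat_real {x. \<bar>x\<bar> \<ge> t} x)"
proof -
  show "integrable std (indicat_real {x. \<bar>x\<bar> \<ge> t})"
    by (rule integrable_std_quartic[of "indicat_real {x. \<bar>x\<bar> \<ge> t}" 1 0 0, unfolded add_0_left])
      (auto simp: indicator_def)
  show "integrable std (\<lambda>x. x\<^sup>2 * indicat_real {x. \<bar>x\<bar> \<ge> t} x)"
    by (rule integrable_std_quartic[of "\<lambda>x. x\<^sup>2 * indicat_real {x. \<bar>x\<bar> \<ge> t} x" 1 1 0, unfolded add_0_left])
      (use square_le_quartic in \<open>auto simp: indicator_def\<close>)
qed

lemma alpha_mult: "alpha t * measure std {g. \<bar>g\<bar> \<ge> t} = (\<integral>x. x\<^sup>2 * indicat_real {x. \<bar>x\<bar> \<ge> t} x \<partial>std)"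
  using measure_std_tail_pos[of t] by (simp add: alpha_def)

lemma integral_thr: "(\<integral>x. thr t x \<partial>std) = 0"
  unfolding thr_def left_diff_distrib
  by (subst Bochner_Integration.integral_diff) (auto simp: alpha_mult[symmetric])

lemma alpha_ge:
  assumes "0 \<le> t" shows "t\<^sup>2 \<le> alpha t"
proof -
  have "(\<integral>x. t\<^sup>2 * indicat_real {x. \<bar>x\<bar> \<ge> t} x \<partial>std) \<le> (\<integral>x. x\<^sup>2 * indicat_real {x. \<bar>x\<bar> \<ge> t} x \<partial>std)"
    using assms by (intro integral_mono integrable_mult_right integrable_std_indicator)
      (auto simp: indicator_def abs_le_square_iff[symmetric])
  then have "t\<^sup>2 * measure std {g. \<bar>g\<bar> \<ge> t} \<le> alpha t * measure std {g. \<bar>g\<bar> \<ge> t}"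
    by (simp add: alpha_mult)
  then show ?thesis using measure_std_tail_pos[of t] by (simp add: mult_le_cancel_right)
qed

lemma std_density_deriv: "(std_normal_density has_real_derivative (- x * std_normal_density x)) (at x)"
  unfolding std_normal_density_def by (auto intro!: derivative_eq_intros simp: field_simps)

lemma std_density_tendsto: "((\<lambda>x. x ^ k * std_normal_density x) \<longlongrightarrow> 0) at_top"
proof -
  have "((\<lambda>x. (1 / sqrt (2 * pi)) * (x ^ k * exp (- x\<^sup>2 / 2))) \<longlongrightarrow> 0) at_top"
    by (intro tendsto_mult_right_zero) real_asymp
  then show ?thesis by (simp add: std_normal_density_def field_simps)
qed

lemma
  fixes h :: "real \<Rightarrow> real"
  assumes h[measurable]: "h \<in> borel_measurable borel"
    and F: "\<And>x. a \<le> x \<Longrightarrow> (F has_real_derivative h x * std_normal_density x) (at x)"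
    and nonneg: "\<And>x. a \<le> x \<Longrightarrow> 0 \<le> h x" and lim: "(F \<longlongrightarrow> 0) at_top"
  shows std_integral_FTC_atLeast: "integrable std (\<lambda>x. h x * indicat_real {a..} x)"
      "(\<integral>x. h x * indicat_real {a..} x \<partial>std) = - F a"
proof -
  let ?f = "\<lambda>x. std_normal_density x * (h x * indicat_real {a..} x)"
  have "(\<integral>\<^sup>+x\<in>{a..}. ennreal (h x * std_normal_density x) \<partial>lborel) = ennreal (0 - F a)"
    by (rule nn_integral_FTC_atLeast) (use F nonneg lim in auto)
  moreover have "ennreal (?f x) = ennreal (h x * std_normal_density x) * indicator {a..} x" for x
    by (simp add: indicator_def mult.commute)
  ultimately have nn: "(\<integral>\<^sup>+x. ennreal (?f x) \<partial>lborel) = ennreal (- F a)" by simp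
  have "F a \<le> 0"
  proof (rule tendsto_lowerbound[OF lim])
    show "\<forall>\<^sub>F x in at_top. F a \<le> F x"
      using eventually_ge_at_top[of a]
    proof eventually_elim
      case (elim x)
      show ?case
      proof (rule DERIV_nonneg_imp_nondecreasing[OF elim])
        show "\<exists>y. (F has_real_derivative y) (at x) \<and> 0 \<le> y" if "a \<le> x" for x
          using F[OF that] nonneg[OF that] by (intro exI[of _ "h x * std_normal_density x"]) auto
      qed
    qed
  qed simp
  then have "has_bochner_integral lborel ?f (- F a)"
    using nn nonneg by (intro has_bochner_integral_nn_integral) (auto simp: indicator_def)
  then show "integrable std (\<lambda>x. h x * indicat_real {a..} x)"
      "(\<integral>x. h x * indicat_real {a..} x \<partial>std) = - F a"
    by (auto simp: has_bochner_integral_iff integrable_std_iff integral_std)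
qed

text \<open>
  The upper bound is equivalent to the Mills ratio estimate. Both sides are obtained from explicit
  antiderivatives of non-negative functions on \<open>[t, \<infinity>)\<close>, with \<open>\<phi>\<close> the normal density:
  \<open>(x\<^sup>2 - 1) \<phi>(x)\<close> is the derivative of \<open>- x \<phi>(x)\<close>, and \<open>(1 + 1 / x\<^sup>2) \<phi>(x)\<close> that of \<open>- \<phi>(x) / x\<close>.
\<close>

lemma alpha_le:
  assumes "1 \<le> t" shows "alpha t \<le> t\<^sup>2 + 2"
proof -
  let ?d = std_normal_density
  let ?I = "\<lambda>x. indicat_real {t..} x"
  have i1: "integrable std (\<lambda>x. (x\<^sup>2 - 1) * ?I x)" and v1: "(\<integral>x. (x\<^sup>2 - 1) * ?I x \<partial>std) = t * ?d t"
  proof -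
    have d: "((\<lambda>x. - (x * ?d x)) has_real_derivative (x\<^sup>2 - 1) * ?d x) (at x)" for x
      by (auto intro!: derivative_eq_intros std_density_deriv simp: power2_eq_square algebra_simps)
    have nn: "0 \<le> x\<^sup>2 - 1" if "t \<le> x" for x
      using that assms by (auto simp: one_le_power)
    have l: "((\<lambda>x. - (x * ?d x)) \<longlongrightarrow> 0) at_top"
      using tendsto_minus[OF std_density_tendsto[of 1]] by simp
    note * = std_integral_FTC_atLeast[OF _ d nn l]
    show "integrable std (\<lambda>x. (x\<^sup>2 - 1) * ?I x)" by (rule *) auto
    show "(\<integral>x. (x\<^sup>2 - 1) * ?I x \<partial>std) = t * ?d t" by (subst *) auto
  qed
  have i2: "integrable std (\<lambda>x. (1 + 1 / x\<^sup>2) * ?I x)" and v2: "(\<integral>x. (1 + 1 / x\<^sup>2) * ?I x \<partial>std) = ?d t / t"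
  proof -
    have d: "((\<lambda>x. - (?d x / x)) has_real_derivative (1 + 1 / x\<^sup>2) * ?d x) (at x)" if "t \<le> x" for x
      using that assms
      by (auto intro!: derivative_eq_intros std_density_deriv simp: power2_eq_square field_simps)
    have "((\<lambda>x. ?d x / x) \<longlongrightarrow> 0) at_top"
      using std_density_tendsto[of 0] by (intro tendsto_divide_0 filterlim_at_top_imp_at_infinity filterlim_ident) simp
    from tendsto_minus[OF this] have l: "((\<lambda>x. - (?d x / x)) \<longlongrightarrow> 0) at_top" by simp
    note * = std_integral_FTC_atLeast[OF _ d _ l]
    show "integrable std (\<lambda>x. (1 + 1 / x\<^sup>2) * ?I x)" by (rule *) auto
    show "(\<integral>x. (1 + 1 / x\<^sup>2) * ?I x \<partial>std) = ?d t / t" by (subst *) auto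
  qed
  have i3: "integrable std ?I"
    by (rule integrable_std_quartic[of "?I" 1 0 0, unfolded add_0_left]) (auto simp: indicator_def)
  have "t * ?d t = t\<^sup>2 * (?d t / t)" using assms by (simp add: power2_eq_square)
  also have "\<dots> = t\<^sup>2 * (\<integral>x. (1 + 1 / x\<^sup>2) * ?I x \<partial>std)" by (simp only: v2)
  also have "\<dots> \<le> t\<^sup>2 * (\<integral>x. (1 + 1 / t\<^sup>2) * ?I x \<partial>std)"
  proof (intro mult_left_mono integral_mono i2 integrable_mult_right i3)
    fix x show "(1 + 1 / x\<^sup>2) * ?I x \<le> (1 + 1 / t\<^sup>2) * ?I x"
      using assms by (auto simp: indicator_def intro!: divide_left_mono power_mono)
  qed simp
  also have "\<dots> = t\<^sup>2 * (1 + 1 / t\<^sup>2) * integral\<^sup>L std ?I" by simp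
  also have "t\<^sup>2 * (1 + 1 / t\<^sup>2) = t\<^sup>2 + 1" using assms by (simp add: field_simps)
  finally have half: "(\<integral>x. (x\<^sup>2 - 1) * ?I x \<partial>std) \<le> (t\<^sup>2 + 1) * integral\<^sup>L std ?I" by (simp add: v1)
  \<comment> \<open>The integrand on the left half-line is the reflection of the one on the right.\<close>
  let ?J = "\<lambda>x. (t\<^sup>2 + 1) * ?I x - (x\<^sup>2 - 1) * ?I x"
  have J: "integrable std ?J" using i1 i3 by auto
  have J0: "integral\<^sup>L std ?J \<ge> 0"
    using half i1 i3 by (subst Bochner_Integration.integral_diff) auto
  have J': "integrable std (\<lambda>x. ?J (- x))" using J by (subst integrable_std_reflect) auto
  have eq: "(t\<^sup>2 + 2) * indicat_real {x. \<bar>x\<bar> \<ge> t} x - x\<^sup>2 * indicat_real {x. \<bar>x\<bar> \<ge> t} x = ?J x + ?J (- x)" for x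
    using assms by (auto simp: indicator_def algebra_simps)
  have "(t\<^sup>2 + 2) * measure std {g. \<bar>g\<bar> \<ge> t} - alpha t * measure std {g. \<bar>g\<bar> \<ge> t}
      = (\<integral>x. ?J x + ?J (- x) \<partial>std)"
    unfolding eq[symmetric] alpha_mult
    by (subst Bochner_Integration.integral_diff) auto
  also have "\<dots> = integral\<^sup>L std ?J + (\<integral>x. ?J (- x) \<partial>std)" using J J' by (rule Bochner_Integration.integral_add)
  also have "(\<integral>x. ?J (- x) \<partial>std) = integral\<^sup>L std ?J" by (rule integral_std_reflect) simp
  finally have "alpha t * measure std {g. \<bar>g\<bar> \<ge> t} \<le> (t\<^sup>2 + 2) * measure std {g. \<bar>g\<bar> \<ge> t}"
    using J0 by simp
  then show ?thesis using measure_std_tail_pos[of t] by (simp add: mult_le_cancel_right)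
qed

text \<open>
  The constant \<open>\<alpha>\<^sub>t\<close> is the mean of \<open>g\<^sup>2\<close> given \<open>\<bar>g\<bar> \<ge> t\<close>, so replacing it by any other constant, here
  \<open>t\<^sup>2\<close>, increases the second moment.
\<close>

lemma thr_second_moment_le_tail:
  assumes "0 \<le> t"
  shows "(\<integral>x. (thr t x)\<^sup>2 \<partial>std) \<le> (\<integral>x. (x\<^sup>2 - t\<^sup>2)\<^sup>2 * indicat_real {x. \<bar>x\<bar> \<ge> t} x \<partial>std)"
proof -
  let ?I = "indicat_real {x. \<bar>x\<bar> \<ge> t}" and ?c = "alpha t - t\<^sup>2"
  have eq: "(x\<^sup>2 - t\<^sup>2)\<^sup>2 * ?I x = (thr t x)\<^sup>2 + 2 * ?c * thr t x + ?c\<^sup>2 * ?I x" for x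
    by (auto simp: thr_def indicator_def power2_eq_square algebra_simps)
  have "(\<integral>x. (x\<^sup>2 - t\<^sup>2)\<^sup>2 * ?I x \<partial>std)
      = (\<integral>x. (thr t x)\<^sup>2 \<partial>std) + 2 * ?c * (\<integral>x. thr t x \<partial>std) + ?c\<^sup>2 * measure std {x. \<bar>x\<bar> \<ge> t}"
    unfolding eq using integrable_thr_square[of t 0] integrable_thr[of t 0] by simp
  then show ?thesis by (simp add: integral_thr)
qed

lemma square_times_exp_le: "0 \<le> y \<Longrightarrow> y\<^sup>2 * exp (- y) \<le> 2" for y :: real
  using exp_lower_Taylor_quadratic[of y] by (simp add: exp_minus field_simps)

lemma std_tail_square_le:
  assumes "0 \<le> t"
  shows "(\<integral>x. (x\<^sup>2 - t\<^sup>2)\<^sup>2 * indicat_real {x. \<bar>x\<bar> \<ge> t} x \<partial>std) \<le> 44 * exp (- t\<^sup>2 / 2)"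
proof -
  define F where "F x = (x\<^sup>2 - t\<^sup>2)\<^sup>2 * indicat_real {t..} x" for x
  have [measurable]: "F \<in> borel_measurable borel" unfolding F_def by measurable
  have F_bound: "\<bar>F x\<bar> \<le> 2 * t ^ 4 + 2 * x ^ 4" for x
  proof -
    have "\<bar>F x\<bar> \<le> (x\<^sup>2 - t\<^sup>2)\<^sup>2" by (simp add: F_def indicator_def)
    also have "\<dots> \<le> 2 * (t\<^sup>2)\<^sup>2 + 2 * (x\<^sup>2)\<^sup>2"
      using sum_squares_bound[of "x\<^sup>2" "- t\<^sup>2"] by (simp add: power2_diff)
    finally show ?thesis by (simp flip: power_mult)
  qed
  have F_int: "integrable std F"
    using integrable_std_quartic[of F "2 * t ^ 4" 2 0] F_bound by simp
  \<comment> \<open>Shifting by \<open>t\<close> produces the factor \<open>exp (- t\<^sup>2 / 2 - t x)\<close> on \<open>x \<ge> 0\<close>.\<close>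
  define f where "f y = F y * exp (- t * y + t\<^sup>2 / 2)" for y
  have [measurable]: "f \<in> borel_measurable borel" unfolding f_def by measurable
  have F_f: "exp (t * x - t\<^sup>2 / 2) * f x = F x" for x
    unfolding f_def by (simp add: mult.left_commute flip: exp_add)
  have f_int: "integrable std (\<lambda>x. f (t + x))"
    using F_int by (simp add: integrable_std_shift F_f)
  have "integral\<^sup>L std F = (\<integral>x. f (t + x) \<partial>std)" by (simp add: integral_std_shift F_f)
  also have "\<dots> \<le> (\<integral>x. exp (- t\<^sup>2 / 2) * (2 * x ^ 4 + 16) \<partial>std)"
  proof (rule integral_mono[OF f_int])
    show "integrable std (\<lambda>x. exp (- t\<^sup>2 / 2) * (2 * x ^ 4 + 16))"
      by (intro integrable_mult_right Bochner_Integration.integrable_add integrable_std_const integrable_std_powers)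
    fix x
    show "f (t + x) \<le> exp (- t\<^sup>2 / 2) * (2 * x ^ 4 + 16)"
    proof (cases "0 \<le> x")
      case True
      have "((t + x)\<^sup>2 - t\<^sup>2)\<^sup>2 = (x\<^sup>2 + 2 * (t * x))\<^sup>2" by (simp add: power2_eq_square algebra_simps)
      also have "\<dots> \<le> 2 * (x\<^sup>2)\<^sup>2 + 2 * (2 * (t * x))\<^sup>2"
        using sum_squares_bound[of "x\<^sup>2" "2 * (t * x)"] by (simp add: power2_sum)
      finally have "((t + x)\<^sup>2 - t\<^sup>2)\<^sup>2 \<le> 2 * x ^ 4 + 8 * (t * x)\<^sup>2" by (simp add: power_mult_distrib)
      then have "((t + x)\<^sup>2 - t\<^sup>2)\<^sup>2 * exp (- (t * x)) \<le> (2 * x ^ 4 + 8 * (t * x)\<^sup>2) * exp (- (t * x))"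
        by (rule mult_right_mono) simp
      also have "\<dots> = 2 * x ^ 4 * exp (- (t * x)) + 8 * ((t * x)\<^sup>2 * exp (- (t * x)))"
        by (simp add: algebra_simps)
      also have "\<dots> \<le> 2 * x ^ 4 * 1 + 8 * 2"
        using True assms by (intro add_mono mult_left_mono square_times_exp_le) auto
      finally have "((t + x)\<^sup>2 - t\<^sup>2)\<^sup>2 * exp (- (t * x)) \<le> 2 * x ^ 4 + 16" by simp
      then have *: "exp (- t\<^sup>2 / 2) * (((t + x)\<^sup>2 - t\<^sup>2)\<^sup>2 * exp (- (t * x))) \<le> exp (- t\<^sup>2 / 2) * (2 * x ^ 4 + 16)"
        by (rule mult_left_mono) simp
      have "- t * (t + x) + t\<^sup>2 / 2 = - t\<^sup>2 / 2 + - (t * x)"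
        by (simp add: power2_eq_square algebra_simps)
      then have "exp (- t * (t + x) + t\<^sup>2 / 2) = exp (- t\<^sup>2 / 2) * exp (- (t * x))"
        by (simp only: exp_add)
      then have "f (t + x) = exp (- t\<^sup>2 / 2) * (((t + x)\<^sup>2 - t\<^sup>2)\<^sup>2 * exp (- (t * x)))"
        using True unfolding f_def F_def by simp
      with * show ?thesis by simp
    next
      case False
      then show ?thesis by (simp add: f_def F_def)
    qed
  qed
  also have "\<dots> = 22 * exp (- t\<^sup>2 / 2)" by simp
  finally have half: "integral\<^sup>L std F \<le> 22 * exp (- t\<^sup>2 / 2)" .
  have F_refl: "integrable std (\<lambda>x. F (- x))" using F_int by (subst integrable_std_reflect) auto
  have F2: "integrable std (\<lambda>x. F x + F (- x))" using F_int F_refl by simp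
  have "(\<integral>x. (x\<^sup>2 - t\<^sup>2)\<^sup>2 * indicat_real {x. \<bar>x\<bar> \<ge> t} x \<partial>std) \<le> (\<integral>x. F x + F (- x) \<partial>std)"
  proof (rule integral_mono[OF _ F2])
    show "integrable std (\<lambda>x. (x\<^sup>2 - t\<^sup>2)\<^sup>2 * indicat_real {x. \<bar>x\<bar> \<ge> t} x)"
      by (rule Bochner_Integration.integrable_bound[OF F2]) (auto simp: F_def indicator_def)
  qed (auto simp: F_def indicator_def)
  also have "\<dots> = integral\<^sup>L std F + (\<integral>x. F (- x) \<partial>std)" using F_int F_refl by (rule Bochner_Integration.integral_add)
  also have "(\<integral>x. F (- x) \<partial>std) = integral\<^sup>L std F" by (rule integral_std_reflect) simp
  finally show ?thesis using half by simp
qed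

lemma thr_second_moment_le: "0 \<le> t \<Longrightarrow> (\<integral>x. (thr t x)\<^sup>2 \<partial>std) \<le> 44 * exp (- t\<^sup>2 / 2)"
  using thr_second_moment_le_tail std_tail_square_le by (rule order_trans)

lemma std_fourth_moment_tail_le:
  assumes "0 \<le> t"
  shows "(\<integral>x. x ^ 4 * indicat_real {x. \<bar>x\<bar> \<ge> 2 * t} x \<partial>std) \<le> 192 * exp (- t\<^sup>2 / 2)"
proof -
  let ?f = "\<lambda>x. x ^ 4 * indicat_real {x. \<bar>x\<bar> \<ge> 2 * t} x"
  have int: "integrable std ?f"
    using integrable_std_quartic[of ?f 0 1 0] by (simp add: indicator_def)
  have "integral\<^sup>L std ?f = (\<integral>x. std_normal_density x * ?f x \<partial>lborel)" by (rule integral_std) simp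
  also have "\<dots> \<le> (\<integral>x. 128 * sqrt 2 * exp (- t\<^sup>2 / 2) * normal_density 0 (sqrt 2) x \<partial>lborel)"
  proof (rule integral_mono)
    show "integrable lborel (\<lambda>x. std_normal_density x * ?f x)"
      using int by (subst (asm) integrable_std_iff) auto
    show "integrable lborel (\<lambda>x. 128 * sqrt 2 * exp (- t\<^sup>2 / 2) * normal_density 0 (sqrt 2) x)"
      by (intro integrable_mult_right integrable_normal_density) simp
    fix x :: real
    have "x ^ 4 \<le> 128 * exp (x\<^sup>2 / 8)"
    proof -
      have "1 + x\<^sup>2 / 8 + (x\<^sup>2 / 8)\<^sup>2 / 2 \<le> exp (x\<^sup>2 / 8)"
        by (rule exp_lower_Taylor_quadratic) simp
      moreover have "(x\<^sup>2 / 8)\<^sup>2 = x ^ 4 / 64" by (simp add: power2_eq_square power4_eq_xxxx)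
      ultimately show ?thesis using zero_le_power2[of x] by linarith
    qed
    also have "\<dots> \<le> 128 * exp (x\<^sup>2 / 4 - t\<^sup>2 / 2)" if "\<bar>x\<bar> \<ge> 2 * t"
    proof -
      have "(2 * t)\<^sup>2 \<le> \<bar>x\<bar>\<^sup>2" using that \<open>0 \<le> t\<close> by (intro power_mono) auto
      then show ?thesis by (simp add: power_mult_distrib)
    qed
    finally have "?f x \<le> 128 * exp (x\<^sup>2 / 4 - t\<^sup>2 / 2)" by (simp add: indicator_def)
    then have "std_normal_density x * ?f x \<le> std_normal_density x * (128 * exp (x\<^sup>2 / 4 - t\<^sup>2 / 2))"
      by (rule mult_left_mono) simp
    also have "\<dots> = 128 / sqrt (2 * pi) * (exp (- x\<^sup>2 / 2) * exp (x\<^sup>2 / 4 - t\<^sup>2 / 2))"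
      by (simp add: std_normal_density_def)
    also have "exp (- x\<^sup>2 / 2) * exp (x\<^sup>2 / 4 - t\<^sup>2 / 2) = exp (- t\<^sup>2 / 2) * exp (- x\<^sup>2 / 4)"
      unfolding exp_add[symmetric] by simp
    also have "128 / sqrt (2 * pi) * (exp (- t\<^sup>2 / 2) * exp (- x\<^sup>2 / 4))
        = 128 * sqrt 2 * exp (- t\<^sup>2 / 2) * normal_density 0 (sqrt 2) x"
    proof -
      have "128 / sqrt (2 * pi) = 128 * sqrt 2 * (1 / sqrt (2 * pi * (sqrt 2)\<^sup>2))"
        by (simp add: real_sqrt_mult field_simps)
      then show ?thesis by (simp add: normal_density_def)
    qed
    finally show "std_normal_density x * ?f x \<le> 128 * sqrt 2 * exp (- t\<^sup>2 / 2) * normal_density 0 (sqrt 2) x" .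
  qed
  also have "\<dots> = 128 * sqrt 2 * exp (- t\<^sup>2 / 2)" by simp
  also have "\<dots> \<le> 128 * (3 / 2) * exp (- t\<^sup>2 / 2)"
    by (intro mult_right_mono mult_left_mono real_le_lsqrt) (auto simp: power2_eq_square)
  finally show ?thesis by simp
qed

lemma thr_ge: "0 \<le> t \<Longrightarrow> x\<^sup>2 - alpha t \<le> thr t x"
  using alpha_ge[of t] abs_le_square_iff[of t x] by (auto simp: thr_def indicator_def)

lemma integral_thr_ge:
  assumes "0 \<le> t"
  shows "m\<^sup>2 + 1 - alpha t \<le> (\<integral>x. thr t (m + x) \<partial>std)"
proof -
  have eq: "(m + x)\<^sup>2 - alpha t = x\<^sup>2 + 2 * m * x + (m\<^sup>2 - alpha t)" for x
    by (simp add: power2_eq_square algebra_simps)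
  have int: "integrable std (\<lambda>x. (m + x)\<^sup>2 - alpha t)"
    unfolding eq by (intro integrable_std_intros)
  have "m\<^sup>2 + 1 - alpha t = (\<integral>x. (m + x)\<^sup>2 - alpha t \<partial>std)"
    unfolding eq by simp
  also have "\<dots> \<le> (\<integral>x. thr t (m + x) \<partial>std)"
    by (intro integral_mono int integrable_thr thr_ge assms)
  finally show ?thesis .
qed

lemma cosh_mono_square:
  fixes x y m :: real
  assumes "x\<^sup>2 \<le> y\<^sup>2" shows "cosh (m * x) \<le> cosh (m * y)"
proof -
  have "\<bar>x\<bar> \<le> \<bar>y\<bar>" using assms by (simp add: abs_le_square_iff)
  then have "cosh \<bar>m * x\<bar> \<le> cosh \<bar>m * y\<bar>"
    by (subst cosh_real_nonneg_le_iff) (auto simp: abs_mult intro: mult_left_mono)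
  then show ?thesis by simp
qed

lemma cosh_gap_nonneg: "0 \<le> t \<Longrightarrow> 0 \<le> thr t x * (cosh (m * x) - cosh (m * sqrt (alpha t)))"
proof -
  assume "0 \<le> t"
  then have a: "0 \<le> alpha t" using alpha_ge[of t] zero_le_power2[of t] by linarith
  show ?thesis
  proof (cases "alpha t \<le> x\<^sup>2")
    case True
    then show ?thesis using cosh_mono_square[of "sqrt (alpha t)" x m] a by (auto simp: thr_def indicator_def)
  next
    case False
    then show ?thesis using cosh_mono_square[of x "sqrt (alpha t)" m] a
      by (auto simp: thr_def indicator_def intro: mult_nonpos_nonpos)
  qed
qed

text \<open>
  As \<open>thr t\<close> integrates to \<open>0\<close>, a constant may be subtracted from the hyperbolic cosine. With the value
  at \<open>sqrt \<alpha>\<^sub>t\<close>, where \<open>thr t\<close> changes sign, the integrand becomes non-negative.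
\<close>

lemma
  assumes "0 \<le> t"
  shows integrable_thr_gap: "integrable std (\<lambda>x. thr t x * (cosh (m * x) - cosh (m * sqrt (alpha t))))"
    and integral_thr_gap: "(\<integral>x. thr t (m + x) \<partial>std)
      = exp (- m\<^sup>2 / 2) * (\<integral>x. thr t x * (cosh (m * x) - cosh (m * sqrt (alpha t))) \<partial>std)"
proof -
  have 1: "integrable std (\<lambda>x. thr t x * cosh (m * x))"
    by (intro integrable_std_tilt thr_measurable thr_even integrable_thr)
  have 2: "integrable std (\<lambda>x. thr t x * cosh (m * sqrt (alpha t)))"
    using integrable_thr[of t 0] by simp
  show "integrable std (\<lambda>x. thr t x * (cosh (m * x) - cosh (m * sqrt (alpha t))))"
    unfolding right_diff_distrib using 1 2 by simp
  show "(\<integral>x. thr t (m + x) \<partial>std)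
      = exp (- m\<^sup>2 / 2) * (\<integral>x. thr t x * (cosh (m * x) - cosh (m * sqrt (alpha t))) \<partial>std)"
    unfolding right_diff_distrib using 1 2
    by (subst Bochner_Integration.integral_diff)
      (simp_all add: integral_thr integral_std_tilt[OF thr_measurable thr_even integrable_thr])
qed

lemma integral_thr_nonneg: "0 \<le> t \<Longrightarrow> 0 \<le> (\<integral>x. thr t (m + x) \<partial>std)"
  unfolding integral_thr_gap by (intro mult_nonneg_nonneg integral_nonneg_AE AE_I2 cosh_gap_nonneg) auto

lemma sinh_scale_le:
  fixes c x :: real assumes "0 \<le> c" "c \<le> 1" "0 \<le> x"
  shows "sinh (c * x) \<le> c * sinh x"
proof -
  have "(\<lambda>x. c * sinh x - sinh (c * x)) 0 \<le> (\<lambda>x. c * sinh x - sinh (c * x)) x"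
  proof (rule DERIV_nonneg_imp_nondecreasing[OF \<open>0 \<le> x\<close>])
    fix u assume "0 \<le> u" "u \<le> x"
    have "((\<lambda>x. c * sinh x - sinh (c * x)) has_real_derivative c * (cosh u - cosh (c * u))) (at u)"
      by (auto intro!: derivative_eq_intros simp: algebra_simps)
    moreover have "cosh (c * u) \<le> cosh u"
      using assms \<open>0 \<le> u\<close> by (subst cosh_real_nonneg_le_iff) (auto simp: mult_left_le_one_le)
    ultimately show "\<exists>y. ((\<lambda>x. c * sinh x - sinh (c * x)) has_real_derivative y) (at u) \<and> 0 \<le> y"
      using assms by fastforce
  qed
  then show ?thesis by simp
qed

text \<open>
  The function \<open>(cosh (m y) - 1) / y\<^sup>2 = 2 sinh (m y / 2)\<^sup>2 / y\<^sup>2\<close> is increasing on \<open>y > 0\<close>; this is the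
  claim after rearrangement.
\<close>

lemma cosh_gap:
  fixes m :: real assumes "0 \<le> b" "b \<le> a"
  shows "(a\<^sup>2 - b\<^sup>2) * cosh (m * a) \<le> a\<^sup>2 * (cosh (m * a) - cosh (m * b)) + (a\<^sup>2 - b\<^sup>2)"
proof (cases "a = 0")
  case False
  with assms have a: "0 < a" by auto
  have half: "cosh (m * y) - 1 = 2 * (sinh (\<bar>m\<bar> * y / 2))\<^sup>2" for y
  proof -
    have "cosh (m * y) = cosh (2 * (\<bar>m\<bar> * y / 2))" by (cases "m \<ge> 0") auto
    also have "\<dots> = 2 * (sinh (\<bar>m\<bar> * y / 2))\<^sup>2 + 1"
      by (simp only: cosh_double cosh_square_eq)
    finally show ?thesis by simp
  qed
  have "sinh (\<bar>m\<bar> * b / 2) = sinh (b / a * (\<bar>m\<bar> * a / 2))" using a by simp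
  also have "\<dots> \<le> b / a * sinh (\<bar>m\<bar> * a / 2)" using assms a by (intro sinh_scale_le) auto
  finally have "a * sinh (\<bar>m\<bar> * b / 2) \<le> b * sinh (\<bar>m\<bar> * a / 2)" using a by (simp add: field_simps)
  then have "(a * sinh (\<bar>m\<bar> * b / 2))\<^sup>2 \<le> (b * sinh (\<bar>m\<bar> * a / 2))\<^sup>2"
    using a assms by (intro power_mono) auto
  then have "a\<^sup>2 * (cosh (m * b) - 1) \<le> b\<^sup>2 * (cosh (m * a) - 1)"
    unfolding half by (simp add: power_mult_distrib)
  then show ?thesis by (simp add: algebra_simps)
qed (use assms in auto)

text \<open>
  On the range \<open>\<bar>x\<bar> \<le> 4 t\<close> the tilted second moment is dominated pointwise by \<open>16 t\<^sup>2\<close> times the integrand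
  of the mean, up to the untilted second moment. The lemma \<open>cosh_gap\<close> is used with the larger of \<open>\<bar>x\<bar>\<close>
  and \<open>sqrt \<alpha>\<^sub>t\<close> in the role of \<open>a\<close>.
\<close>

lemma thr_tilt_le:
  assumes t: "1 \<le> t" and x: "\<bar>x\<bar> \<le> 4 * t"
  shows "(thr t x)\<^sup>2 * cosh (m * x)
    \<le> 16 * t\<^sup>2 * (thr t x * (cosh (m * x) - cosh (m * sqrt (alpha t)))) + (thr t x)\<^sup>2"
proof (cases "\<bar>x\<bar> < t")
  case True
  then show ?thesis by (simp add: thr_def)
next
  case False
  define b where "b = sqrt (alpha t)"
  have al: "t\<^sup>2 \<le> alpha t" "alpha t \<le> t\<^sup>2 + 2" "1 \<le> t\<^sup>2" using t alpha_ge alpha_le by auto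
  then have b: "b\<^sup>2 = alpha t" "0 \<le> b" unfolding b_def by auto
  have th: "thr t x = x\<^sup>2 - b\<^sup>2" using False b by (simp add: thr_def)
  define a c where "a = max \<bar>x\<bar> b" and "c = min \<bar>x\<bar> b"
  have ac: "0 \<le> c" "c \<le> a" using b by (auto simp: a_def c_def)
  have "x\<^sup>2 \<le> 16 * t\<^sup>2" using power_mono[OF x, of 2] by (simp add: power_mult_distrib)
  then have a2: "a\<^sup>2 \<le> 16 * t\<^sup>2" using al b by (auto simp: a_def max_def)
  have d: "0 \<le> a\<^sup>2 - c\<^sup>2" using ac by (simp add: power_mono)
  have ch: "cosh (m * x) = cosh (m * \<bar>x\<bar>)" by (cases "x \<ge> 0") auto
  have sq: "(thr t x)\<^sup>2 = (a\<^sup>2 - c\<^sup>2)\<^sup>2"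
    and prd: "thr t x * (cosh (m * x) - cosh (m * b)) = (a\<^sup>2 - c\<^sup>2) * (cosh (m * a) - cosh (m * c))"
    unfolding th ch by (cases "b \<le> \<bar>x\<bar>"; simp add: a_def c_def max_def min_def power2_commute algebra_simps)+
  have "x\<^sup>2 \<le> a\<^sup>2" using power_mono[of "\<bar>x\<bar>" a 2] by (simp add: a_def)
  then have "(thr t x)\<^sup>2 * cosh (m * x) \<le> (a\<^sup>2 - c\<^sup>2)\<^sup>2 * cosh (m * a)"
    unfolding sq by (intro mult_left_mono cosh_mono_square) auto
  also have "\<dots> = (a\<^sup>2 - c\<^sup>2) * ((a\<^sup>2 - c\<^sup>2) * cosh (m * a))" by (simp add: power2_eq_square)
  also have "\<dots> \<le> (a\<^sup>2 - c\<^sup>2) * (a\<^sup>2 * (cosh (m * a) - cosh (m * c)) + (a\<^sup>2 - c\<^sup>2))"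
    by (intro mult_left_mono cosh_gap ac d)
  also have "\<dots> = a\<^sup>2 * (thr t x * (cosh (m * x) - cosh (m * b))) + (thr t x)\<^sup>2"
    unfolding sq prd by (simp add: power2_eq_square algebra_simps)
  also have "\<dots> \<le> 16 * t\<^sup>2 * (thr t x * (cosh (m * x) - cosh (m * b))) + (thr t x)\<^sup>2"
    using cosh_gap_nonneg[of t x m] t by (intro add_right_mono mult_right_mono a2) (auto simp: b_def)
  finally show ?thesis by (simp add: b_def)
qed

lemma thr_second_moment_shift_le:
  assumes t: "1 \<le> t" and m: "\<bar>m\<bar> \<le> 2 * t"
  shows "(\<integral>x. (thr t (m + x))\<^sup>2 \<partial>std) \<le> 16 * t\<^sup>2 * (\<integral>x. thr t (m + x) \<partial>std) + 3116 * exp (- t\<^sup>2 / 2)"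
proof -
  let ?gap = "\<lambda>x. thr t x * (cosh (m * x) - cosh (m * sqrt (alpha t)))"
  let ?q = "\<lambda>x. x ^ 4 * indicat_real {x. \<bar>x\<bar> \<ge> 2 * t} x"
  \<comment> \<open>If \<open>\<bar>m + x\<bar> > 4 t\<close>, then \<open>\<bar>x\<bar> > 2 t\<close> and \<open>\<bar>m + x\<bar> \<le> 2 \<bar>x\<bar>\<close>, so this part is a Gaussian tail.\<close>
  define F where "F x = (thr t x)\<^sup>2 * indicat_real {x. \<bar>x\<bar> \<le> 4 * t} x" for x
  have [measurable]: "F \<in> borel_measurable borel" unfolding F_def by measurable
  have F_int: "integrable std (\<lambda>x. F (m + x))"
    using thr_square_le[of t] by (intro integrable_std_quartic[where a = "2 * (alpha t)\<^sup>2" and b = 2])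
      (auto simp: F_def indicator_def)
  have q_int: "integrable std ?q"
    using integrable_std_quartic[of ?q 0 1 0] by (simp add: indicator_def)
  have t0: "0 \<le> t" using t by simp
  have "(\<integral>x. (thr t (m + x))\<^sup>2 \<partial>std) \<le> (\<integral>x. F (m + x) + 16 * ?q x \<partial>std)"
  proof (rule integral_mono[OF integrable_thr_square])
    show "integrable std (\<lambda>x. F (m + x) + 16 * ?q x)" using F_int q_int by simp
    fix x
    show "(thr t (m + x))\<^sup>2 \<le> F (m + x) + 16 * ?q x"
    proof (cases "\<bar>m + x\<bar> \<le> 4 * t")
      case False
      then have x: "2 * t \<le> \<bar>x\<bar>" "\<bar>m + x\<bar> \<le> \<bar>2 * x\<bar>" using m by linarith+
      have "(4 * t)\<^sup>2 \<le> \<bar>m + x\<bar>\<^sup>2" using False t0 by (intro power_mono) auto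
      then have "alpha t \<le> (m + x)\<^sup>2" "0 \<le> alpha t"
        using alpha_le[OF t] alpha_ge[OF t0] zero_le_power2[of t] one_le_power[OF t, of 2]
        by (auto simp: power_mult_distrib)
      then have "((m + x)\<^sup>2 - alpha t)\<^sup>2 \<le> ((m + x)\<^sup>2)\<^sup>2" by (intro power_mono) auto
      also have "(m + x)\<^sup>2 \<le> (2 * x)\<^sup>2" using x(2) by (rule abs_le_square_iff[THEN iffD1])
      then have "((m + x)\<^sup>2)\<^sup>2 \<le> ((2 * x)\<^sup>2)\<^sup>2" by (rule power_mono) simp
      also have "((2 * x)\<^sup>2)\<^sup>2 = 16 * x ^ 4" by (simp add: power_mult_distrib flip: power_mult)
      finally have "(thr t (m + x))\<^sup>2 \<le> 16 * x ^ 4" by (simp add: thr_def indicator_def)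
      then show ?thesis using x False by (simp add: F_def)
    qed (simp add: F_def indicator_def)
  qed
  also have "\<dots> = (\<integral>x. F (m + x) \<partial>std) + 16 * integral\<^sup>L std ?q" using F_int q_int by simp
  also have "(\<integral>x. F (m + x) \<partial>std) = exp (- m\<^sup>2 / 2) * (\<integral>x. F x * cosh (m * x) \<partial>std)"
    using F_int by (intro integral_std_tilt) (auto simp: F_def thr_even indicator_def)
  also have "(\<integral>x. F x * cosh (m * x) \<partial>std) \<le> (\<integral>x. 16 * t\<^sup>2 * ?gap x + (thr t x)\<^sup>2 \<partial>std)"
  proof (rule integral_mono)
    show "integrable std (\<lambda>x. F x * cosh (m * x))"
      using F_int by (intro integrable_std_tilt) (auto simp: F_def thr_even indicator_def)
    show "integrable std (\<lambda>x. 16 * t\<^sup>2 * ?gap x + (thr t x)\<^sup>2)"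
      using integrable_thr_gap[OF t0, of m] integrable_thr_square[of t 0] by simp
    show "F x * cosh (m * x) \<le> 16 * t\<^sup>2 * ?gap x + (thr t x)\<^sup>2" for x
      using thr_tilt_le[OF t, of x m] cosh_gap_nonneg[OF t0, of x m] by (auto simp: F_def indicator_def)
  qed
  also have "\<dots> = 16 * t\<^sup>2 * integral\<^sup>L std ?gap + (\<integral>x. (thr t x)\<^sup>2 \<partial>std)"
    using integrable_thr_gap[OF t0, of m] integrable_thr_square[of t 0] by simp
  finally have "(\<integral>x. (thr t (m + x))\<^sup>2 \<partial>std)
    \<le> 16 * t\<^sup>2 * (exp (- m\<^sup>2 / 2) * integral\<^sup>L std ?gap) + exp (- m\<^sup>2 / 2) * (\<integral>x. (thr t x)\<^sup>2 \<partial>std) + 16 * integral\<^sup>L std ?q"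
    by (simp add: algebra_simps)
  also have "exp (- m\<^sup>2 / 2) * integral\<^sup>L std ?gap = (\<integral>x. thr t (m + x) \<partial>std)"
    using integral_thr_gap[OF t0] by simp
  also have "exp (- m\<^sup>2 / 2) * (\<integral>x. (thr t x)\<^sup>2 \<partial>std) \<le> 1 * (44 * exp (- t\<^sup>2 / 2))"
    by (intro mult_mono thr_second_moment_le t0) auto
  also have "integral\<^sup>L std ?q \<le> 192 * exp (- t\<^sup>2 / 2)" by (rule std_fourth_moment_tail_le[OF t0])
  finally show ?thesis by simp
qed

lemma std_square_shift_var:
  shows "integrable std (\<lambda>x. ((m + x)\<^sup>2 - (m\<^sup>2 + 1))\<^sup>2)"
    and "(\<integral>x. ((m + x)\<^sup>2 - (m\<^sup>2 + 1))\<^sup>2 \<partial>std) = 4 * m\<^sup>2 + 2"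
    and "integrable std (\<lambda>x. (m + x)\<^sup>2)" and "(\<integral>x. (m + x)\<^sup>2 \<partial>std) = m\<^sup>2 + 1"
proof -
  have eq: "((m + x)\<^sup>2 - (m\<^sup>2 + 1))\<^sup>2 = x ^ 4 + 4 * m * x ^ 3 + (4 * m\<^sup>2 - 2) * x\<^sup>2 + (- 4 * m) * x + 1" for x
    by (simp add: power2_eq_square power4_eq_xxxx power3_eq_cube algebra_simps)
  show "integrable std (\<lambda>x. ((m + x)\<^sup>2 - (m\<^sup>2 + 1))\<^sup>2)"
    unfolding eq by (intro integrable_std_intros)
  show "(\<integral>x. ((m + x)\<^sup>2 - (m\<^sup>2 + 1))\<^sup>2 \<partial>std) = 4 * m\<^sup>2 + 2"
    unfolding eq by simp
  have eq: "(m + x)\<^sup>2 = x\<^sup>2 + 2 * m * x + m\<^sup>2" for x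
    by (simp add: power2_eq_square algebra_simps)
  show "integrable std (\<lambda>x. (m + x)\<^sup>2)"
    unfolding eq by (intro integrable_std_intros)
  show "(\<integral>x. (m + x)\<^sup>2 \<partial>std) = m\<^sup>2 + 1"
    unfolding eq by simp
qed

lemma std_centred_square:
  assumes "integrable std f" "integrable std (\<lambda>x. (f x)\<^sup>2 :: real)"
  shows "integrable std (\<lambda>x. (f x - c)\<^sup>2)"
    and "(\<integral>x. (f x - c)\<^sup>2 \<partial>std) = (\<integral>x. (f x)\<^sup>2 \<partial>std) - 2 * c * integral\<^sup>L std f + c\<^sup>2"
proof -
  have eq: "(f x - c)\<^sup>2 = (f x)\<^sup>2 + (- 2 * c) * f x + c\<^sup>2" for x
    by (simp add: power2_eq_square algebra_simps)
  show "integrable std (\<lambda>x. (f x - c)\<^sup>2)"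
    unfolding eq using assms by (intro Bochner_Integration.integrable_add integrable_mult_right integrable_std_const)
  show "(\<integral>x. (f x - c)\<^sup>2 \<partial>std) = (\<integral>x. (f x)\<^sup>2 \<partial>std) - 2 * c * integral\<^sup>L std f + c\<^sup>2"
    unfolding eq using assms by simp
qed

text \<open>
  The variance of one summand is controlled by its mean. For \<open>\<bar>m\<bar> \<le> 2 t\<close> this is the bound on the second
  moment; for larger \<open>m\<close> the thresholding hardly matters and \<open>thr t\<close> is compared with \<open>x\<^sup>2 - \<alpha>\<^sub>t\<close>.
\<close>

lemma thr_variance_le:
  assumes t: "1 \<le> t" defines "e \<equiv> (\<lambda>m. \<integral>x. thr t (m + x) \<partial>std)"
  shows "(\<integral>x. (thr t (m + x) - e m)\<^sup>2 \<partial>std) \<le> 54 * t\<^sup>2 * e m + 3116 * exp (- t\<^sup>2 / 2)"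
proof -
  note centred = std_centred_square[OF integrable_thr[of t m] integrable_thr_square[of t m]]
  have t0: "0 \<le> t" and t1: "1 \<le> t\<^sup>2" using t by (auto simp: one_le_power)
  have e0: "0 \<le> e m" unfolding e_def by (rule integral_thr_nonneg[OF t0])
  show ?thesis
  proof (cases "\<bar>m\<bar> \<le> 2 * t")
    case True
    have "(\<integral>x. (thr t (m + x) - e m)\<^sup>2 \<partial>std) = (\<integral>x. (thr t (m + x))\<^sup>2 \<partial>std) - (e m)\<^sup>2"
      unfolding centred(2) by (simp add: e_def power2_eq_square)
    also have "\<dots> \<le> (\<integral>x. (thr t (m + x))\<^sup>2 \<partial>std)" by simp
    also have "\<dots> \<le> 16 * t\<^sup>2 * e m + 3116 * exp (- t\<^sup>2 / 2)"
      unfolding e_def by (rule thr_second_moment_shift_le[OF t True])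
    also have "16 * t\<^sup>2 * e m \<le> 54 * t\<^sup>2 * e m" using e0 by (intro mult_right_mono) auto
    finally show ?thesis by simp
  next
    case False
    \<comment> \<open>The mean of \<open>(m + g)\<^sup>2 - \<alpha>\<^sub>t\<close>; centring at \<open>c\<close> instead of \<open>e m\<close> only increases the integral.\<close>
    define c where "c = m\<^sup>2 + 1 - alpha t"
    have al: "0 \<le> alpha t" "alpha t \<le> 3 * t\<^sup>2" "t\<^sup>2 \<le> alpha t"
      using alpha_ge[OF t0] alpha_le[OF t] t1 by auto
    have pw: "(thr t y - c)\<^sup>2 \<le> 2 * (y\<^sup>2 - (m\<^sup>2 + 1))\<^sup>2 + 2 * (alpha t)\<^sup>2" for y
    proof (cases "t \<le> \<bar>y\<bar>")
      case True then show ?thesis by (simp add: thr_def c_def algebra_simps)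
    next
      case False
      then have "\<bar>y\<bar> \<le> \<bar>t\<bar>" by auto
      then have "y\<^sup>2 \<le> t\<^sup>2" by (simp add: abs_le_square_iff)
      then have *: "0 \<le> alpha t - y\<^sup>2" "alpha t - y\<^sup>2 \<le> alpha t" using al by auto
      have "(thr t y - c)\<^sup>2 = ((y\<^sup>2 - (m\<^sup>2 + 1)) + (alpha t - y\<^sup>2))\<^sup>2"
        using False power2_commute[of "alpha t - 1" "m\<^sup>2"]
        by (simp add: thr_def c_def algebra_simps)
      also have "\<dots> \<le> 2 * (y\<^sup>2 - (m\<^sup>2 + 1))\<^sup>2 + 2 * (alpha t - y\<^sup>2)\<^sup>2"
        using sum_squares_bound[of "y\<^sup>2 - (m\<^sup>2 + 1)" "alpha t - y\<^sup>2"]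
        unfolding power2_sum[of "y\<^sup>2 - (m\<^sup>2 + 1)" "alpha t - y\<^sup>2"] by linarith
      also have "(alpha t - y\<^sup>2)\<^sup>2 \<le> (alpha t)\<^sup>2" using * by (rule power_mono[rotated])
      finally show ?thesis by simp
    qed
    have "(\<integral>x. (thr t (m + x) - e m)\<^sup>2 \<partial>std) = (\<integral>x. (thr t (m + x) - c)\<^sup>2 \<partial>std) - (e m - c)\<^sup>2"
      unfolding centred(2) by (simp add: e_def power2_eq_square algebra_simps)
    also have "\<dots> \<le> (\<integral>x. (thr t (m + x) - c)\<^sup>2 \<partial>std)" by simp
    also have "\<dots> \<le> (\<integral>x. 2 * ((m + x)\<^sup>2 - (m\<^sup>2 + 1))\<^sup>2 + 2 * (alpha t)\<^sup>2 \<partial>std)"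
      using std_square_shift_var(1)[of m] by (intro integral_mono centred(1) pw) simp
    also have "\<dots> = 2 * (4 * m\<^sup>2 + 2) + 2 * (alpha t)\<^sup>2"
      using std_square_shift_var(1,2)[of m] by simp
    also have "(alpha t)\<^sup>2 \<le> (3 * t\<^sup>2)\<^sup>2" using al by (intro power_mono) auto
    also have "2 * (4 * m\<^sup>2 + 2) + 2 * (3 * t\<^sup>2)\<^sup>2 = 8 * m\<^sup>2 + 4 + 18 * (t\<^sup>2 * t\<^sup>2)"
      by (simp add: power2_eq_square)
    finally have v: "(\<integral>x. (thr t (m + x) - e m)\<^sup>2 \<partial>std) \<le> 8 * m\<^sup>2 + 4 + 18 * (t\<^sup>2 * t\<^sup>2)" by simp
    have "(2 * t)\<^sup>2 \<le> \<bar>m\<bar>\<^sup>2" using False t0 by (intro power_mono) auto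
    then have m4: "4 * t\<^sup>2 \<le> m\<^sup>2" by (simp add: power_mult_distrib)
    have em: "m\<^sup>2 / 4 + 1 \<le> e m" using integral_thr_ge[OF t0, of m] al m4 unfolding e_def by linarith
    have 1: "1 * e m \<le> t\<^sup>2 * e m" using t1 e0 by (rule mult_right_mono)
    have 2: "t\<^sup>2 * t\<^sup>2 \<le> t\<^sup>2 * e m" using m4 em by (intro mult_left_mono) auto
    have "8 * m\<^sup>2 + 4 + 18 * (t\<^sup>2 * t\<^sup>2) \<le> 54 * (t\<^sup>2 * e m)" using em 1 2 m4 t1 by argo
    with v show ?thesis
      using exp_ge_zero[of "- t\<^sup>2 / 2"] unfolding mult.assoc by linarith
  qed
qed

section \<open>The equicorrelated normal density\<close>

lemma equicorrelation_carrier [simp]: "equicorrelation p \<gamma> \<in> carrier_mat p p"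
  by (simp add: equicorrelation_def)

lemma equicorrelation_index:
  "i < p \<Longrightarrow> j < p \<Longrightarrow> equicorrelation p \<gamma> $$ (i, j) = (if i = j then 1 - \<gamma> else 0) + \<gamma>"
  by (simp add: equicorrelation_def)

lemma equicorrelation_mult_vec:
  assumes "u \<in> carrier_vec p" "i < p"
  shows "(equicorrelation p \<gamma> *\<^sub>v u) $ i = (1 - \<gamma>) * u $ i + \<gamma> * (\<Sum>j<p. u $ j)"
proof -
  have "(equicorrelation p \<gamma> *\<^sub>v u) $ i
      = (\<Sum>j<p. ((if i = j then 1 - \<gamma> else 0) + \<gamma>) * u $ j)"
    using assms by (auto simp: scalar_prod_def equicorrelation_index equicorrelation_def atLeast0LessThan intro!: sum.cong)
  also have "\<dots> = (\<Sum>j<p. (if i = j then (1 - \<gamma>) * u $ j else 0)) + (\<Sum>j<p. \<gamma> * u $ j)"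
    unfolding sum.distrib[symmetric] by (intro sum.cong) (auto simp: algebra_simps)
  also have "(\<Sum>j<p. (if i = j then (1 - \<gamma>) * u $ j else 0)) = (1 - \<gamma>) * u $ i"
    using assms by simp
  finally show ?thesis by (simp add: sum_distrib_left)
qed

lemma mult_mat_index_sum:
  assumes "A \<in> carrier_mat n n" "B \<in> carrier_mat n n" "i < n" "j < n"
  shows "(A * B) $$ (i, j) = (\<Sum>l<n. A $$ (i, l) * B $$ (l, j))"
  using assms by (simp add: scalar_prod_def atLeast0LessThan)

lemma prod_list_upt: "prod_list (map f [0..<n]) = (\<Prod>i<n. f i)" for f :: "nat \<Rightarrow> real"
  by (induction n) (auto simp: lessThan_Suc mult.commute)

text \<open>
  Multiplying by the lower triangular matrix \<open>A\<close> of ones from the left and by \<open>B\<close>, the inverse of \<open>A\<close>,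
  from the right makes the matrix upper triangular.
\<close>

lemma det_equicorrelation:
  assumes "1 \<le> p"
  shows "Determinant.det (equicorrelation p \<gamma>) = (1 - \<gamma>) ^ (p - 1) * (1 - \<gamma> + \<gamma> * real p)"
proof -
  define A :: "real mat" where "A = Matrix.mat p p (\<lambda>(i, j). if j \<le> i then 1 else 0)"
  define B :: "real mat" where "B = Matrix.mat p p (\<lambda>(i, j). if i = j then 1 else if i = Suc j then -1 else 0)"
  let ?S = "equicorrelation p \<gamma>"
  have A: "A \<in> carrier_mat p p" and B: "B \<in> carrier_mat p p" by (auto simp: A_def B_def)
  have "Determinant.det A = prod_list (diag_mat A)"
    by (rule det_lower_triangular[OF _ A]) (auto simp: A_def)
  then have detA: "Determinant.det A = 1"
    by (simp add: diag_mat_def A_def prod_list_upt cong: map_cong)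
  have "Determinant.det B = prod_list (diag_mat B)"
    by (rule det_lower_triangular[OF _ B]) (auto simp: B_def)
  then have detB: "Determinant.det B = 1"
    by (simp add: diag_mat_def B_def prod_list_upt cong: map_cong)
  have AS: "(A * ?S) $$ (i, j) = (if j \<le> i then 1 - \<gamma> else 0) + \<gamma> * real (Suc i)" if "i < p" "j < p" for i j
  proof -
    have "(A * ?S) $$ (i, j) = (\<Sum>l<p. (if l \<le> i then 1 else 0) * ((if l = j then 1 - \<gamma> else 0) + \<gamma>))"
      unfolding mult_mat_index_sum[OF A equicorrelation_carrier that]
      using that by (intro sum.cong) (auto simp: A_def equicorrelation_index)
    also have "\<dots> = (\<Sum>l<p. if l = j then (if j \<le> i then 1 - \<gamma> else 0) else 0) + (\<Sum>l<p. if l \<le> i then \<gamma> else 0)"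
      unfolding sum.distrib[symmetric] by (intro sum.cong) auto
    also have "(\<Sum>l<p. if l \<le> i then \<gamma> else 0) = (\<Sum>l\<in>{..i}. \<gamma>)"
      using that by (intro sum.mono_neutral_cong_right) auto
    finally show ?thesis using that by (simp add: algebra_simps)
  qed
  have ASB: "(A * ?S * B) $$ (i, j) = (if Suc j < p then (if i = j then 1 - \<gamma> else 0)
      else (if j \<le> i then 1 - \<gamma> else 0) + \<gamma> * real (Suc i))" if "i < p" "j < p" for i j
  proof -
    have "(A * ?S * B) $$ (i, j) = (\<Sum>l<p. (A * ?S) $$ (i, l) * (if l = j then 1 else if l = Suc j then -1 else 0))"
      unfolding mult_mat_index_sum[OF mult_carrier_mat[OF A equicorrelation_carrier] B that]
      using that by (intro sum.cong) (auto simp: B_def)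
    also have "\<dots> = (\<Sum>l<p. (if l = j then (A * ?S) $$ (i, j) else 0)) - (\<Sum>l<p. if l = Suc j then (A * ?S) $$ (i, Suc j) else 0)"
      unfolding sum_subtractf[symmetric] by (intro sum.cong) (auto simp del: index_mult_mat(1))
    also have "\<dots> = (A * ?S) $$ (i, j) - (if Suc j < p then (A * ?S) $$ (i, Suc j) else 0)"
      using that by (simp del: index_mult_mat(1))
    also have "\<dots> = (if Suc j < p then (if i = j then 1 - \<gamma> else 0)
      else (if j \<le> i then 1 - \<gamma> else 0) + \<gamma> * real (Suc i))"
      using that by (auto simp: AS simp del: index_mult_mat(1))
    finally show ?thesis .
  qed
  have C: "A * ?S * B \<in> carrier_mat p p" using A B by auto
  have "Determinant.det (A * ?S * B) = prod_list (diag_mat (A * ?S * B))"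
  proof (rule det_upper_triangular[OF _ C])
    show "upper_triangular (A * ?S * B)" using A B
      by (intro upper_triangularI) (auto simp: ASB simp del: index_mult_mat(1))
  qed
  also have "\<dots> = (\<Prod>i<p. (A * ?S * B) $$ (i, i))"
    using A B by (simp add: diag_mat_def prod_list_upt del: index_mult_mat(1))
  also have "\<dots> = (\<Prod>i<p. if Suc i < p then 1 - \<gamma> else 1 - \<gamma> + \<gamma> * real p)"
  proof (intro prod.cong refl)
    fix i assume i: "i \<in> {..<p}"
    then have "\<not> Suc i < p \<Longrightarrow> Suc i = p" by auto
    then show "(A * ?S * B) $$ (i, i) = (if Suc i < p then 1 - \<gamma> else 1 - \<gamma> + \<gamma> * real p)"
      using i by (cases "Suc i < p") (simp_all add: ASB del: index_mult_mat(1) of_nat_Suc)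
  qed
  also have "\<dots> = (1 - \<gamma>) ^ (p - 1) * (1 - \<gamma> + \<gamma> * real p)"
    using assms by (cases p) (simp_all add: lessThan_Suc)
  finally have "Determinant.det (A * ?S * B) = (1 - \<gamma>) ^ (p - 1) * (1 - \<gamma> + \<gamma> * real p)" .
  moreover have "Determinant.det (A * ?S * B) = Determinant.det A * Determinant.det ?S * Determinant.det B"
    using A B by (simp add: det_mult[of _ p])
  ultimately show ?thesis by (simp add: detA detB)
qed

text \<open>
  The inverse matrix \<open>B\<close> is only used through the linear system solved by \<open>u = B v\<close>, which is summed over
  its rows to find \<open>\<Sum> u\<^sub>j\<close> first.
\<close>

lemma equicorrelation_quadratic_form:
  fixes f :: "nat \<Rightarrow> real"
  assumes p: "1 \<le> p" and \<gamma>: "0 \<le> \<gamma>" "\<gamma> < 1"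
  defines "v \<equiv> Matrix.vec p f" and "V \<equiv> 1 - \<gamma> + \<gamma> * real p"
  shows "scalar_prod v (mult_mat_vec (the (mat_inverse (equicorrelation p \<gamma>))) v)
    = ((\<Sum>i<p. (f i)\<^sup>2) - \<gamma> * (\<Sum>i<p. f i)\<^sup>2 / V) / (1 - \<gamma>)"
proof -
  let ?S = "equicorrelation p \<gamma>"
  have V: "V > 0" using \<gamma> unfolding V_def by (intro add_pos_nonneg) auto
  have "Determinant.det ?S \<noteq> 0" using V \<gamma> p by (simp add: det_equicorrelation V_def)
  then have "?S \<in> Units (ring_mat TYPE(real) p b)" for b :: unit
    by (intro det_non_zero_imp_unit) auto
  then obtain B where B: "mat_inverse ?S = Some B"
    using mat_inverse(1)[of ?S p] by fastforce
  from mat_inverse(2)[OF equicorrelation_carrier B]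
  have SB: "?S * B = 1\<^sub>m p" and Bc: "B \<in> carrier_mat p p" by auto
  have v: "v \<in> carrier_vec p" by (simp add: v_def)
  define u where "u = B *\<^sub>v v"
  have u: "u \<in> carrier_vec p" using Bc v by (auto simp: u_def)
  have "?S *\<^sub>v u = v"
    unfolding u_def using Bc v SB by (simp add: assoc_mult_mat_vec[symmetric, of _ p p _ p])
  then have eq: "f i = (1 - \<gamma>) * u $ i + \<gamma> * (\<Sum>j<p. u $ j)" if "i < p" for i
    using equicorrelation_mult_vec[OF u that, of \<gamma>] that by (simp add: v_def)
  have "(\<Sum>i<p. f i) = (\<Sum>i<p. (1 - \<gamma>) * u $ i + \<gamma> * (\<Sum>j<p. u $ j))"
    by (intro sum.cong refl eq) simp
  also have "\<dots> = V * (\<Sum>j<p. u $ j)"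
    by (simp only: sum.distrib sum_distrib_left[symmetric] sum_constant card_lessThan)
      (simp add: V_def algebra_simps)
  finally have s: "(\<Sum>j<p. u $ j) = (\<Sum>i<p. f i) / V" using V by (simp add: field_simps)
  have ui: "u $ i = (f i - \<gamma> * (\<Sum>i<p. f i) / V) / (1 - \<gamma>)" if "i < p" for i
    using eq[OF that] \<gamma> by (simp add: s field_simps)
  have "scalar_prod v (the (mat_inverse ?S) *\<^sub>v v) = (\<Sum>i<p. f i * u $ i)"
    unfolding B option.sel u_def[symmetric]
    using u by (auto simp: scalar_prod_def v_def atLeast0LessThan intro!: sum.cong)
  also have "\<dots> = (\<Sum>i<p. ((f i)\<^sup>2 - f i * (\<gamma> * (\<Sum>i<p. f i) / V)) / (1 - \<gamma>))"
    by (intro sum.cong) (auto simp: ui power2_eq_square right_diff_distrib)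
  also have "\<dots> = ((\<Sum>i<p. (f i)\<^sup>2) - \<gamma> * (\<Sum>i<p. f i)\<^sup>2 / V) / (1 - \<gamma>)"
    unfolding sum_divide_distrib[symmetric] sum_subtractf sum_distrib_right[symmetric]
    by (simp add: power2_eq_square)
  finally show ?thesis .
qed

text \<open>
  Completing the square in \<open>w\<close>: the product of the density of the common factor and the conditional
  density of the data given \<open>w\<close> is the equicorrelated normal density times a normal density in \<open>w\<close>.
\<close>

lemma equicorrelation_density_mixture:
  fixes f :: "nat \<Rightarrow> real" and w :: real
  assumes p: "1 \<le> p" and \<gamma>: "0 \<le> \<gamma>" "\<gamma> < 1"
  defines "V \<equiv> 1 - \<gamma> + \<gamma> * real p"
  defines "q \<equiv> ((\<Sum>i<p. (f i)\<^sup>2) - \<gamma> * (\<Sum>i<p. f i)\<^sup>2 / V) / (1 - \<gamma>)"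
  shows "std_normal_density w * (\<Prod>i<p. normal_density (sqrt \<gamma> * w) (sqrt (1 - \<gamma>)) (f i))
    = exp (- q / 2) / sqrt ((2 * pi) ^ p * ((1 - \<gamma>) ^ (p - 1) * V))
      * normal_density (sqrt \<gamma> * (\<Sum>i<p. f i) / V) (sqrt ((1 - \<gamma>) / V)) w"
proof -
  define s Q where "s = (\<Sum>i<p. f i)" and "Q = (\<Sum>i<p. (f i)\<^sup>2)"
  have V: "V > 0" using \<gamma> unfolding V_def by (intro add_pos_nonneg) auto
  have g1: "1 - \<gamma> > 0" using \<gamma> by simp
  have sg: "sqrt \<gamma> * sqrt \<gamma> = \<gamma>" using \<gamma> by simp
  have sumsq: "(\<Sum>i<p. (f i - sqrt \<gamma> * w)\<^sup>2) = Q - 2 * sqrt \<gamma> * w * s + real p * (\<gamma> * w\<^sup>2)"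
  proof -
    have "(\<Sum>i<p. (f i - sqrt \<gamma> * w)\<^sup>2) = (\<Sum>i<p. (f i)\<^sup>2 - 2 * sqrt \<gamma> * w * f i + \<gamma> * w\<^sup>2)"
      by (intro sum.cong) (auto simp: power2_diff power_mult_distrib \<gamma>)
    then show ?thesis by (simp add: sum.distrib sum_subtractf Q_def s_def sum_distrib_left)
  qed
  have expo: "- w\<^sup>2 / 2 + - (\<Sum>i<p. (f i - sqrt \<gamma> * w)\<^sup>2) / (2 * (1 - \<gamma>))
      = - q / 2 + - (w - sqrt \<gamma> * s / V)\<^sup>2 / (2 * ((1 - \<gamma>) / V))"
  proof -
    have sqr: "V * (w - sqrt \<gamma> * s / V)\<^sup>2 = V * w\<^sup>2 - 2 * sqrt \<gamma> * w * s + \<gamma> * s\<^sup>2 / V"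
      using V by (simp add: power2_diff power_divide power_mult_distrib \<gamma> distrib_left right_diff_distrib)
        (simp add: power2_eq_square)
    have f1: "- (w - sqrt \<gamma> * s / V)\<^sup>2 / (2 * ((1 - \<gamma>) / V)) = - (V * (w - sqrt \<gamma> * s / V)\<^sup>2) / (2 * (1 - \<gamma>))"
      using V by (simp add: ac_simps)
    have "- (T / (1 - \<gamma>)) / 2 = - T / (2 * (1 - \<gamma>))" for T
      using g1 by (simp add: field_simps)
    then have f2: "- q / 2 = - (Q - \<gamma> * s\<^sup>2 / V) / (2 * (1 - \<gamma>))" unfolding q_def Q_def s_def .
    have f3: "- w\<^sup>2 / 2 = - ((1 - \<gamma>) * w\<^sup>2) / (2 * (1 - \<gamma>))" using g1 by (simp add: field_simps)
    have "V * w\<^sup>2 = (1 - \<gamma>) * w\<^sup>2 + real p * (\<gamma> * w\<^sup>2)" by (simp add: V_def algebra_simps)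
    then have "- ((1 - \<gamma>) * w\<^sup>2) + - (Q - 2 * sqrt \<gamma> * w * s + real p * (\<gamma> * w\<^sup>2))
        = - (Q - \<gamma> * s\<^sup>2 / V) + - (V * w\<^sup>2 - 2 * sqrt \<gamma> * w * s + \<gamma> * s\<^sup>2 / V)"
      by linarith
    then show ?thesis
      unfolding sumsq f1 f2 f3 sqr add_divide_distrib[symmetric] by (rule arg_cong)
  qed
  have prod_eq: "(\<Prod>i<p. normal_density (sqrt \<gamma> * w) (sqrt (1 - \<gamma>)) (f i))
      = (1 / sqrt (2 * pi * (1 - \<gamma>))) ^ p * exp (- (\<Sum>i<p. (f i - sqrt \<gamma> * w)\<^sup>2) / (2 * (1 - \<gamma>)))"
    using g1 by (simp add: normal_density_def prod.distrib prod_dividef exp_sum[symmetric] sum_divide_distrib sum_negf power_one_over)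
  have const: "1 / sqrt (2 * pi) * (1 / sqrt (2 * pi * (1 - \<gamma>))) ^ p
     = 1 / sqrt ((2 * pi) ^ p * ((1 - \<gamma>) ^ (p - 1) * V)) * (1 / sqrt (2 * pi * ((1 - \<gamma>) / V)))"
  proof -
    have "(2 * pi) ^ p * ((1 - \<gamma>) ^ (p - 1) * V) * (2 * pi * ((1 - \<gamma>) / V))
        = 2 * pi * ((2 * pi) ^ p * ((1 - \<gamma>) ^ (p - 1) * (1 - \<gamma>)))"
      using V by (simp add: field_simps)
    also have "(1 - \<gamma>) ^ (p - 1) * (1 - \<gamma>) = (1 - \<gamma>) ^ p"
      using p by (cases p) auto
    finally have "sqrt ((2 * pi) ^ p * ((1 - \<gamma>) ^ (p - 1) * V)) * sqrt (2 * pi * ((1 - \<gamma>) / V))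
        = sqrt (2 * pi) * sqrt (2 * pi * (1 - \<gamma>)) ^ p"
      by (simp only: real_sqrt_mult[symmetric] real_sqrt_power[symmetric] power_mult_distrib)
    then show ?thesis by (simp add: power_one_over)
  qed
  have sq: "(sqrt (1 - \<gamma>))\<^sup>2 = 1 - \<gamma>" "(sqrt ((1 - \<gamma>) / V))\<^sup>2 = (1 - \<gamma>) / V" using g1 V by auto
  have "std_normal_density w * (\<Prod>i<p. normal_density (sqrt \<gamma> * w) (sqrt (1 - \<gamma>)) (f i))
    = (1 / sqrt (2 * pi) * (1 / sqrt (2 * pi * (1 - \<gamma>))) ^ p) *
      exp (- w\<^sup>2 / 2 + - (\<Sum>i<p. (f i - sqrt \<gamma> * w)\<^sup>2) / (2 * (1 - \<gamma>)))"
    unfolding prod_eq std_normal_density_def exp_add by simp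
  also have "\<dots> = exp (- q / 2) / sqrt ((2 * pi) ^ p * ((1 - \<gamma>) ^ (p - 1) * V))
      * normal_density (sqrt \<gamma> * (\<Sum>i<p. f i) / V) (sqrt ((1 - \<gamma>) / V)) w"
    unfolding expo const exp_add normal_density_def s_def[symmetric] sq by simp
  finally show ?thesis .
qed

section \<open>Finite product measures\<close>

lemma PiM_density:
  fixes M :: "'i \<Rightarrow> 'a measure"
  assumes "product_sigma_finite M" "product_sigma_finite (\<lambda>i. density (M i) (f i))"
    and I: "finite I" and f[measurable]: "\<And>i. f i \<in> borel_measurable (M i)"
  shows "density (PiM I M) (\<lambda>x. \<Prod>i\<in>I. f i (x i)) = PiM I (\<lambda>i. density (M i) (f i))"
proof -
  interpret M: product_sigma_finite M by fact
  interpret D: product_sigma_finite "\<lambda>i. density (M i) (f i)" by fact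
  have sets: "sets (PiM I (\<lambda>i. density (M i) (f i))) = sets (PiM I M)"
    by (intro sets_PiM_cong) auto
  show ?thesis
  proof (rule D.PiM_eqI[OF I])
    show "sets (density (PiM I M) (\<lambda>x. \<Prod>i\<in>I. f i (x i))) = sets (PiM I (\<lambda>i. density (M i) (f i)))"
      by (simp add: sets)
    fix A assume "\<And>i. i \<in> I \<Longrightarrow> A i \<in> sets (density (M i) (f i))"
    then have A[measurable]: "\<And>i. i \<in> I \<Longrightarrow> A i \<in> sets (M i)" by simp
    have "emeasure (density (PiM I M) (\<lambda>x. \<Prod>i\<in>I. f i (x i))) (Pi\<^sub>E I A)
        = (\<integral>\<^sup>+x. (\<Prod>i\<in>I. f i (x i)) * indicator (Pi\<^sub>E I A) x \<partial>PiM I M)"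
      using I by (intro emeasure_density sets_PiM_I_finite A) measurable
    also have "\<dots> = (\<integral>\<^sup>+x. (\<Prod>i\<in>I. f i (x i) * indicator (A i) (x i)) \<partial>PiM I M)"
    proof (intro nn_integral_cong)
      fix x assume x: "x \<in> space (PiM I M)"
      have "(\<Prod>i\<in>I. indicator (A i) (x i) :: ennreal) = indicator (Pi\<^sub>E I A) x"
      proof (cases "x \<in> Pi\<^sub>E I A")
        case False
        then obtain i where "i \<in> I" "x i \<notin> A i" using x by (auto simp: space_PiM PiE_def Pi_def)
        then show ?thesis using False I by (auto simp: prod_zero_iff intro!: bexI[of _ i])
      qed (auto simp: PiE_def Pi_def intro!: prod.neutral)
      then show "(\<Prod>i\<in>I. f i (x i)) * indicator (Pi\<^sub>E I A) x = (\<Prod>i\<in>I. f i (x i) * indicator (A i) (x i))"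
        by (simp add: prod.distrib)
    qed
    also have "\<dots> = (\<Prod>i\<in>I. \<integral>\<^sup>+x. f i x * indicator (A i) x \<partial>M i)"
      by (rule M.product_nn_integral_prod[OF I]) simp
    also have "\<dots> = (\<Prod>i\<in>I. emeasure (density (M i) (f i)) (A i))"
      by (intro prod.cong refl) (simp add: emeasure_density)
    finally show "emeasure (density (PiM I M) (\<lambda>x. \<Prod>i\<in>I. f i (x i))) (Pi\<^sub>E I A)
        = (\<Prod>i\<in>I. emeasure (density (M i) (f i)) (A i))" .
  qed
qed

lemma distr_PiM_componentwise:
  fixes M :: "'i \<Rightarrow> 'a measure"
  assumes "product_sigma_finite M" "product_sigma_finite (\<lambda>i. distr (M i) (N i) (T i))"
    and I: "finite I" and T[measurable]: "\<And>i. T i \<in> measurable (M i) (N i)"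
  shows "distr (PiM I M) (PiM I N) (\<lambda>x. \<lambda>i\<in>I. T i (x i)) = PiM I (\<lambda>i. distr (M i) (N i) (T i))"
proof -
  interpret M: product_sigma_finite M by fact
  interpret D: product_sigma_finite "\<lambda>i. distr (M i) (N i) (T i)" by fact
  have sets: "sets (PiM I (\<lambda>i. distr (M i) (N i) (T i))) = sets (PiM I N)"
    by (intro sets_PiM_cong) auto
  show ?thesis
  proof (rule D.PiM_eqI[OF I])
    show "sets (distr (PiM I M) (PiM I N) (\<lambda>x. \<lambda>i\<in>I. T i (x i))) = sets (PiM I (\<lambda>i. distr (M i) (N i) (T i)))"
      by (simp add: sets)
    fix A assume "\<And>i. i \<in> I \<Longrightarrow> A i \<in> sets (distr (M i) (N i) (T i))"
    then have A[measurable]: "\<And>i. i \<in> I \<Longrightarrow> A i \<in> sets (N i)" by simp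
    have "emeasure (distr (PiM I M) (PiM I N) (\<lambda>x. \<lambda>i\<in>I. T i (x i))) (Pi\<^sub>E I A)
        = emeasure (PiM I M) ((\<lambda>x. \<lambda>i\<in>I. T i (x i)) -` Pi\<^sub>E I A \<inter> space (PiM I M))"
      using I by (intro emeasure_distr sets_PiM_I_finite A) measurable
    also have "(\<lambda>x. \<lambda>i\<in>I. T i (x i)) -` Pi\<^sub>E I A \<inter> space (PiM I M) = Pi\<^sub>E I (\<lambda>i. T i -` A i \<inter> space (M i))"
      by (auto simp: space_PiM PiE_def Pi_def extensional_def)
    also have "emeasure (PiM I M) \<dots> = (\<Prod>i\<in>I. emeasure (M i) (T i -` A i \<inter> space (M i)))"
      using I by (intro M.emeasure_PiM) measurable
    also have "\<dots> = (\<Prod>i\<in>I. emeasure (distr (M i) (N i) (T i)) (A i))"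
      by (intro prod.cong refl) (simp add: emeasure_distr)
    finally show "emeasure (distr (PiM I M) (PiM I N) (\<lambda>x. \<lambda>i\<in>I. T i (x i))) (Pi\<^sub>E I A)
        = (\<Prod>i\<in>I. emeasure (distr (M i) (N i) (T i)) (A i))" .
  qed
qed

lemma abs_mult_le_sum_squares: "\<bar>a * b\<bar> \<le> a\<^sup>2 + b\<^sup>2" for a b :: real
proof -
  have "2 * (\<bar>a\<bar> * \<bar>b\<bar>) \<le> a\<^sup>2 + b\<^sup>2" using sum_squares_bound[of "\<bar>a\<bar>" "\<bar>b\<bar>"] by simp
  moreover have "0 \<le> \<bar>a\<bar> * \<bar>b\<bar>" by simp
  ultimately show ?thesis unfolding abs_mult by linarith
qed

context finite_product_prob_space
begin

lemma
  fixes f :: "'b \<Rightarrow> real"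
  assumes i: "i \<in> I" and [measurable]: "f \<in> borel_measurable (M i)"
  shows integrable_component_iff: "integrable (PiM I M) (\<lambda>x. f (x i)) \<longleftrightarrow> integrable (M i) f"
    and integral_component: "(\<integral>x. f (x i) \<partial>PiM I M) = integral\<^sup>L (M i) f"
proof -
  have [measurable]: "(\<lambda>x. x i) \<in> measurable (PiM I M) (M i)" using i by (rule measurable_component_singleton)
  have d: "distr (PiM I M) (M i) (\<lambda>x. x i) = M i" using i by (rule PiM_component)
  show "integrable (PiM I M) (\<lambda>x. f (x i)) \<longleftrightarrow> integrable (M i) f"
    using integrable_distr_eq[of "\<lambda>x. x i" "PiM I M" "M i" f] by (simp add: d)
  show "(\<integral>x. f (x i) \<partial>PiM I M) = integral\<^sup>L (M i) f"
    using integral_distr[of "\<lambda>x. x i" "PiM I M" "M i" f] by (simp add: d)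
qed

text \<open>
  A mean zero function of the \<open>i\<close>-th coordinate is orthogonal to \<open>H\<close> as soon as \<open>H\<close> does not depend on that
  coordinate where \<open>f\<close> is non-zero.
\<close>

lemma integral_component_mult_eq_0:
  fixes f :: "'b \<Rightarrow> real"
  assumes i: "i \<in> I" and f: "integral\<^sup>L (M i) f = 0"
    and int: "integrable (PiM I M) (\<lambda>x. f (x i) * H x)"
    and H: "\<And>x y. y \<in> space (M i) \<Longrightarrow> f y * H (x(i := y)) = f y * K x"
  shows "(\<integral>x. f (x i) * H x \<partial>PiM I M) = 0"
proof -
  have I: "insert i (I - {i}) = I" using i by auto
  have "(\<integral>x. f (x i) * H x \<partial>PiM I M)
      = (\<integral>x. (\<integral>y. f ((x(i := y)) i) * H (x(i := y)) \<partial>M i) \<partial>PiM (I - {i}) M)"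
    using product_integral_insert[of "I - {i}" i "\<lambda>x. f (x i) * H x", unfolded I] int finite_index by simp
  also have "\<dots> = (\<integral>x. (\<integral>y. f y * K x \<partial>M i) \<partial>PiM (I - {i}) M)"
    by (intro Bochner_Integration.integral_cong refl) (simp add: H)
  finally show ?thesis by (simp add: f)
qed

lemma
  fixes h :: "'a \<Rightarrow> 'b \<Rightarrow> real"
  assumes h: "\<And>i. i \<in> I \<Longrightarrow> integrable (M i) (h i)"
    and h2: "\<And>i. i \<in> I \<Longrightarrow> integrable (M i) (\<lambda>y. (h i y)\<^sup>2)"
    and zero: "\<And>i. i \<in> I \<Longrightarrow> integral\<^sup>L (M i) (h i) = 0"
  shows integrable_sum_square: "integrable (PiM I M) (\<lambda>x. (\<Sum>i\<in>I. h i (x i))\<^sup>2)"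
    and integral_sum_square: "(\<integral>x. (\<Sum>i\<in>I. h i (x i))\<^sup>2 \<partial>PiM I M) = (\<Sum>i\<in>I. \<integral>y. (h i y)\<^sup>2 \<partial>M i)"
proof -
  have [measurable]: "h i \<in> borel_measurable (M i)" if "i \<in> I" for i using h[OF that] by auto
  have mc: "(\<lambda>x. h i (x i)) \<in> borel_measurable (PiM I M)" if "i \<in> I" for i
    using that by (intro measurable_compose[OF measurable_component_singleton]) auto
  have sq: "integrable (PiM I M) (\<lambda>x. (h i (x i))\<^sup>2)" if "i \<in> I" for i
    using that h2[OF that] integrable_component_iff[of i "\<lambda>y. (h i y)\<^sup>2"] by simp
  have cross: "integrable (PiM I M) (\<lambda>x. h i (x i) * h j (x j))" if "i \<in> I" "j \<in> I" for i j
  proof (rule Bochner_Integration.integrable_bound[of _ "\<lambda>x. (h i (x i))\<^sup>2 + (h j (x j))\<^sup>2"])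
    show "AE x in PiM I M. norm (h i (x i) * h j (x j)) \<le> norm ((h i (x i))\<^sup>2 + (h j (x j))\<^sup>2)"
      by (simp add: abs_mult_le_sum_squares)
  qed (use that sq mc in auto)
  have eq: "(\<Sum>i\<in>I. h i (x i))\<^sup>2 = (\<Sum>i\<in>I. \<Sum>j\<in>I. h i (x i) * h j (x j))" for x
    by (simp add: power2_eq_square sum_product)
  show "integrable (PiM I M) (\<lambda>x. (\<Sum>i\<in>I. h i (x i))\<^sup>2)"
    unfolding eq using cross by (intro Bochner_Integration.integrable_sum) auto
  have off: "(\<integral>x. h i (x i) * h j (x j) \<partial>PiM I M) = (if i = j then \<integral>y. (h i y)\<^sup>2 \<partial>M i else 0)" if "i \<in> I" "j \<in> I" for i j
  proof (cases "i = j")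
    case True
    then show ?thesis using integral_component[of i "\<lambda>y. (h i y)\<^sup>2"] that by (simp add: power2_eq_square)
  next
    case False
    have "(\<integral>x. h i (x i) * h j (x j) \<partial>PiM I M) = 0"
      by (rule integral_component_mult_eq_0[where K = "\<lambda>x. h j (x j)"]) (use that zero cross False in auto)
    then show ?thesis using False by simp
  qed
  have "(\<integral>x. (\<Sum>i\<in>I. h i (x i))\<^sup>2 \<partial>PiM I M) = (\<Sum>i\<in>I. \<Sum>j\<in>I. \<integral>x. h i (x i) * h j (x j) \<partial>PiM I M)"
    unfolding eq using cross by (simp add: Bochner_Integration.integral_sum Bochner_Integration.integrable_sum)
  also have "\<dots> = (\<Sum>i\<in>I. \<integral>y. (h i y)\<^sup>2 \<partial>M i)"
    using off finite_index by (simp add: sum.delta cong: sum.cong)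
  finally show "(\<integral>x. (\<Sum>i\<in>I. h i (x i))\<^sup>2 \<partial>PiM I M) = (\<Sum>i\<in>I. \<integral>y. (h i y)\<^sup>2 \<partial>M i)" .
qed

lemma Chebyshev_sum:
  fixes h :: "'a \<Rightarrow> 'b \<Rightarrow> real"
  assumes h: "\<And>i. i \<in> I \<Longrightarrow> integrable (M i) (h i)"
    and h2: "\<And>i. i \<in> I \<Longrightarrow> integrable (M i) (\<lambda>y. (h i y - m i)\<^sup>2)"
    and m: "\<And>i. i \<in> I \<Longrightarrow> integral\<^sup>L (M i) (h i) = m i"
    and a: "0 < a"
  shows "measure (PiM I M) {x \<in> space (PiM I M). a \<le> \<bar>(\<Sum>i\<in>I. h i (x i)) - (\<Sum>i\<in>I. m i)\<bar>}
    \<le> (\<Sum>i\<in>I. \<integral>y. (h i y - m i)\<^sup>2 \<partial>M i) / a\<^sup>2"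
    and "{x \<in> space (PiM I M). a \<le> \<bar>(\<Sum>i\<in>I. h i (x i)) - (\<Sum>i\<in>I. m i)\<bar>} \<in> sets (PiM I M)"
proof -
  let ?S = "\<lambda>x. \<Sum>i\<in>I. h i (x i) - m i"
  have S: "?S x = (\<Sum>i\<in>I. h i (x i)) - (\<Sum>i\<in>I. m i)" for x by (rule sum_subtractf)
  have m0: "integral\<^sup>L (M i) (\<lambda>y. h i y - m i) = 0" if "i \<in> I" for i
    using m[OF that] h[OF that] by (simp add: M.prob_space)
  have hm: "integrable (M i) (\<lambda>y. h i y - m i)" if "i \<in> I" for i using h[OF that] by simp
  note sq = integrable_sum_square[OF hm h2 m0] integral_sum_square[OF hm h2 m0]
  have [measurable]: "h i \<in> borel_measurable (M i)" if "i \<in> I" for i using h[OF that] by auto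
  have [measurable]: "(\<lambda>x. h i (x i)) \<in> borel_measurable (PiM I M)" if "i \<in> I" for i
    using that by (intro measurable_compose[OF measurable_component_singleton]) auto
  have [measurable]: "(\<lambda>x. \<Sum>i\<in>I. h i (x i)) \<in> borel_measurable (PiM I M)" by measurable
  show "{x \<in> space (PiM I M). a \<le> \<bar>(\<Sum>i\<in>I. h i (x i)) - (\<Sum>i\<in>I. m i)\<bar>} \<in> sets (PiM I M)" by measurable
  have ev: "{x \<in> space (PiM I M). a \<le> \<bar>(\<Sum>i\<in>I. h i (x i)) - (\<Sum>i\<in>I. m i)\<bar>} = {x \<in> space (PiM I M). a\<^sup>2 \<le> (?S x)\<^sup>2}"
    unfolding S using a by (auto simp: abs_le_square_iff[symmetric])
  have "measure (PiM I M) {x \<in> space (PiM I M). a\<^sup>2 \<le> (?S x)\<^sup>2} \<le> (\<integral>x. (?S x)\<^sup>2 \<partial>PiM I M) / a\<^sup>2"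
    using sq(1) a by (intro integral_Markov_inequality_measure[where A = "space (PiM I M)", simplified]) auto
  then show "measure (PiM I M) {x \<in> space (PiM I M). a \<le> \<bar>(\<Sum>i\<in>I. h i (x i)) - (\<Sum>i\<in>I. m i)\<bar>}
    \<le> (\<Sum>i\<in>I. \<integral>y. (h i y - m i)\<^sup>2 \<partial>M i) / a\<^sup>2"
    unfolding ev using sq(2) by simp
qed

end

section \<open>The law of the transformed data\<close>

text \<open>
  The standard normal law and the Lebesgue measure on \<open>\<real>\<^sup>p\<close>, and the Borel structure of \<open>\<real>\<^sup>p\<close>.
\<close>

abbreviation stdn :: "nat \<Rightarrow> (nat \<Rightarrow> real) measure" where
  "stdn p \<equiv> PiM {..<p} (\<lambda>_. std)"
abbreviation lebn :: "nat \<Rightarrow> (nat \<Rightarrow> real) measure" where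
  "lebn p \<equiv> PiM {..<p} (\<lambda>_. lborel)"
abbreviation boreln :: "nat \<Rightarrow> (nat \<Rightarrow> real) measure" where
  "boreln p \<equiv> PiM {..<p} (\<lambda>_. borel)"

lemma finite_product_prob_space_std: "finite_product_prob_space (\<lambda>_. std) {..<p::nat}"
proof -
  have "product_prob_space (\<lambda>_::nat. std)" by (rule product_prob_spaceI) (rule prob_space_std)
  then show ?thesis
    by (simp add: finite_product_prob_space_def finite_product_sigma_finite_def
      finite_product_sigma_finite_axioms_def product_prob_space_def)
qed

lemma product_sigma_finite_lborel: "product_sigma_finite (\<lambda>_::nat. lborel :: real measure)"
  by (simp add: product_sigma_finite_def lborel.sigma_finite_measure_axioms)

lemma prob_space_stdn: "prob_space (stdn p)"
proof -
  interpret finite_product_prob_space "\<lambda>_. std" "{..<p}" by (rule finite_product_prob_space_std)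
  show ?thesis by (rule P.prob_space_axioms)
qed

lemma sigma_finite_lebn: "sigma_finite_measure (lebn p)"
  by (rule product_sigma_finite.sigma_finite[OF product_sigma_finite_lborel]) simp

lemma sets_stdn [measurable_cong]: "sets (stdn p) = sets (boreln p)"
  by (intro sets_PiM_cong) auto

lemma sets_lebn [measurable_cong]: "sets (lebn p) = sets (boreln p)"
  by (intro sets_PiM_cong) auto

lemma distr_std_affine:
  assumes "0 < \<sigma>"
  shows "distr std borel (\<lambda>z. a + \<sigma> * z) = density lborel (normal_density a \<sigma>)"
proof -
  interpret prob_space std by (rule prob_space_std)
  have "distributed std lborel (\<lambda>x. x) std_normal_density"
    by (simp add: distributed_def distr_id2 cong: distr_cong)
  from normal_density_affine[OF this _ , of \<sigma> a] assms
  have "distributed std lborel (\<lambda>x. a + \<sigma> * x) (normal_density a \<sigma>)" by simp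
  then have "distr std lborel (\<lambda>x. a + \<sigma> * x) = density lborel (normal_density a \<sigma>)"
    by (simp add: distributed_def)
  then show ?thesis by (simp add: distr_cong[OF refl, of lborel borel])
qed

lemma product_normal_density:
  assumes \<sigma>: "0 < \<sigma>"
  shows "density (lebn p) (\<lambda>x. ennreal (\<Prod>i<p. normal_density (a i) \<sigma> (x i)))
    = distr (stdn p) (lebn p) (\<lambda>z. \<lambda>i\<in>{..<p}. a i + \<sigma> * z i)"
proof -
  have ps: "product_sigma_finite (\<lambda>i. density lborel (normal_density (a i) \<sigma>))"
    using prob_space_normal_density[OF \<sigma>] by (auto simp: product_sigma_finite_def intro!: prob_space_imp_sigma_finite)
  have "density (lebn p) (\<lambda>x. ennreal (\<Prod>i<p. normal_density (a i) \<sigma> (x i)))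
      = density (lebn p) (\<lambda>x. \<Prod>i\<in>{..<p}. ennreal (normal_density (a i) \<sigma> (x i)))"
    by (simp add: prod_ennreal)
  also have "\<dots> = PiM {..<p} (\<lambda>i. density lborel (normal_density (a i) \<sigma>))"
    by (rule PiM_density[OF product_sigma_finite_lborel ps]) auto
  also have "\<dots> = PiM {..<p} (\<lambda>i. distr std borel (\<lambda>z. a i + \<sigma> * z))"
    by (simp add: distr_std_affine[OF \<sigma>])
  also have "\<dots> = distr (stdn p) (boreln p) (\<lambda>z. \<lambda>i\<in>{..<p}. a i + \<sigma> * z i)"
  proof (rule distr_PiM_componentwise[symmetric])
    show "product_sigma_finite (\<lambda>_::nat. std)"
      using prob_space_std by (auto simp: product_sigma_finite_def intro!: prob_space_imp_sigma_finite)
    show "product_sigma_finite (\<lambda>i. distr std borel (\<lambda>z. a i + \<sigma> * z))"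
      using ps by (simp add: distr_std_affine[OF \<sigma>])
  qed auto
  also have "\<dots> = distr (stdn p) (lebn p) (\<lambda>z. \<lambda>i\<in>{..<p}. a i + \<sigma> * z i)"
    by (intro distr_cong) (auto simp: sets_lebn)
  finally show ?thesis .
qed

lemma stdn_density: "stdn p = density (lebn p) (\<lambda>x. ennreal (\<Prod>i<p. std_normal_density (x i)))"
proof -
  have "stdn p = density (lebn p) (\<lambda>x. \<Prod>i\<in>{..<p}. ennreal (std_normal_density (x i)))"
    by (rule PiM_density[symmetric, OF product_sigma_finite_lborel])
      (use prob_space_std in \<open>auto simp: product_sigma_finite_def intro!: prob_space_imp_sigma_finite\<close>)
  then show ?thesis by (simp add: prod_ennreal)
qed

lemma lebn_shift:
  assumes [measurable]: "f \<in> borel_measurable (lebn p)"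
  shows "(\<integral>\<^sup>+x. f (\<lambda>i\<in>{..<p}. c + x i) \<partial>lebn p) = integral\<^sup>N (lebn p) f"
proof -
  have 1: "distr lborel borel (\<lambda>z. c + z) = (lborel :: real measure)" by (rule lborel_distr_plus)
  have "distr (lebn p) (boreln p) (\<lambda>x. \<lambda>i\<in>{..<p}. c + x i) = PiM {..<p} (\<lambda>i. distr lborel borel (\<lambda>z. c + z))"
    by (rule distr_PiM_componentwise[OF product_sigma_finite_lborel]) (auto simp: 1 product_sigma_finite_lborel)
  then have 2: "distr (lebn p) (boreln p) (\<lambda>x. \<lambda>i\<in>{..<p}. c + x i) = lebn p"
    by (simp add: 1)
  have "integral\<^sup>N (lebn p) f = integral\<^sup>N (distr (lebn p) (boreln p) (\<lambda>x. \<lambda>i\<in>{..<p}. c + x i)) f"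
    by (simp add: 2)
  also have "\<dots> = (\<integral>\<^sup>+x. f (\<lambda>i\<in>{..<p}. c + x i) \<partial>lebn p)"
    by (rule nn_integral_distr) auto
  finally show ?thesis by simp
qed

text \<open>
  Invariance of the Gaussian density under the change of variables in \<open>gauss_rotation\<close>: the exponents
  agree because \<open>\<bar>y - b\<bar>\<^sup>2 + r\<^sup>2 = \<bar>y\<bar>\<^sup>2 + (a - r)\<^sup>2\<close>.
\<close>

lemma gauss_rotation_identity:
  fixes y :: "nat \<Rightarrow> real" and a :: real
  assumes p: "1 \<le> p"
  defines "b \<equiv> a / sqrt (real p)" and "r \<equiv> (\<Sum>i<p. y i) / sqrt (real p)"
  shows "(\<Prod>i<p. std_normal_density (- b + y i)) * std_normal_density r
    = (\<Prod>i<p. std_normal_density (y i)) * std_normal_density (- r + 1 * a)"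
proof -
  have P: "(\<Prod>i<p. std_normal_density (g i)) = (1 / sqrt (2 * pi)) ^ p * exp (- (\<Sum>i<p. (g i)\<^sup>2) / 2)" for g
    by (simp add: std_normal_density_def prod.distrib prod_dividef exp_sum[symmetric] sum_divide_distrib sum_negf power_one_over)
  have s: "sqrt (real p) * sqrt (real p) = real p" "sqrt (real p) \<noteq> 0" using p by auto
  have "(\<Sum>i<p. (- b + y i)\<^sup>2) = (\<Sum>i<p. (y i)\<^sup>2 - 2 * b * y i + b\<^sup>2)"
    by (intro sum.cong) (auto simp: power2_eq_square algebra_simps)
  also have "\<dots> = (\<Sum>i<p. (y i)\<^sup>2) - 2 * b * (\<Sum>i<p. y i) + real p * b\<^sup>2"
    by (simp add: sum.distrib sum_subtractf sum_distrib_left)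
  also have "real p * b\<^sup>2 = a\<^sup>2" using s p by (simp add: b_def power_divide)
  also have "2 * b * (\<Sum>i<p. y i) = 2 * a * r" by (simp add: b_def r_def)
  finally have "(\<Sum>i<p. (- b + y i)\<^sup>2) + r\<^sup>2 = (\<Sum>i<p. (y i)\<^sup>2) + (- r + 1 * a)\<^sup>2"
    by (simp add: power2_eq_square algebra_simps)
  then have "exp (- (\<Sum>i<p. (- b + y i)\<^sup>2) / 2 + - r\<^sup>2 / 2) = exp (- (\<Sum>i<p. (y i)\<^sup>2) / 2 + - (- r + 1 * a)\<^sup>2 / 2)"
    by (simp add: add_divide_distrib[symmetric])
  then show ?thesis unfolding P std_normal_density_def[of r] std_normal_density_def[of "- r + 1 * a"] exp_add
    by simp
qed

text \<open>
  Replacing the component of \<open>z\<close> along the constant vectors by the independent \<open>\<xi>\<close> preserves the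
  standard normal law. The proof writes the exchange of the two components as translations: first of
  \<open>\<xi>\<close> by \<open>sqrt p\<close> times the mean of \<open>z\<close>, then of \<open>z\<close> by \<open>a / sqrt p\<close> in every coordinate.
\<close>

lemma gauss_rotation:
  assumes p: "1 \<le> p"
  shows "distr (stdn p \<Otimes>\<^sub>M std) (stdn p) (\<lambda>(z, \<xi>). \<lambda>i\<in>{..<p}. (\<xi> / sqrt (real p) - (\<Sum>j<p. z j) / real p) + z i) = stdn p"
    (is "distr ?P _ ?R = _")
proof (rule measure_eqI)
  have R[measurable]: "?R \<in> measurable ?P (stdn p)" by measurable
  fix A assume "A \<in> sets (distr ?P (stdn p) ?R)"
  then have A[measurable]: "A \<in> sets (boreln p)" by (simp add: sets_stdn)
  interpret std: prob_space std by (rule prob_space_std)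
  interpret L: sigma_finite_measure "lebn p" by (rule sigma_finite_lebn)
  interpret LL: pair_sigma_finite lborel "lebn p" ..
  define \<Phi> where "\<Phi> x = (\<Prod>i<p. std_normal_density (x i))" for x :: "nat \<Rightarrow> real"
  have [measurable]: "\<Phi> \<in> borel_measurable (boreln p)" unfolding \<Phi>_def by measurable
  have \<Phi>0: "0 \<le> \<Phi> x" for x by (auto simp: \<Phi>_def intro!: prod_nonneg)
  define r where "r x = (\<Sum>j<p. x j) / sqrt (real p)" for x :: "nat \<Rightarrow> real"
  have [measurable]: "r \<in> borel_measurable (boreln p)" unfolding r_def by measurable
  define sh where "sh c x = (\<lambda>i\<in>{..<p}. c + x i)" for c :: real and x :: "nat \<Rightarrow> real"
  have [measurable]: "(\<lambda>(c, x). sh c x) \<in> measurable (borel \<Otimes>\<^sub>M boreln p) (boreln p)"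
    unfolding sh_def by measurable
  have [measurable]: "(\<lambda>\<xi>. indicator A (sh (g \<xi>) z) :: ennreal) \<in> borel_measurable borel"
    if [measurable]: "g \<in> borel_measurable borel" for z and g :: "real \<Rightarrow> real"
    unfolding sh_def by measurable
  have sq: "sqrt (real p) * sqrt (real p) = real p" "sqrt (real p) \<noteq> 0" using p by auto
  let ?I = "\<lambda>x. indicator A x :: ennreal" and ?d = std_normal_density
  let ?s = "sqrt (real p)"
  have "emeasure (distr ?P (stdn p) ?R) A = (\<integral>\<^sup>+ x. ?I x \<partial>distr ?P (stdn p) ?R)"
    using A by (simp add: sets_stdn)
  also have "\<dots> = (\<integral>\<^sup>+ w. ?I (?R w) \<partial>?P)"
    by (rule nn_integral_distr[OF R]) (simp add: sets_stdn)
  also have "\<dots> = (\<integral>\<^sup>+ z. \<integral>\<^sup>+ \<xi>. ?I (?R (z, \<xi>)) \<partial>std \<partial>stdn p)"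
    by (rule std.nn_integral_fst[symmetric]) measurable
  also have "\<dots> = (\<integral>\<^sup>+ z. \<Phi> z * (\<integral>\<^sup>+ \<xi>. ?d \<xi> * ?I (sh (\<xi> / ?s - (\<Sum>j<p. z j) / real p) z) \<partial>lborel) \<partial>lebn p)"
    unfolding sh_def[symmetric] prod.case \<Phi>_def stdn_density
    by (subst (1 2) nn_integral_density) auto
  also have "\<dots> = (\<integral>\<^sup>+ z. \<integral>\<^sup>+ a. \<Phi> z * (?d (r z + 1 * a) * ?I (sh (a / ?s) z)) \<partial>lborel \<partial>lebn p)"
  proof (intro nn_integral_cong)
    fix z
    have "(r z + 1 * a) / ?s - (\<Sum>j<p. z j) / real p = a / ?s" for a
      using sq by (simp add: r_def field_simps)
    then have *: "(\<integral>\<^sup>+ \<xi>. ?d \<xi> * ?I (sh (\<xi> / ?s - (\<Sum>j<p. z j) / real p) z) \<partial>lborel)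
        = (\<integral>\<^sup>+ a. ?d (r z + 1 * a) * ?I (sh (a / ?s) z) \<partial>lborel)"
      by (subst nn_integral_real_affine[where t = "r z" and c = 1]) auto
    show "\<Phi> z * (\<integral>\<^sup>+ \<xi>. ?d \<xi> * ?I (sh (\<xi> / ?s - (\<Sum>j<p. z j) / real p) z) \<partial>lborel)
        = (\<integral>\<^sup>+ a. \<Phi> z * (?d (r z + 1 * a) * ?I (sh (a / ?s) z)) \<partial>lborel)"
      unfolding * by (rule nn_integral_cmult[symmetric]) auto
  qed
  also have "\<dots> = (\<integral>\<^sup>+ a. \<integral>\<^sup>+ z. \<Phi> z * (?d (r z + 1 * a) * ?I (sh (a / ?s) z)) \<partial>lebn p \<partial>lborel)"
    by (rule LL.Fubini') measurable
  also have "\<dots> = (\<integral>\<^sup>+ a. \<integral>\<^sup>+ y. \<Phi> (sh (- (a / ?s)) y) * (?d (r (sh (- (a / ?s)) y) + 1 * a) * ?I (sh (a / ?s) (sh (- (a / ?s)) y))) \<partial>lebn p \<partial>lborel)"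
    unfolding sh_def[of "- _"] by (intro nn_integral_cong lebn_shift[symmetric]) measurable
  also have "\<dots> = (\<integral>\<^sup>+ a. \<integral>\<^sup>+ y. \<Phi> y * ?I y * ?d (- r y + 1 * a) \<partial>lebn p \<partial>lborel)"
  proof (intro nn_integral_cong)
    fix a y assume y: "y \<in> space (lebn p)"
    have 1: "sh (a / ?s) (sh (- (a / ?s)) y) = y"
      using y by (auto simp: sh_def space_PiM PiE_def extensional_def fun_eq_iff)
    have 2: "r (sh (- (a / ?s)) y) + 1 * a = r y"
    proof -
      have e: "real p * (a / ?s) / ?s = a" using sq p by (simp add: field_simps)
      have "r (sh (- (a / ?s)) y) = ((\<Sum>j<p. y j) - real p * (a / ?s)) / ?s"
        by (simp add: r_def sh_def sum_subtractf)
      then show ?thesis unfolding diff_divide_distrib e by (simp add: r_def)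
    qed
    have "\<Phi> (sh (- (a / ?s)) y) * ?d (r y) = \<Phi> y * ?d (- r y + 1 * a)"
      using gauss_rotation_identity[OF p, of a y] by (simp add: \<Phi>_def sh_def r_def)
    then have "ennreal (\<Phi> (sh (- (a / ?s)) y)) * ennreal (?d (r y)) = ennreal (\<Phi> y) * ennreal (?d (- r y + 1 * a))"
      using \<Phi>0 by (simp add: ennreal_mult[symmetric])
    then show "\<Phi> (sh (- (a / ?s)) y) * (?d (r (sh (- (a / ?s)) y) + 1 * a) * ?I (sh (a / ?s) (sh (- (a / ?s)) y)))
        = \<Phi> y * ?I y * ?d (- r y + 1 * a)"
      unfolding 1 2 by (simp only: mult.assoc[symmetric]) (simp only: ac_simps)
  qed
  also have "\<dots> = (\<integral>\<^sup>+ y. \<integral>\<^sup>+ a. \<Phi> y * ?I y * ?d (- r y + 1 * a) \<partial>lborel \<partial>lebn p)"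
    by (rule LL.Fubini'[symmetric]) measurable
  also have "\<dots> = (\<integral>\<^sup>+ y. \<Phi> y * ?I y \<partial>lebn p)"
  proof (intro nn_integral_cong)
    fix y
    have "(\<integral>\<^sup>+ a. ?d (- r y + 1 * a) \<partial>lborel) = (\<integral>\<^sup>+ a. ?d a \<partial>lborel)"
      by (subst (2) nn_integral_real_affine[where t = "- r y" and c = 1]) auto
    also have "\<dots> = 1"
      using std.emeasure_space_1 by (simp add: emeasure_density)
    finally show "(\<integral>\<^sup>+ a. \<Phi> y * ?I y * ?d (- r y + 1 * a) \<partial>lborel) = \<Phi> y * ?I y"
      by (subst nn_integral_cmult) auto
  qed
  also have "\<dots> = emeasure (stdn p) A"
    unfolding \<Phi>_def by (subst stdn_density, subst emeasure_density) (auto simp: sets_lebn)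
  finally show "emeasure (distr ?P (stdn p) ?R) A = emeasure (stdn p) A" .
qed simp

text \<open>
  The one-factor representation: \<open>w\<close> is the common factor and \<open>z\<close> the vector of individual errors.
\<close>

definition factor_sample :: "nat \<Rightarrow> real \<Rightarrow> (nat \<Rightarrow> real) \<Rightarrow> (nat \<Rightarrow> real) \<times> real \<Rightarrow> nat \<Rightarrow> real" where
  "factor_sample p \<gamma> \<theta> = (\<lambda>(z, w). \<lambda>i\<in>{..<p}. \<theta> i + sqrt \<gamma> * w + sqrt (1 - \<gamma>) * z i)"

lemma factor_sample_measurable [measurable]:
  "factor_sample p \<gamma> \<theta> \<in> measurable (boreln p \<Otimes>\<^sub>M borel) (boreln p)"
  unfolding factor_sample_def by measurable

lemma multivariate_normal_equicorrelation:
  assumes p: "1 \<le> p" and \<gamma>: "0 \<le> \<gamma>" "\<gamma> < 1"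
  shows "multivariate_normal p \<theta> (equicorrelation p \<gamma>)
    = distr (stdn p \<Otimes>\<^sub>M std) (lebn p) (factor_sample p \<gamma> \<theta>)" (is "?L = ?R")
proof (rule measure_eqI)
  define V where "V = 1 - \<gamma> + \<gamma> * real p"
  define q where "q f = ((\<Sum>i<p. (f i)\<^sup>2) - \<gamma> * (\<Sum>i<p. f i)\<^sup>2 / V) / (1 - \<gamma>)" for f :: "nat \<Rightarrow> real"
  define c where "c = sqrt ((2 * pi) ^ p * ((1 - \<gamma>) ^ (p - 1) * V))"
  have V: "V > 0" using \<gamma> unfolding V_def by (intro add_pos_nonneg) auto
  have dens: "?L = density (lebn p) (\<lambda>x. ennreal (exp (- q (\<lambda>i. x i - \<theta> i) / 2) / c))"
    unfolding multivariate_normal_def Let_def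
    using equicorrelation_quadratic_form[OF p \<gamma>] det_equicorrelation[OF p]
    by (simp add: q_def V_def c_def)
  show "sets ?L = sets ?R" by (simp add: dens)
  fix A assume "A \<in> sets ?L"
  then have A[measurable]: "A \<in> sets (boreln p)" by (simp add: dens sets_lebn)
  interpret std: prob_space std by (rule prob_space_std)
  interpret L: sigma_finite_measure "lebn p" by (rule sigma_finite_lebn)
  interpret LL: pair_sigma_finite lborel "lebn p" ..
  interpret N: prob_space "stdn p" by (rule prob_space_stdn)
  interpret NN: pair_sigma_finite "stdn p" std ..
  let ?I = "\<lambda>x. indicator A x :: ennreal" and ?d = std_normal_density
  let ?n = "\<lambda>x w. \<Prod>i<p. normal_density (sqrt \<gamma> * w) (sqrt (1 - \<gamma>)) (x i - \<theta> i)"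
  let ?m = "\<lambda>x w. \<Prod>i<p. normal_density (\<theta> i + sqrt \<gamma> * w) (sqrt (1 - \<gamma>)) (x i)"
  have s1: "0 < sqrt (1 - \<gamma>)" using \<gamma> by simp
  have [measurable]: "(\<lambda>x. q (\<lambda>i. x i - \<theta> i)) \<in> borel_measurable (boreln p)"
    unfolding q_def by measurable
  have [measurable]: "(\<lambda>x. ?m (snd x) (fst x)) \<in> borel_measurable (borel \<Otimes>\<^sub>M boreln p)"
    unfolding normal_density_def by measurable
  have "emeasure ?L A = (\<integral>\<^sup>+x. ennreal (exp (- q (\<lambda>i. x i - \<theta> i) / 2) / c) * ?I x \<partial>lebn p)"
    unfolding dens by (rule emeasure_density) (auto simp: sets_lebn)
  also have "\<dots> = (\<integral>\<^sup>+x. \<integral>\<^sup>+w. ?d w * ?m x w * ?I x \<partial>lborel \<partial>lebn p)"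
  proof (intro nn_integral_cong)
    fix x :: "nat \<Rightarrow> real"
    define f where "f i = x i - \<theta> i" for i
    define nd where "nd = normal_density (sqrt \<gamma> * (\<Sum>i<p. f i) / V) (sqrt ((1 - \<gamma>) / V))"
    have "prob_space (density lborel nd)"
      unfolding nd_def using V \<gamma> by (intro prob_space_normal_density) simp
    then have 1: "(\<integral>\<^sup>+w. nd w \<partial>lborel) = 1"
      using prob_space.emeasure_space_1[of "density lborel nd"] by (simp add: emeasure_density nd_def)
    have "?m x w = ?n x w" for w
      by (intro prod.cong) (auto simp: normal_density_def algebra_simps)
    then have e1: "?d w * ?m x w = exp (- q f / 2) / c * nd w" for w
      using equicorrelation_density_mixture[OF p \<gamma>, of w f]
      unfolding q_def[symmetric] V_def[symmetric] c_def[symmetric] nd_def[symmetric]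
      by (simp add: q_def f_def)
    have e2: "0 \<le> exp (- q f / 2) / c" using V \<gamma> unfolding c_def by (intro divide_nonneg_nonneg) auto
    have eq: "ennreal (?d w * ?m x w) = ennreal (exp (- q f / 2) / c) * nd w" for w
      unfolding e1 by (rule ennreal_mult'[OF e2])
    have "(\<integral>\<^sup>+w. ?d w * ?m x w * ?I x \<partial>lborel) = (\<integral>\<^sup>+w. (exp (- q f / 2) / c) * ?I x * nd w \<partial>lborel)"
      unfolding eq by (simp add: ac_simps)
    also have "\<dots> = (exp (- q f / 2) / c) * ?I x"
      using 1 by (subst nn_integral_cmult) (auto simp: nd_def)
    finally have "(\<integral>\<^sup>+w. ?d w * ?m x w * ?I x \<partial>lborel) = ennreal (exp (- q f / 2) / c) * ?I x" .
    then show "ennreal (exp (- q (\<lambda>i. x i - \<theta> i) / 2) / c) * ?I x = (\<integral>\<^sup>+w. ?d w * ?m x w * ?I x \<partial>lborel)"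
      unfolding f_def by simp
  qed
  also have "\<dots> = (\<integral>\<^sup>+w. \<integral>\<^sup>+x. ?d w * ?m x w * ?I x \<partial>lebn p \<partial>lborel)"
    by (rule LL.Fubini') measurable
  also have "\<dots> = (\<integral>\<^sup>+w. ?d w * (\<integral>\<^sup>+z. ?I (factor_sample p \<gamma> \<theta> (z, w)) \<partial>stdn p) \<partial>lborel)"
  proof (intro nn_integral_cong)
    fix w
    have "(\<integral>\<^sup>+x. ?d w * ?m x w * ?I x \<partial>lebn p) = ?d w * (\<integral>\<^sup>+x. ?m x w * ?I x \<partial>lebn p)"
      by (subst nn_integral_cmult[symmetric])
        (auto simp: ennreal_mult' mult.assoc sets_lebn intro!: nn_integral_cong)
    also have "(\<integral>\<^sup>+x. ?m x w * ?I x \<partial>lebn p) = emeasure (density (lebn p) (\<lambda>x. ennreal (?m x w))) A"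
      by (subst emeasure_density) (auto simp: sets_lebn)
    also have "\<dots> = (\<integral>\<^sup>+x. ?I x \<partial>distr (stdn p) (lebn p) (\<lambda>z. \<lambda>i\<in>{..<p}. \<theta> i + sqrt \<gamma> * w + sqrt (1 - \<gamma>) * z i))"
      unfolding product_normal_density[OF s1] by (simp add: sets_lebn)
    also have "\<dots> = (\<integral>\<^sup>+z. ?I (factor_sample p \<gamma> \<theta> (z, w)) \<partial>stdn p)"
      by (subst nn_integral_distr) (auto simp: sets_lebn factor_sample_def)
    finally show "(\<integral>\<^sup>+x. ?d w * ?m x w * ?I x \<partial>lebn p) = ?d w * (\<integral>\<^sup>+z. ?I (factor_sample p \<gamma> \<theta> (z, w)) \<partial>stdn p)" .
  qed
  also have "\<dots> = (\<integral>\<^sup>+w. (\<integral>\<^sup>+z. ?I (factor_sample p \<gamma> \<theta> (z, w)) \<partial>stdn p) \<partial>std)"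
    by (subst nn_integral_density) auto
  also have "\<dots> = (\<integral>\<^sup>+zw. ?I (factor_sample p \<gamma> \<theta> zw) \<partial>(stdn p \<Otimes>\<^sub>M std))"
    by (rule NN.nn_integral_snd) measurable
  also have "\<dots> = (\<integral>\<^sup>+x. ?I x \<partial>?R)"
    by (subst nn_integral_distr) (auto simp: sets_lebn)
  also have "\<dots> = emeasure ?R A" by (simp add: sets_lebn)
  finally show "emeasure ?L A = emeasure ?R A" .
qed

lemma sample_law_factor:
  assumes p: "1 \<le> p" and \<gamma>: "0 \<le> \<gamma>" "\<gamma> < 1"
  shows "sample_law p \<gamma> \<theta>
    = distr ((stdn p \<Otimes>\<^sub>M std) \<Otimes>\<^sub>M std) (lebn p \<Otimes>\<^sub>M std) (\<lambda>(zw, \<xi>). (factor_sample p \<gamma> \<theta> zw, \<xi>))"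
proof -
  have "distr (stdn p \<Otimes>\<^sub>M std) (lebn p) (factor_sample p \<gamma> \<theta>) \<Otimes>\<^sub>M distr std std (\<lambda>x. x)
    = distr ((stdn p \<Otimes>\<^sub>M std) \<Otimes>\<^sub>M std) (lebn p \<Otimes>\<^sub>M std) (\<lambda>(zw, \<xi>). (factor_sample p \<gamma> \<theta> zw, \<xi>))"
    by (rule pair_measure_distr) (auto simp: distr_id2 prob_space_std intro!: prob_space_imp_sigma_finite)
  then show ?thesis unfolding sample_law_def multivariate_normal_equicorrelation[OF assms]
    by (simp add: distr_id2)
qed

lemma prob_space_sample_law:
  assumes p: "1 \<le> p" and \<gamma>: "0 \<le> \<gamma>" "\<gamma> < 1"
  shows "prob_space (sample_law p \<gamma> \<theta>)"
  unfolding sample_law_factor[OF assms]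
  by (intro prob_space.prob_space_distr prob_space_pair prob_space_std prob_space_stdn) measurable

lemma sets_sample_law [measurable_cong]:
  "sets (sample_law p \<gamma> \<theta>) = sets (boreln p \<Otimes>\<^sub>M borel)"
  unfolding sample_law_def multivariate_normal_def
  by (intro sets_pair_measure_cong) (auto simp: sets_lebn)

text \<open>
  The mean vector of the transformed data under \<open>P\<^bsub>\<theta>,\<gamma>\<^esub>\<close>.
\<close>

definition mean_shift :: "nat \<Rightarrow> real \<Rightarrow> (nat \<Rightarrow> real) \<Rightarrow> nat \<Rightarrow> real" where
  "mean_shift p \<gamma> \<theta> i = (\<theta> i - (\<Sum>j<p. \<theta> j) / real p) / sqrt (1 - \<gamma>)"

lemma X_tilde_factor:
  assumes p: "1 \<le> p" and \<gamma>: "0 \<le> \<gamma>" "\<gamma> < 1" and i: "i < p"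
  shows "X_tilde p \<gamma> (factor_sample p \<gamma> \<theta> (z, w), \<xi>) i
    = mean_shift p \<gamma> \<theta> i + ((\<xi> / sqrt (real p) - (\<Sum>j<p. z j) / real p) + z i)"
proof -
  have g: "sqrt (1 - \<gamma>) \<noteq> 0" using \<gamma> by simp
  have "(\<Sum>j<p. factor_sample p \<gamma> \<theta> (z, w) j)
      = (\<Sum>j<p. \<theta> j) + real p * (sqrt \<gamma> * w) + sqrt (1 - \<gamma>) * (\<Sum>j<p. z j)"
    by (simp add: factor_sample_def sum.distrib sum_distrib_left)
  then have "1 / real p * (\<Sum>j<p. factor_sample p \<gamma> \<theta> (z, w) j)
      = (\<Sum>j<p. \<theta> j) / real p + sqrt \<gamma> * w + sqrt (1 - \<gamma>) * ((\<Sum>j<p. z j) / real p)"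
    using p by (simp add: add_divide_distrib)
  moreover have "factor_sample p \<gamma> \<theta> (z, w) i = \<theta> i + sqrt \<gamma> * w + sqrt (1 - \<gamma>) * z i"
    using i by (simp add: factor_sample_def)
  ultimately have "factor_sample p \<gamma> \<theta> (z, w) i - 1 / real p * (\<Sum>j<p. factor_sample p \<gamma> \<theta> (z, w) j)
      = (\<theta> i - (\<Sum>j<p. \<theta> j) / real p) + sqrt (1 - \<gamma>) * (z i - (\<Sum>j<p. z j) / real p)"
    by (simp add: algebra_simps)
  then show ?thesis using g by (simp add: mean_shift_def add_divide_distrib)
qed

lemma X_tilde_measurable [measurable]:
  "i < p \<Longrightarrow> (\<lambda>\<omega>. X_tilde p \<gamma> \<omega> i) \<in> borel_measurable (boreln p \<Otimes>\<^sub>M borel)"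
proof -
  assume i: "i < p"
  have "(\<lambda>\<omega>. X_tilde p \<gamma> \<omega> i) = (\<lambda>\<omega>. 1 / sqrt (1 - \<gamma>) * (fst \<omega> i - 1 / real p * (\<Sum>j<p. fst \<omega> j)) + snd \<omega> / sqrt (real p))"
    by (auto simp: fun_eq_iff)
  also have "\<dots> \<in> borel_measurable (boreln p \<Otimes>\<^sub>M borel)"
  proof -
    have [measurable]: "(\<lambda>\<omega>. fst \<omega> i) \<in> borel_measurable (boreln p \<Otimes>\<^sub>M borel)"
      using i by (intro measurable_compose[OF measurable_fst] measurable_component_singleton) simp
    show ?thesis by measurable
  qed
  finally show ?thesis .
qed

text \<open>
  The right-hand side is the law \<open>N(\<mu>, I)\<close> with \<open>\<mu> = mean_shift p \<gamma> \<theta>\<close>.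
\<close>

lemma X_tilde_law:
  assumes p: "1 \<le> p" and \<gamma>: "0 \<le> \<gamma>" "\<gamma> < 1"
  shows "distr (sample_law p \<gamma> \<theta>) (boreln p) (\<lambda>\<omega>. \<lambda>i\<in>{..<p}. X_tilde p \<gamma> \<omega> i)
    = distr (stdn p) (boreln p) (\<lambda>g. \<lambda>i\<in>{..<p}. mean_shift p \<gamma> \<theta> i + g i)"
proof -
  let ?B = "boreln p"
  let ?rot = "\<lambda>(z, \<xi>). \<lambda>i\<in>{..<p}. (\<xi> / sqrt (real p) - (\<Sum>j<p. z j) / real p) + z i"
  let ?sh = "\<lambda>g. \<lambda>i\<in>{..<p}. mean_shift p \<gamma> \<theta> i + g i"
  interpret std: prob_space std by (rule prob_space_std)
  interpret N: prob_space "stdn p" by (rule prob_space_stdn)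
  have "distr (stdn p \<Otimes>\<^sub>M std) (stdn p) fst \<Otimes>\<^sub>M distr std std (\<lambda>x. x)
      = distr ((stdn p \<Otimes>\<^sub>M std) \<Otimes>\<^sub>M std) (stdn p \<Otimes>\<^sub>M std) (\<lambda>(zw, \<xi>). (fst zw, \<xi>))"
    by (rule pair_measure_distr) (auto simp: distr_id2 prob_space_std intro!: prob_space_imp_sigma_finite)
  then have marg: "distr ((stdn p \<Otimes>\<^sub>M std) \<Otimes>\<^sub>M std) (stdn p \<Otimes>\<^sub>M std) (\<lambda>(zw, \<xi>). (fst zw, \<xi>)) = stdn p \<Otimes>\<^sub>M std"
    by (simp add: distr_id2 std.distr_pair_fst)
  have "distr (sample_law p \<gamma> \<theta>) ?B (\<lambda>\<omega>. \<lambda>i\<in>{..<p}. X_tilde p \<gamma> \<omega> i)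
     = distr ((stdn p \<Otimes>\<^sub>M std) \<Otimes>\<^sub>M std) ?B
        ((\<lambda>\<omega>. \<lambda>i\<in>{..<p}. X_tilde p \<gamma> \<omega> i) \<circ> (\<lambda>(zw, \<xi>). (factor_sample p \<gamma> \<theta> zw, \<xi>)))"
    unfolding sample_law_factor[OF assms] by (rule distr_distr) measurable
  also have "\<dots> = distr ((stdn p \<Otimes>\<^sub>M std) \<Otimes>\<^sub>M std) ?B (?sh \<circ> (?rot \<circ> (\<lambda>(zw, \<xi>). (fst zw, \<xi>))))"
    by (intro distr_cong refl) (auto simp: X_tilde_factor[OF assms] fun_eq_iff restrict_def simp del: X_tilde.simps)
  also have "\<dots> = distr (distr ((stdn p \<Otimes>\<^sub>M std) \<Otimes>\<^sub>M std) (stdn p) (?rot \<circ> (\<lambda>(zw, \<xi>). (fst zw, \<xi>)))) ?B ?sh"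
    by (rule distr_distr[symmetric]) measurable
  also have "distr ((stdn p \<Otimes>\<^sub>M std) \<Otimes>\<^sub>M std) (stdn p) (?rot \<circ> (\<lambda>(zw, \<xi>). (fst zw, \<xi>)))
      = distr (distr ((stdn p \<Otimes>\<^sub>M std) \<Otimes>\<^sub>M std) (stdn p \<Otimes>\<^sub>M std) (\<lambda>(zw, \<xi>). (fst zw, \<xi>))) (stdn p) ?rot"
    by (rule distr_distr[symmetric]) measurable
  also have "\<dots> = stdn p" unfolding marg by (rule gauss_rotation[OF p])
  finally show ?thesis .
qed

text \<open>
  Transfer of events. The hypothesis \<open>Q'\<close> says that \<open>Q\<close> looks only at the coordinates below \<open>p\<close>.
\<close>

lemma measure_X_tilde:
  assumes p: "1 \<le> p" and \<gamma>: "0 \<le> \<gamma>" "\<gamma> < 1"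
    and Q: "{x \<in> space (boreln p). Q x} \<in> sets (boreln p)"
    and Q': "\<And>x. Q (restrict x {..<p}) = Q x"
  shows "\<P>(\<omega> in sample_law p \<gamma> \<theta>. Q (X_tilde p \<gamma> \<omega>))
      = \<P>(g in stdn p. Q (\<lambda>i. mean_shift p \<gamma> \<theta> i + g i))"
    and "{\<omega> \<in> space (sample_law p \<gamma> \<theta>). Q (X_tilde p \<gamma> \<omega>)} \<in> sets (sample_law p \<gamma> \<theta>)"
proof -
  let ?B = "boreln p"
  let ?A = "{x \<in> space ?B. Q x}"
  let ?X = "\<lambda>\<omega>. \<lambda>i\<in>{..<p}. X_tilde p \<gamma> \<omega> i"
  let ?sh = "\<lambda>g. \<lambda>i\<in>{..<p}. mean_shift p \<gamma> \<theta> i + g i"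
  have X: "?X \<in> measurable (sample_law p \<gamma> \<theta>) ?B" by measurable
  have S: "?sh \<in> measurable (stdn p) ?B" by measurable
  have eq1: "?X -` ?A \<inter> space (sample_law p \<gamma> \<theta>) = {\<omega> \<in> space (sample_law p \<gamma> \<theta>). Q (X_tilde p \<gamma> \<omega>)}"
    using measurable_space[OF X] Q'[of "X_tilde p \<gamma> _"] by (auto simp: restrict_def)
  have eq2: "?sh -` ?A \<inter> space (stdn p) = {g \<in> space (stdn p). Q (\<lambda>i. mean_shift p \<gamma> \<theta> i + g i)}"
    using measurable_space[OF S] Q'[of "\<lambda>i. mean_shift p \<gamma> \<theta> i + _ i"] by auto
  show "\<P>(\<omega> in sample_law p \<gamma> \<theta>. Q (X_tilde p \<gamma> \<omega>))
      = \<P>(g in stdn p. Q (\<lambda>i. mean_shift p \<gamma> \<theta> i + g i))"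
    unfolding eq1[symmetric] eq2[symmetric] measure_distr[OF X Q, symmetric] measure_distr[OF S Q, symmetric]
    by (simp add: X_tilde_law[OF p \<gamma>])
  show "{\<omega> \<in> space (sample_law p \<gamma> \<theta>). Q (X_tilde p \<gamma> \<omega>)} \<in> sets (sample_law p \<gamma> \<theta>)"
    unfolding eq1[symmetric] using X Q by (rule measurable_sets)
qed

section \<open>The projection on the constant direction\<close>

lemma integral_std_affine_square:
  "integrable std (\<lambda>w. (c + b * w)\<^sup>2)" "(\<integral>w. (c + b * w)\<^sup>2 \<partial>std) = c\<^sup>2 + b\<^sup>2"
proof -
  have eq: "(c + b * w)\<^sup>2 = b\<^sup>2 * w\<^sup>2 + 2 * c * b * w + c\<^sup>2" for w
    by (simp add: power2_eq_square algebra_simps)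
  show "integrable std (\<lambda>w. (c + b * w)\<^sup>2)"
    unfolding eq by (intro integrable_std_intros)
  show "(\<integral>w. (c + b * w)\<^sup>2 \<partial>std) = c\<^sup>2 + b\<^sup>2" unfolding eq by simp
qed

text \<open>
  The inner product of \<open>X\<close>, the first component of the pair \<open>(X, \<xi>)\<close>, with the unit constant vector.
\<close>

definition mean_proj :: "nat \<Rightarrow> (nat \<Rightarrow> real) \<times> real \<Rightarrow> real" where
  "mean_proj p \<omega> = (\<Sum>i<p. 1 / sqrt (real p) * fst \<omega> i)"

lemma mean_proj_measurable [measurable]:
  "mean_proj p \<in> borel_measurable (boreln p \<Otimes>\<^sub>M borel)"
  unfolding mean_proj_def by measurable

lemma mean_proj_tail:
  assumes p: "1 \<le> p" and \<gamma>: "0 \<le> \<gamma>" "\<gamma> < 1" and a: "0 < a"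
  shows "\<P>(\<omega> in sample_law p \<gamma> \<theta>. a \<le> \<bar>mean_proj p \<omega> - (\<Sum>i<p. \<theta> i) / sqrt (real p)\<bar>) \<le> (1 - \<gamma> + \<gamma> * real p) / a\<^sup>2"
    and "{\<omega> \<in> space (sample_law p \<gamma> \<theta>).
      a \<le> \<bar>mean_proj p \<omega> - (\<Sum>i<p. \<theta> i) / sqrt (real p)\<bar>} \<in> sets (sample_law p \<gamma> \<theta>)"
proof -
  interpret S: prob_space "sample_law p \<gamma> \<theta>" by (rule prob_space_sample_law[OF p \<gamma>])
  interpret std: prob_space std by (rule prob_space_std)
  interpret N: finite_product_prob_space "\<lambda>_. std" "{..<p}" by (rule finite_product_prob_space_std)
  define m where "m = (\<Sum>i<p. \<theta> i) / sqrt (real p)"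
  define V where "V = 1 - \<gamma> + \<gamma> * real p"
  define \<alpha> \<beta> where "\<alpha> = sqrt (1 - \<gamma>) / sqrt (real p)" and "\<beta> = sqrt \<gamma> * sqrt (real p)"
  have V: "0 < V" using \<gamma> unfolding V_def by (intro add_pos_nonneg) auto
  have sp: "sqrt (real p) \<noteq> 0" "sqrt (real p) * sqrt (real p) = real p" using p by auto
  let ?A = "{\<omega> \<in> space (sample_law p \<gamma> \<theta>). a \<le> \<bar>mean_proj p \<omega> - m\<bar>}"
  show A: "{\<omega> \<in> space (sample_law p \<gamma> \<theta>).
      a \<le> \<bar>mean_proj p \<omega> - (\<Sum>i<p. \<theta> i) / sqrt (real p)\<bar>} \<in> sets (sample_law p \<gamma> \<theta>)"
    by measurable
  have proj: "mean_proj p (factor_sample p \<gamma> \<theta> (z, w), \<xi>) - m = \<alpha> * (\<Sum>i<p. z i) + \<beta> * w" for z w \<xi>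
  proof -
    have "mean_proj p (factor_sample p \<gamma> \<theta> (z, w), \<xi>)
        = ((\<Sum>i<p. \<theta> i) + real p * (sqrt \<gamma> * w) + sqrt (1 - \<gamma>) * (\<Sum>i<p. z i)) / sqrt (real p)"
      by (simp add: mean_proj_def factor_sample_def sum_divide_distrib[symmetric] sum.distrib sum_distrib_left)
    moreover have "real p * (sqrt \<gamma> * w) / sqrt (real p) = \<beta> * w"
      using sp by (simp add: \<beta>_def field_simps)
    ultimately show ?thesis by (simp add: add_divide_distrib m_def \<alpha>_def)
  qed
  have "(\<integral>\<^sup>+\<omega>. ennreal ((mean_proj p \<omega> - m)\<^sup>2) \<partial>sample_law p \<gamma> \<theta>)
      = (\<integral>\<^sup>+\<omega>. ennreal ((mean_proj p (factor_sample p \<gamma> \<theta> (fst \<omega>), snd \<omega>) - m)\<^sup>2) \<partial>((stdn p \<Otimes>\<^sub>M std) \<Otimes>\<^sub>M std))"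
    unfolding sample_law_factor[OF p \<gamma>] by (subst nn_integral_distr) (auto simp: case_prod_beta)
  also have "\<dots> = (\<integral>\<^sup>+zw. \<integral>\<^sup>+\<xi>. ennreal ((mean_proj p (factor_sample p \<gamma> \<theta> zw, \<xi>) - m)\<^sup>2) \<partial>std \<partial>(stdn p \<Otimes>\<^sub>M std))"
    by (subst std.nn_integral_fst[symmetric]) auto
  also have "\<dots> = (\<integral>\<^sup>+zw. ennreal ((\<alpha> * (\<Sum>i<p. fst zw i) + \<beta> * snd zw)\<^sup>2) \<partial>(stdn p \<Otimes>\<^sub>M std))"
  proof (intro nn_integral_cong)
    fix zw :: "(nat \<Rightarrow> real) \<times> real"
    show "(\<integral>\<^sup>+\<xi>. ennreal ((mean_proj p (factor_sample p \<gamma> \<theta> zw, \<xi>) - m)\<^sup>2) \<partial>std)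
        = ennreal ((\<alpha> * (\<Sum>i<p. fst zw i) + \<beta> * snd zw)\<^sup>2)"
      using proj[of "fst zw" "snd zw"] std.emeasure_space_1 by simp
  qed
  also have "\<dots> = (\<integral>\<^sup>+z. \<integral>\<^sup>+w. ennreal ((\<alpha> * (\<Sum>i<p. z i) + \<beta> * w)\<^sup>2) \<partial>std \<partial>stdn p)"
    by (subst std.nn_integral_fst[symmetric]) auto
  also have "\<dots> = (\<integral>\<^sup>+z. ennreal ((\<Sum>i<p. \<alpha> * z i)\<^sup>2 + \<beta>\<^sup>2) \<partial>stdn p)"
    by (intro nn_integral_cong, subst nn_integral_eq_integral)
      (auto simp: integral_std_affine_square sum_distrib_left)
  also have "\<dots> = ennreal (\<integral>z. (\<Sum>i<p. \<alpha> * z i)\<^sup>2 + \<beta>\<^sup>2 \<partial>stdn p)"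
  proof (rule nn_integral_eq_integral)
    show "integrable (stdn p) (\<lambda>z. (\<Sum>i<p. \<alpha> * z i)\<^sup>2 + \<beta>\<^sup>2)"
      by (intro Bochner_Integration.integrable_add N.integrable_sum_square) (auto simp: power_mult_distrib)
  qed auto
  also have "(\<integral>z. (\<Sum>i<p. \<alpha> * z i)\<^sup>2 + \<beta>\<^sup>2 \<partial>stdn p) = real p * \<alpha>\<^sup>2 + \<beta>\<^sup>2"
  proof -
    have "integrable (stdn p) (\<lambda>z. (\<Sum>i<p. \<alpha> * z i)\<^sup>2)"
      by (intro N.integrable_sum_square) (auto simp: power_mult_distrib)
    moreover have "(\<integral>z. (\<Sum>i<p. \<alpha> * z i)\<^sup>2 \<partial>stdn p) = (\<Sum>i<p. \<integral>y. (\<alpha> * y)\<^sup>2 \<partial>std)"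
      by (intro N.integral_sum_square) (auto simp: power_mult_distrib)
    ultimately show ?thesis using N.P.prob_space by (simp add: power_mult_distrib)
  qed
  also have "real p * \<alpha>\<^sup>2 + \<beta>\<^sup>2 = V"
    using p \<gamma> by (simp add: \<alpha>_def \<beta>_def V_def power_divide power_mult_distrib)
  finally have nn: "(\<integral>\<^sup>+\<omega>. ennreal ((mean_proj p \<omega> - m)\<^sup>2) \<partial>sample_law p \<gamma> \<theta>) = ennreal V" .
  have "has_bochner_integral (sample_law p \<gamma> \<theta>) (\<lambda>\<omega>. (mean_proj p \<omega> - m)\<^sup>2) V"
    using nn V by (intro has_bochner_integral_nn_integral) auto
  then have int: "integrable (sample_law p \<gamma> \<theta>) (\<lambda>\<omega>. (mean_proj p \<omega> - m)\<^sup>2)"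
    and val: "(\<integral>\<omega>. (mean_proj p \<omega> - m)\<^sup>2 \<partial>sample_law p \<gamma> \<theta>) = V"
    by (auto simp: has_bochner_integral_iff)
  have "?A = {\<omega> \<in> space (sample_law p \<gamma> \<theta>). a\<^sup>2 \<le> (mean_proj p \<omega> - m)\<^sup>2}"
    using a by (auto simp: abs_le_square_iff[symmetric])
  also have "measure (sample_law p \<gamma> \<theta>) \<dots> \<le> (\<integral>\<omega>. (mean_proj p \<omega> - m)\<^sup>2 \<partial>sample_law p \<gamma> \<theta>) / a\<^sup>2"
    using int a by (intro integral_Markov_inequality_measure[where A = "space (sample_law p \<gamma> \<theta>)"]) auto
  finally show "\<P>(\<omega> in sample_law p \<gamma> \<theta>. a \<le> \<bar>mean_proj p \<omega> - (\<Sum>i<p. \<theta> i) / sqrt (real p)\<bar>) \<le> (1 - \<gamma> + \<gamma> * real p) / a\<^sup>2"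
    unfolding val unfolding m_def V_def .
qed

section \<open>The statistic under the null hypothesis\<close>

text \<open>
  The statistic \<open>Y\<^sub>t\<close> as a function of the vector of transformed data.
\<close>

definition thr_sum :: "nat \<Rightarrow> real \<Rightarrow> (nat \<Rightarrow> real) \<Rightarrow> real" where
  "thr_sum p t x = (\<Sum>i<p. thr t (x i))"

lemma thr_sum_measurable [measurable]: "thr_sum p t \<in> borel_measurable (boreln p)"
  unfolding thr_sum_def by measurable

lemma
  shows integrable_thr_sum_square: "integrable (stdn p) (\<lambda>x. (thr_sum p t x)\<^sup>2)"
    and integral_thr_sum_square: "(\<integral>x. (thr_sum p t x)\<^sup>2 \<partial>stdn p) = real p * (\<integral>y. (thr t y)\<^sup>2 \<partial>std)"
proof -
  interpret N: finite_product_prob_space "\<lambda>_. std" "{..<p}" by (rule finite_product_prob_space_std)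
  note i = integrable_thr[of t 0, unfolded add_0_left] integrable_thr_square[of t 0, unfolded add_0_left]
  show "integrable (stdn p) (\<lambda>x. (thr_sum p t x)\<^sup>2)"
    unfolding thr_sum_def by (rule N.integrable_sum_square) (auto simp: i integral_thr)
  have "(\<integral>x. (thr_sum p t x)\<^sup>2 \<partial>stdn p) = (\<Sum>i<p. \<integral>y. (thr t y)\<^sup>2 \<partial>std)"
    unfolding thr_sum_def by (rule N.integral_sum_square) (auto simp: i integral_thr)
  then show "(\<integral>x. (thr_sum p t x)\<^sup>2 \<partial>stdn p) = real p * (\<integral>y. (thr t y)\<^sup>2 \<partial>std)" by simp
qed

lemma integrable_thr_sum_diff_square:
  "integrable (stdn p) (\<lambda>x. (thr_sum p t x - thr_sum p u x)\<^sup>2)"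
proof (rule Bochner_Integration.integrable_bound[of _ "\<lambda>x. 2 * (thr_sum p t x)\<^sup>2 + 2 * (thr_sum p u x)\<^sup>2"])
  have "(a - b)\<^sup>2 \<le> 2 * a\<^sup>2 + 2 * b\<^sup>2" for a b :: real
    using sum_squares_bound[of a "- b"] by (simp add: power2_diff)
  then show "AE x in stdn p. norm ((thr_sum p t x - thr_sum p u x)\<^sup>2) \<le> norm (2 * (thr_sum p t x)\<^sup>2 + 2 * (thr_sum p u x)\<^sup>2)"
    by auto
qed (auto simp: integrable_thr_sum_square)

text \<open>
  For \<open>t\<^sub>0, u \<le> t\<close> the difference of the statistics at levels \<open>t\<^sub>0\<close> and \<open>u\<close> depends on the data only through
  \<open>min \<bar>x\<^sub>i\<bar> t\<close>: a coordinate with \<open>\<bar>x\<^sub>i\<bar> \<ge> t\<close> contributes the constant \<open>\<alpha>\<^sub>u - \<alpha>\<^sub>t\<^sub>0\<close>.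
\<close>

lemma thr_sum_diff_update:
  assumes "i < p" "u \<le> t" "t\<^sub>0 \<le> t" "t \<le> \<bar>y\<bar>" "t \<le> \<bar>z\<bar>"
  shows "thr_sum p t\<^sub>0 (x(i := y)) - thr_sum p u (x(i := y)) = thr_sum p t\<^sub>0 (x(i := z)) - thr_sum p u (x(i := z))"
  unfolding thr_sum_def sum_subtractf[symmetric]
  using assms by (intro sum.cong) (auto simp: thr_def indicator_def)

text \<open>
  The martingale property. The last hypothesis expresses that \<open>H\<close> is a function of the truncated
  coordinates \<open>min \<bar>x\<^sub>i\<bar> t\<close>.
\<close>

lemma thr_sum_orthogonal:
  assumes int: "integrable (stdn p) (\<lambda>x. (H x)\<^sup>2)" and [measurable]: "H \<in> borel_measurable (boreln p)"
    and t: "0 \<le> t"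
    and H: "\<And>x i y z. i < p \<Longrightarrow> t \<le> \<bar>y\<bar> \<Longrightarrow> t \<le> \<bar>z\<bar> \<Longrightarrow> H (x(i := y)) = H (x(i := z))"
  shows "integrable (stdn p) (\<lambda>x. thr_sum p t x * H x)" and "(\<integral>x. thr_sum p t x * H x \<partial>stdn p) = 0"
proof -
  interpret N: finite_product_prob_space "\<lambda>_. std" "{..<p}" by (rule finite_product_prob_space_std)
  have int1: "integrable (stdn p) (\<lambda>x. thr t (x i) * H x)" if i: "i < p" for i
  proof (rule Bochner_Integration.integrable_bound[of _ "\<lambda>x. (thr t (x i))\<^sup>2 + (H x)\<^sup>2"])
    have "integrable (stdn p) (\<lambda>x. (thr t (x i))\<^sup>2)"
      using N.integrable_component_iff[of i "\<lambda>y. (thr t y)\<^sup>2"] integrable_thr_square[of t 0] i by simp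
    then show "integrable (stdn p) (\<lambda>x. (thr t (x i))\<^sup>2 + (H x)\<^sup>2)" using int by simp
    have [measurable]: "(\<lambda>x. x i) \<in> borel_measurable (boreln p)"
      using i by (intro measurable_component_singleton) simp
    show "(\<lambda>x. thr t (x i) * H x) \<in> borel_measurable (stdn p)" by measurable
    show "AE x in stdn p. norm (thr t (x i) * H x) \<le> norm ((thr t (x i))\<^sup>2 + (H x)\<^sup>2)"
      by (simp add: abs_mult_le_sum_squares)
  qed
  have zero: "(\<integral>x. thr t (x i) * H x \<partial>stdn p) = 0" if i: "i < p" for i
  proof (rule N.integral_component_mult_eq_0[where K = "\<lambda>x. H (x(i := t))"])
    show "thr t y * H (x(i := y)) = thr t y * H (x(i := t))" for x y
      using H[OF i, of y t x] t by (cases "t \<le> \<bar>y\<bar>") (auto simp: thr_def)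
  qed (use i int1 integral_thr in auto)
  have eq: "thr_sum p t x * H x = (\<Sum>i<p. thr t (x i) * H x)" for x
    by (simp add: thr_sum_def sum_distrib_right)
  show "integrable (stdn p) (\<lambda>x. thr_sum p t x * H x)"
    unfolding eq using int1 by (intro Bochner_Integration.integrable_sum) auto
  show "(\<integral>x. thr_sum p t x * H x \<partial>stdn p) = 0"
    unfolding eq using int1 zero by (subst Bochner_Integration.integral_sum) auto
qed

text \<open>
  Kolmogorov's maximal inequality for the martingale whose value at \<open>t\<close> is \<open>Y\<^sub>t\<^sub>0 - Y\<^sub>t\<close>, with terminal
  value \<open>Y\<^sub>t\<^sub>0\<close>.
\<close>

lemma thr_sum_maximal_inequality:
  assumes D: "finite D" "\<And>t. t \<in> D \<Longrightarrow> t\<^sub>0 \<le> t" and t0: "0 \<le> t\<^sub>0" and l: "0 < l"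
  shows "\<P>(x in stdn p. \<exists>t\<in>D. l < \<bar>thr_sum p t\<^sub>0 x - thr_sum p t x\<bar>)
    \<le> real p * (\<integral>y. (thr t\<^sub>0 y)\<^sup>2 \<partial>std) / l\<^sup>2"
proof -
  interpret N: prob_space "stdn p" by (rule prob_space_stdn)
  define S where "S t x = thr_sum p t\<^sub>0 x - thr_sum p t x" for t x
  have [measurable]: "S t \<in> borel_measurable (boreln p)" for t unfolding S_def by measurable
  \<comment> \<open>The level \<open>t\<close> is the first one at which the martingale exceeds \<open>l\<close>.\<close>
  define P where "P t x \<longleftrightarrow> l < \<bar>S t x\<bar> \<and> (\<forall>u\<in>D. u < t \<longrightarrow> \<bar>S u x\<bar> \<le> l)" for t x
  have [measurable]: "Measurable.pred (boreln p) (P t)" for t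
    unfolding P_def using D(1) by measurable
  define A where "A t = {x \<in> space (stdn p). P t x}" for t
  have A[measurable]: "A t \<in> sets (stdn p)" for t unfolding A_def by measurable
  have cover: "{x \<in> space (stdn p). \<exists>t\<in>D. l < \<bar>S t x\<bar>} \<subseteq> (\<Union>t\<in>D. A t)"
  proof safe
    fix x t assume x: "x \<in> space (stdn p)" and t: "t \<in> D" "l < \<bar>S t x\<bar>"
    let ?E = "{t \<in> D. l < \<bar>S t x\<bar>}"
    have E: "finite ?E" "?E \<noteq> {}" using D t by auto
    then have "Min ?E \<in> ?E" by (rule Min_in)
    moreover have "\<bar>S u x\<bar> \<le> l" if "u \<in> D" "u < Min ?E" for u
      using that E Min_le[of ?E u] by force
    ultimately show "x \<in> (\<Union>t\<in>D. A t)" using x by (auto simp: A_def P_def)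
  qed
  let ?Y = "\<lambda>x. (thr_sum p t\<^sub>0 x)\<^sup>2"
  have part: "l\<^sup>2 * measure (stdn p) (A t) \<le> (\<integral>x. ?Y x * of_bool (P t x) \<partial>stdn p)"
    and int_part: "integrable (stdn p) (\<lambda>x. ?Y x * of_bool (P t x))" if t: "t \<in> D" for t
  proof -
    have tt: "t\<^sub>0 \<le> t" "0 \<le> t" using D(2)[OF t] t0 by auto
    define H where "H x = S t x * of_bool (P t x)" for x
    have [measurable]: "H \<in> borel_measurable (boreln p)" unfolding H_def by measurable
    have intH: "integrable (stdn p) (\<lambda>x. (H x)\<^sup>2)"
      by (rule Bochner_Integration.integrable_bound[OF integrable_thr_sum_diff_square[of p t\<^sub>0 t]])
        (auto simp: H_def S_def)
    have Supd: "S u (x(i := y)) = S u (x(i := z))" if "i < p" "t \<le> \<bar>y\<bar>" "t \<le> \<bar>z\<bar>" "u \<le> t" for u x i y z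
      unfolding S_def using that tt by (intro thr_sum_diff_update[where t = t]) auto
    have Hupd: "H (x(i := y)) = H (x(i := z))" if "i < p" "t \<le> \<bar>y\<bar>" "t \<le> \<bar>z\<bar>" for x i y z
    proof -
      have "P t (x(i := y)) = P t (x(i := z))"
        unfolding P_def using Supd[OF that] by (auto simp: less_imp_le)
      then show ?thesis unfolding H_def using Supd[OF that, of t] by simp
    qed
    note orth = thr_sum_orthogonal[OF intH _ tt(2) Hupd]
    have int: "integrable (stdn p) (\<lambda>x. of_bool (P t x) :: real)"
      by (rule N.integrable_const_bound[where B = 1]) auto
    show intY: "integrable (stdn p) (\<lambda>x. ?Y x * of_bool (P t x))"
      by (rule Bochner_Integration.integrable_bound[OF integrable_thr_sum_square[of p t\<^sub>0]]) auto
    have "measure (stdn p) (A t) = (\<integral>x. of_bool (P t x) \<partial>stdn p)"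
    proof -
      have "(\<integral>x. of_bool (P t x) \<partial>stdn p) = (\<integral>x. indicat_real (A t) x \<partial>stdn p)"
        by (intro Bochner_Integration.integral_cong) (auto simp: A_def indicator_def)
      also have "\<dots> = measure (stdn p) (A t)" using A by simp
      finally show ?thesis by simp
    qed
    then have "l\<^sup>2 * measure (stdn p) (A t) = (\<integral>x. l\<^sup>2 * of_bool (P t x) + 2 * (thr_sum p t x * H x) \<partial>stdn p)"
      using orth int by simp
    also have "\<dots> \<le> (\<integral>x. ?Y x * of_bool (P t x) \<partial>stdn p)"
    proof (rule integral_mono)
      show "integrable (stdn p) (\<lambda>x. l\<^sup>2 * of_bool (P t x) + 2 * (thr_sum p t x * H x))"
        using orth(1) int by simp
      show "l\<^sup>2 * of_bool (P t x) + 2 * (thr_sum p t x * H x) \<le> ?Y x * of_bool (P t x)" for x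
      proof (cases "P t x")
        case True
        then have "l\<^sup>2 \<le> \<bar>S t x\<bar>\<^sup>2" using l by (intro power_mono) (auto simp: P_def)
        then have "l\<^sup>2 + 2 * (thr_sum p t x * S t x) \<le> (S t x)\<^sup>2 + 2 * (thr_sum p t x * S t x) + (thr_sum p t x)\<^sup>2"
          using zero_le_power2[of "thr_sum p t x"] unfolding power2_abs by linarith
        \<comment> \<open>The terminal value is \<open>Y\<^sub>t\<^sub>0 = S t + Y\<^sub>t\<close>, and the mixed term has mean \<open>0\<close> on the event.\<close>
        also have "\<dots> = (S t x + thr_sum p t x)\<^sup>2" by (simp add: power2_sum)
        finally show ?thesis using True by (simp add: H_def S_def)
      qed (simp add: H_def)
    qed (rule intY)
    finally show "l\<^sup>2 * measure (stdn p) (A t) \<le> (\<integral>x. ?Y x * of_bool (P t x) \<partial>stdn p)" .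
  qed
  have once: "(\<Sum>t\<in>D. of_bool (P t x)) \<le> (1 :: real)" for x
  proof -
    have "t = u" if "t \<in> D" "u \<in> D" "P t x" "P u x" for t u
    proof (cases t u rule: linorder_cases)
      case less
      then have "\<bar>S t x\<bar> \<le> l" "l < \<bar>S t x\<bar>" using that by (auto simp: P_def)
      then show ?thesis by linarith
    next
      case greater
      then have "\<bar>S u x\<bar> \<le> l" "l < \<bar>S u x\<bar>" using that by (auto simp: P_def)
      then show ?thesis by linarith
    qed
    then have "card {t \<in> D. P t x} \<le> 1"
      using D(1) by (subst card_le_Suc0_iff_eq[simplified One_nat_def[symmetric]]) auto
    moreover have "(\<Sum>t\<in>D. of_bool (P t x)) = real (card {t \<in> D. P t x})"
      using D(1) by (simp add: sum.If_cases of_bool_def Int_def)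
    ultimately show ?thesis by simp
  qed
  have "l\<^sup>2 * \<P>(x in stdn p. \<exists>t\<in>D. l < \<bar>S t x\<bar>) \<le> l\<^sup>2 * (\<Sum>t\<in>D. measure (stdn p) (A t))"
    using D(1) by (intro mult_left_mono order_trans[OF N.finite_measure_mono[OF cover]] N.finite_measure_subadditive_finite) auto
  also have "\<dots> \<le> (\<Sum>t\<in>D. \<integral>x. ?Y x * of_bool (P t x) \<partial>stdn p)"
    unfolding sum_distrib_left by (intro sum_mono part)
  also have "\<dots> = (\<integral>x. (\<Sum>t\<in>D. ?Y x * of_bool (P t x)) \<partial>stdn p)"
    by (intro Bochner_Integration.integral_sum[symmetric] int_part)
  also have "\<dots> \<le> (\<integral>x. ?Y x \<partial>stdn p)"
  proof (rule integral_mono)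
    show "integrable (stdn p) (\<lambda>x. \<Sum>t\<in>D. ?Y x * of_bool (P t x))"
      by (intro Bochner_Integration.integrable_sum int_part)
    show "(\<Sum>t\<in>D. ?Y x * of_bool (P t x)) \<le> ?Y x" for x
      unfolding sum_distrib_left[symmetric] using once[of x] by (intro mult_left_le) auto
  qed (rule integrable_thr_sum_square)
  also have "\<dots> = real p * (\<integral>y. (thr t\<^sub>0 y)\<^sup>2 \<partial>std)" by (rule integral_thr_sum_square)
  finally show ?thesis using l unfolding S_def by (simp add: field_simps)
qed

lemma thr_sum_sup_tail:
  assumes D: "finite D" "\<And>t. t \<in> D \<Longrightarrow> t\<^sub>0 \<le> t" and t0: "0 \<le> t\<^sub>0" and r: "0 < r"
  shows "\<P>(x in stdn p. \<exists>t\<in>D. r < thr_sum p t x)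
    \<le> 352 * (real p * exp (- t\<^sub>0\<^sup>2 / 2)) / r\<^sup>2"
proof -
  interpret N: prob_space "stdn p" by (rule prob_space_stdn)
  interpret F: finite_product_prob_space "\<lambda>_. std" "{..<p}" by (rule finite_product_prob_space_std)
  define v where "v = real p * (\<integral>y. (thr t\<^sub>0 y)\<^sup>2 \<partial>std)"
  let ?B = "{x \<in> space (stdn p). r / 2 \<le> \<bar>thr_sum p t\<^sub>0 x\<bar>}"
  let ?C = "{x \<in> space (stdn p). \<exists>t\<in>D. r / 2 < \<bar>thr_sum p t\<^sub>0 x - thr_sum p t x\<bar>}"
  have [measurable]: "?C \<in> sets (stdn p)" "?B \<in> sets (stdn p)" using D(1) by measurable
  have B: "measure (stdn p) ?B \<le> v / (r / 2)\<^sup>2"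
  proof -
    have "\<P>(x in stdn p. r / 2 \<le> \<bar>(\<Sum>i<p. thr t\<^sub>0 (x i)) - (\<Sum>i<p. 0)\<bar>)
      \<le> (\<Sum>i<p. \<integral>y. (thr t\<^sub>0 y - 0)\<^sup>2 \<partial>std) / (r / 2)\<^sup>2"
      using r integrable_thr[of t\<^sub>0 0] integrable_thr_square[of t\<^sub>0 0] integral_thr[of t\<^sub>0]
      by (intro F.Chebyshev_sum(1)) auto
    then show ?thesis by (simp add: thr_sum_def v_def)
  qed
  have C: "measure (stdn p) ?C \<le> v / (r / 2)\<^sup>2"
    unfolding v_def using r by (intro thr_sum_maximal_inequality D t0) auto
  have "\<P>(x in stdn p. \<exists>t\<in>D. r < thr_sum p t x) \<le> measure (stdn p) (?B \<union> ?C)"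
  proof (rule N.finite_measure_mono)
    show "{x \<in> space (stdn p). \<exists>t\<in>D. r < thr_sum p t x} \<subseteq> ?B \<union> ?C"
    proof (rule subsetI)
      fix x assume "x \<in> {x \<in> space (stdn p). \<exists>t\<in>D. r < thr_sum p t x}"
      then obtain t where x: "x \<in> space (stdn p)" "t \<in> D" "r < thr_sum p t x" by auto
      then have "r / 2 \<le> \<bar>thr_sum p t\<^sub>0 x\<bar> \<or> r / 2 < \<bar>thr_sum p t\<^sub>0 x - thr_sum p t x\<bar>" by linarith
      then show "x \<in> ?B \<union> ?C" using x by auto
    qed
  qed measurable
  also have "\<dots> \<le> measure (stdn p) ?B + measure (stdn p) ?C" by (intro measure_Un_le) measurable
  also have "\<dots> \<le> 8 * v / r\<^sup>2" using B C by (simp add: power_divide)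
  also have "\<dots> \<le> 8 * (real p * (44 * exp (- t\<^sub>0\<^sup>2 / 2))) / r\<^sup>2"
    unfolding v_def by (intro divide_right_mono mult_left_mono thr_second_moment_le t0) auto
  finally show ?thesis by simp
qed

lemma sum_inverse_squares_le: "(\<Sum>i<n. 1 / (real i + 1)\<^sup>2) \<le> 2"
proof -
  have "(\<Sum>i<Suc n. 1 / (real i + 1)\<^sup>2) \<le> 2 - 1 / (real n + 1)" for n
  proof (induction n)
    case (Suc n)
    define a where "a = real n + 1"
    have a: "0 < a" by (simp add: a_def)
    have "1 / (a + 1)\<^sup>2 \<le> 1 / (a * (a + 1))"
      using a by (intro divide_left_mono) (auto simp: power2_eq_square)
    also have "\<dots> = 1 / a - 1 / (a + 1)" using a by (simp add: field_simps)
    finally have "1 / (real (Suc n) + 1)\<^sup>2 \<le> 1 / (real n + 1) - 1 / (real (Suc n) + 1)"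
      by (simp add: a_def add.commute)
    then show ?case using Suc unfolding sum.lessThan_Suc[of _ "Suc n"] by linarith
  qed simp
  moreover have "(\<Sum>i<n. 1 / (real i + 1)\<^sup>2) \<le> (\<Sum>i<Suc n. 1 / (real i + 1)\<^sup>2)"
    by simp
  moreover have "2 - 1 / (real n + 1) \<le> 2" by simp
  ultimately show ?thesis by (meson order_trans)
qed

lemma ln_one_plus_four_power_ge: "(real i + 1) / 2 \<le> ln (1 + 4 ^ i)"
proof -
  have e: "exp (1 / 2) \<le> (2 :: real)"
  proof -
    have "(exp (1 / 2))\<^sup>2 = exp (1 :: real)" by (simp flip: exp_of_nat_mult)
    also have "\<dots> \<le> 2\<^sup>2" using exp_le by simp
    finally show ?thesis by (rule power2_le_imp_le) simp
  qed
  have "exp ((real i + 1) / 2) \<le> 1 + 4 ^ i"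
  proof (induction i)
    case (Suc i)
    have "(real (Suc i) + 1) / 2 = (real i + 1) / 2 + 1 / 2" by simp
    then have "exp ((real (Suc i) + 1) / 2) = exp ((real i + 1) / 2) * exp (1 / 2)" by (simp only: exp_add)
    also have "\<dots> \<le> (1 + 4 ^ i) * 2" by (intro mult_mono Suc e) auto
    also have "\<dots> \<le> 1 + 4 ^ Suc i"
    proof -
      have "(1 :: real) \<le> 4 ^ i" by simp
      then have "1 \<le> 2 * (4 :: real) ^ i" by (rule order_trans) simp
      then show ?thesis by simp
    qed
    finally show ?case .
  qed (use e in simp)
  then show ?thesis by (subst ln_ge_iff) (auto intro: add_pos_pos)
qed

text \<open>
  Up to an error probability of order \<open>1 / C^4\<close>, uniformly in \<open>p\<close>, none of the statistics with
  \<open>s < sqrt p\<close> exceeds its critical value. The block \<open>Bl i\<close> consists of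
  the \<open>s\<close> with \<open>sqrt p / 2^(i+1) \<le> s < sqrt p / 2^i\<close>; all its levels lie above \<open>t\<^sub>0 i\<close>, where the second
  moment is of order \<open>p / 4^i\<close>, and all its critical values above \<open>r i\<close>, whose square is of order
  \<open>C^4 (i + 1)\<^sup>2 p / 4^i\<close>.
\<close>

lemma thr_sum_null_tail:
  assumes C: "0 < C"
  shows "\<P>(x in stdn p. \<exists>s. 1 \<le> s \<and> real s < sqrt (real p) \<and>
      r_sparse C p s < thr_sum p (t_sparse p s) x) \<le> 11534336 / C ^ 4"
proof -
  interpret N: prob_space "stdn p" by (rule prob_space_stdn)
  define Bl where "Bl i = {s::nat. 1 \<le> s \<and> sqrt (real p) / 2 ^ Suc i \<le> real s \<and> real s < sqrt (real p) / 2 ^ i}" for i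
  define r where "r i = C\<^sup>2 / 128 * (sqrt (real p) / 2 ^ i * (real i + 1))" for i :: nat
  define t\<^sub>0 where "t\<^sub>0 i = sqrt (2 * ln (1 + 4 ^ i))" for i :: nat
  let ?E = "\<lambda>i. {x \<in> space (stdn p). \<exists>t\<in>t_sparse p ` Bl i. r i < thr_sum p t x}"
  have fin: "finite (Bl i)" for i
  proof (rule finite_subset)
    show "Bl i \<subseteq> {..nat \<lceil>sqrt (real p)\<rceil>}"
    proof
      fix s assume "s \<in> Bl i"
      then have "real s < sqrt (real p) / 2 ^ i" by (simp add: Bl_def)
      also have "\<dots> \<le> sqrt (real p)" by (simp add: divide_le_eq mult_le_cancel_left1)
      finally show "s \<in> {..nat \<lceil>sqrt (real p)\<rceil>}" by simp linarith
    qed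
  qed simp
  have [measurable]: "?E i \<in> sets (stdn p)" for i using fin by measurable
  have Ldom: "4 ^ i < real p / (real s)\<^sup>2" if "s \<in> Bl i" for s i
  proof -
    have s: "1 \<le> real s" "real s * 2 ^ i < sqrt (real p)" using that by (auto simp: Bl_def field_simps)
    then have "(real s * 2 ^ i)\<^sup>2 < (sqrt (real p))\<^sup>2" by (intro power_strict_mono) auto
    then show ?thesis using s
      by (simp add: power_mult_distrib field_simps flip: power_mult)
        (simp add: mult.commute[of i 2] power_mult)
  qed
  have cover: "{x \<in> space (stdn p). \<exists>s. 1 \<le> s \<and> real s < sqrt (real p) \<and> r_sparse C p s < thr_sum p (t_sparse p s) x}
      \<subseteq> (\<Union>i<Suc p. ?E i)"
  proof safe
    fix x s assume x: "x \<in> space (stdn p)" and s: "1 \<le> s" "real s < sqrt (real p)"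
      and rs: "r_sparse C p s < thr_sum p (t_sparse p s) x"
    let ?Q = "\<lambda>i. sqrt (real p) / 2 ^ Suc i \<le> real s"
    have Qp: "?Q p"
    proof -
      have p1: "1 \<le> real p" using s by (cases p) auto
      then have "sqrt (real p) \<le> real p" using real_le_lsqrt[of "real p" "real p"] by (simp add: power2_eq_square)
      also have "\<dots> \<le> 2 ^ Suc p" using of_nat_less_two_power[of "Suc p", where 'a = real] by simp
      finally have "sqrt (real p) / 2 ^ Suc p \<le> 1" by (simp add: divide_le_eq del: power_Suc)
      then show ?thesis using s by linarith
    qed
    define i where "i = (LEAST i. ?Q i)"
    have Qi: "?Q i" unfolding i_def by (rule LeastI[of ?Q, OF Qp])
    have ip: "i \<le> p" unfolding i_def by (rule Least_le[of ?Q, OF Qp])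
    have "real s < sqrt (real p) / 2 ^ i"
    proof (cases i)
      case (Suc j)
      then have "\<not> ?Q j" using not_less_Least[of j ?Q] by (simp add: i_def)
      then show ?thesis using Suc by simp
    qed (use s in simp)
    then have sB: "s \<in> Bl i" using s Qi by (simp add: Bl_def)
    have "(real i + 1) / 2 \<le> ln (1 + 4 ^ i)" by (rule ln_one_plus_four_power_ge)
    also have "\<dots> \<le> ln (1 + real p / (real s)\<^sup>2)" using Ldom[OF sB] by (intro ln_mono) (auto intro: add_pos_pos)
    finally have L: "(real i + 1) / 2 \<le> ln (1 + real p / (real s)\<^sup>2)" .
    have "r i = C\<^sup>2 / 32 * (sqrt (real p) / 2 ^ Suc i * ((real i + 1) / 2))" by (simp add: r_def)
    also have "\<dots> \<le> C\<^sup>2 / 32 * (real s * ln (1 + real p / (real s)\<^sup>2))"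
      using Qi L by (intro mult_left_mono mult_mono) auto
    also have "\<dots> = r_sparse C p s" by (simp add: r_sparse_def)
    finally have "r i < thr_sum p (t_sparse p s) x" using rs by simp
    then have "x \<in> ?E i" using x sB by blast
    then show "x \<in> (\<Union>i<Suc p. ?E i)" using ip by (intro UN_I[of i]) auto
  qed
  have block: "measure (stdn p) (?E i) \<le> 5767168 / C ^ 4 * (1 / (real i + 1)\<^sup>2)" for i
  proof (cases "p = 0")
    case True
    then have "Bl i = {}" by (auto simp: Bl_def)
    then have "?E i = {}" by blast
    then have "measure (stdn p) (?E i) = 0" by (simp only: measure_empty)
    also have "0 \<le> 5767168 / C ^ 4 * (1 / (real i + 1)\<^sup>2)" using C by simp
    finally show ?thesis .
  next
    case False
    then have p: "0 < sqrt (real p)" by simp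
    have r0: "0 < r i" unfolding r_def using p C by (intro mult_pos_pos divide_pos_pos) auto
    have t0: "0 \<le> t\<^sub>0 i" by (simp add: t\<^sub>0_def)
    have le: "t\<^sub>0 i \<le> t" if t: "t \<in> t_sparse p ` Bl i" for t
    proof -
      obtain s where s: "s \<in> Bl i" "t = t_sparse p s" using t by auto
      have "ln (1 + 4 ^ i) \<le> ln (1 + real p / (real s)\<^sup>2)" using Ldom[OF s(1)] by (intro ln_mono) (auto intro: add_pos_pos)
      then show ?thesis using s by (simp add: t\<^sub>0_def t_sparse_def)
    qed
    have ex: "exp (- (t\<^sub>0 i)\<^sup>2 / 2) \<le> 1 / 4 ^ i"
    proof -
      have "0 \<le> ln (1 + 4 ^ i :: real)" by simp
      then have "exp (- (t\<^sub>0 i)\<^sup>2 / 2) = inverse (1 + 4 ^ i)"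
        by (simp add: t\<^sub>0_def exp_minus add_pos_pos)
      also have "\<dots> \<le> 1 / 4 ^ i" unfolding inverse_eq_divide by (rule frac_le) auto
      finally show ?thesis .
    qed
    have "measure (stdn p) (?E i) \<le> 352 * (real p * exp (- (t\<^sub>0 i)\<^sup>2 / 2)) / (r i)\<^sup>2"
      by (rule thr_sum_sup_tail) (use fin le t0 r0 in auto)
    also have "\<dots> \<le> 352 * (real p * (1 / 4 ^ i)) / (r i)\<^sup>2"
      using ex by (intro divide_right_mono mult_left_mono) auto
    also have "(r i)\<^sup>2 = C ^ 4 / 16384 * (real p / 4 ^ i) * (real i + 1)\<^sup>2"
    proof -
      have "(C\<^sup>2)\<^sup>2 = C ^ 4" "(2 ^ i)\<^sup>2 = (4 ^ i :: real)"
        by (simp_all flip: power_mult) (simp add: mult.commute[of i 2] power_mult)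
      then show ?thesis by (simp add: r_def power_mult_distrib power_divide)
    qed
    also have "352 * (real p * (1 / 4 ^ i)) / (C ^ 4 / 16384 * (real p / 4 ^ i) * (real i + 1)\<^sup>2)
        = 5767168 / C ^ 4 * (1 / (real i + 1)\<^sup>2)"
      using False C by (simp add: field_simps)
    finally show ?thesis .
  qed
  have "\<P>(x in stdn p. \<exists>s. 1 \<le> s \<and> real s < sqrt (real p) \<and>
      r_sparse C p s < thr_sum p (t_sparse p s) x) \<le> measure (stdn p) (\<Union>i<Suc p. ?E i)"
    by (intro N.finite_measure_mono cover) measurable
  also have "\<dots> \<le> (\<Sum>i<Suc p. measure (stdn p) (?E i))"
    by (intro N.finite_measure_subadditive_finite) auto
  also have "\<dots> \<le> (\<Sum>i<Suc p. 5767168 / C ^ 4 * (1 / (real i + 1)\<^sup>2))" by (intro sum_mono block)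
  also have "\<dots> \<le> 5767168 / C ^ 4 * 2"
    unfolding sum_distrib_left[symmetric] using C by (intro mult_left_mono sum_inverse_squares_le) auto
  finally show ?thesis by simp
qed

section \<open>Error bounds under a mean shift\<close>

lemma ln2_ge_half: "1 / 2 \<le> ln (2 :: real)"
  using ln2_ge_two_thirds by simp

text \<open>
  Signal of size \<open>B k L\<close> on at most \<open>k\<close> coordinates is detected at level \<open>sqrt (2 L)\<close>, whatever the other
  coordinates of \<open>\<mu>\<close> are. The mean is at least \<open>(B - 4) k L\<close> because the coordinates outside \<open>T\<close> contribute
  non-negatively, and the variance is at most \<open>108 L\<close> times the mean plus a multiple of \<open>k\<^sup>2\<close>.
\<close>

lemma thr_sum_power:
  assumes k: "1 \<le> k" "real k < sqrt (real p)" and T: "T \<subseteq> {..<p}" "card T \<le> k"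
  defines "L \<equiv> ln (1 + real p / (real k)\<^sup>2)"
  assumes B: "16 \<le> B" and signal: "B * real k * L \<le> (\<Sum>i\<in>T. (\<mu> i)\<^sup>2)"
  shows "\<P>(x in stdn p. thr_sum p (sqrt (2 * L)) (\<lambda>i. \<mu> i + x i) \<le> B / 8 * real k * L)
    \<le> 100000 / B"
proof -
  interpret N: finite_product_prob_space "\<lambda>_. std" "{..<p}" by (rule finite_product_prob_space_std)
  define t where "t = sqrt (2 * L)"
  have "(real k)\<^sup>2 < (sqrt (real p))\<^sup>2" using k by (intro power_strict_mono) auto
  then have kp: "(real k)\<^sup>2 < real p" by simp
  then have "1 \<le> real p / (real k)\<^sup>2" using k by simp
  then have "ln 2 \<le> L" unfolding L_def by (intro ln_mono) auto
  then have L: "1 / 2 \<le> L" using ln2_ge_half by linarith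
  have t2: "t\<^sup>2 = 2 * L" using L by (simp add: t_def)
  then have "1\<^sup>2 \<le> t\<^sup>2" using L by simp
  then have t1: "1 \<le> t" by (rule power2_le_imp_le) (use L in \<open>simp add: t_def\<close>)
  then have t0: "0 \<le> t" by simp
  have k0: "0 < real k" using k by simp
  have ex: "real p * exp (- t\<^sup>2 / 2) \<le> (real k)\<^sup>2"
  proof -
    have pos: "0 < 1 + real p / (real k)\<^sup>2" by (intro add_pos_nonneg) auto
    have "0 < real p / (real k)\<^sup>2" using kp k0 by (intro divide_pos_pos) (auto intro: le_less_trans)
    moreover have "exp (- t\<^sup>2 / 2) = inverse (1 + real p / (real k)\<^sup>2)"
      using pos unfolding t2 by (simp add: exp_minus L_def)
    ultimately have "exp (- t\<^sup>2 / 2) \<le> inverse (real p / (real k)\<^sup>2)"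
      by (simp only:) (rule le_imp_inverse_le, auto)
    then have "real p * exp (- t\<^sup>2 / 2) \<le> real p * inverse (real p / (real k)\<^sup>2)"
      by (rule mult_left_mono) simp
    also have "\<dots> \<le> (real k)\<^sup>2" by simp
    finally show ?thesis .
  qed
  define e where "e m = (\<integral>y. thr t (m + y) \<partial>std)" for m
  define E where "E = (\<Sum>i<p. e (\<mu> i))"
  have e0: "0 \<le> e m" for m unfolding e_def by (rule integral_thr_nonneg[OF t0])
  have e1: "m\<^sup>2 - 4 * L \<le> e m" for m
    using integral_thr_ge[OF t0, of m] alpha_le[OF t1] L t2 unfolding e_def by linarith
  have "B * real k * L - real k * (4 * L) \<le> (\<Sum>i\<in>T. (\<mu> i)\<^sup>2) - (\<Sum>i\<in>T. 4 * L)"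
    using T L signal by (intro diff_mono) (auto intro: mult_right_mono)
  also have "\<dots> = (\<Sum>i\<in>T. (\<mu> i)\<^sup>2 - 4 * L)" by (simp add: sum_subtractf)
  also have "\<dots> \<le> (\<Sum>i\<in>T. e (\<mu> i))" by (intro sum_mono e1)
  also have "\<dots> \<le> E" unfolding E_def using T by (intro sum_mono2) (auto simp: e0)
  finally have E: "(B - 4) * (real k * L) \<le> E" by (simp add: algebra_simps)
  have kL: "1 / 2 \<le> real k * L" using mult_mono[of 1 "real k" "1/2" L] k L by simp
  have "3 / 4 * B * (real k * L) \<le> (B - 4) * (real k * L)" using B kL by (intro mult_right_mono) auto
  with E have E1: "3 / 4 * B * (real k * L) \<le> E" by linarith
  have BkL: "0 < B * (real k * L)" using B k0 L by (intro mult_pos_pos) auto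
  then have Epos: "0 < E" using E1 by linarith
  let ?A = "{x \<in> space (stdn p). E / 2 \<le> \<bar>(\<Sum>i<p. thr t (\<mu> i + x i)) - (\<Sum>i<p. e (\<mu> i))\<bar>}"
  have int: "integrable std (\<lambda>y. (thr t (m + y) - e m)\<^sup>2)" for m
    by (rule std_centred_square[OF integrable_thr integrable_thr_square])
  have cheb: "measure (stdn p) ?A \<le> (\<Sum>i<p. \<integral>y. (thr t (\<mu> i + y) - e (\<mu> i))\<^sup>2 \<partial>std) / (E / 2)\<^sup>2"
      and A: "?A \<in> sets (stdn p)"
    using N.Chebyshev_sum[of "\<lambda>i y. thr t (\<mu> i + y)" "\<lambda>i. e (\<mu> i)" "E / 2"] Epos
    by (auto simp: integrable_thr e_def[symmetric] int)
  have var: "(\<Sum>i<p. \<integral>y. (thr t (\<mu> i + y) - e (\<mu> i))\<^sup>2 \<partial>std) \<le> 108 * L * E + 3116 * (real k)\<^sup>2"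
  proof -
    have "(\<Sum>i<p. \<integral>y. (thr t (\<mu> i + y) - e (\<mu> i))\<^sup>2 \<partial>std) \<le> (\<Sum>i<p. 54 * t\<^sup>2 * e (\<mu> i) + 3116 * exp (- t\<^sup>2 / 2))"
      unfolding e_def by (intro sum_mono thr_variance_le t1)
    also have "\<dots> = 54 * t\<^sup>2 * E + 3116 * (real p * exp (- t\<^sup>2 / 2))"
      by (simp add: sum.distrib sum_distrib_left E_def)
    also have "\<dots> \<le> 108 * L * E + 3116 * (real k)\<^sup>2" using ex by (simp add: t2)
    finally show ?thesis .
  qed
  have "\<P>(x in stdn p. thr_sum p t (\<lambda>i. \<mu> i + x i) \<le> B / 8 * real k * L) \<le> measure (stdn p) ?A"
  proof (rule N.finite_measure_mono[OF _ A])
    show "{x \<in> space (stdn p). thr_sum p t (\<lambda>i. \<mu> i + x i) \<le> B / 8 * real k * L} \<subseteq> ?A"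
    proof (rule subsetI)
      fix x assume "x \<in> {x \<in> space (stdn p). thr_sum p t (\<lambda>i. \<mu> i + x i) \<le> B / 8 * real k * L}"
      then have x: "x \<in> space (stdn p)" "(\<Sum>i<p. thr t (\<mu> i + x i)) \<le> 1 / 8 * (B * (real k * L))"
        by (auto simp: thr_sum_def)
      have "3 / 4 * (B * (real k * L)) \<le> E" using E1 by (simp only: mult.assoc)
      then have "1 / 8 * (B * (real k * L)) \<le> E / 2" using BkL by linarith
      then have "E / 2 \<le> \<bar>(\<Sum>i<p. thr t (\<mu> i + x i)) - E\<bar>" using x(2) by linarith
      then show "x \<in> ?A" using x(1) unfolding E_def[symmetric] by simp
    qed
  qed
  also have "\<dots> \<le> (108 * L * E + 3116 * (real k)\<^sup>2) / (E / 2)\<^sup>2"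
    by (rule order_trans[OF cheb]) (intro divide_right_mono var, simp)
  also have "\<dots> = 432 * (L / E) + 12464 * (real k / E)\<^sup>2"
    using Epos by (simp add: field_simps power2_eq_square)
  also have "\<dots> \<le> 432 * (4 / 3 / B) + 12464 * (8 / 3 / B)\<^sup>2"
  proof (intro add_mono mult_left_mono power_mono)
    have "L \<le> real k * L" using k L by simp
    then have "3 / 4 * B * L \<le> E" using E1 B by (intro order_trans[OF mult_left_mono E1]) auto
    then show "L / E \<le> 4 / 3 / B" using Epos B by (simp add: field_simps)
    have "real k * (1 / 2) \<le> real k * L" using L by (intro mult_left_mono) auto
    then have "3 / 4 * B * (real k * (1 / 2)) \<le> E" using B by (intro order_trans[OF mult_left_mono E1]) auto
    then show "real k / E \<le> 8 / 3 / B" using Epos B by (simp add: field_simps)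
    show "0 \<le> real k / E" using Epos by simp
  qed auto
  also have "(8 / 3 / B)\<^sup>2 \<le> 64 / 9 * (1 / B)"
    using B by (simp add: power2_eq_square field_simps)
  finally have "\<P>(x in stdn p. thr_sum p t (\<lambda>i. \<mu> i + x i) \<le> B / 8 * real k * L)
      \<le> 432 * (4 / 3 / B) + 12464 * (64 / 9 * (1 / B))" by simp
  also have "\<dots> \<le> 100000 / B" using B by (simp add: field_simps)
  finally show ?thesis unfolding t_def .
qed

lemma chi2_null_tail:
  assumes "0 < r" "1 \<le> p"
  shows "\<P>(x in stdn p. real p + r * sqrt (real p) < (\<Sum>i<p. (x i)\<^sup>2)) \<le> 2 / r\<^sup>2"
proof -
  interpret N: finite_product_prob_space "\<lambda>_. std" "{..<p}" by (rule finite_product_prob_space_std)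
  let ?A = "{x \<in> space (stdn p). r * sqrt (real p) \<le> \<bar>(\<Sum>i<p. (0 + x i)\<^sup>2) - (\<Sum>i<p. 0\<^sup>2 + 1)\<bar>}"
  note c = N.Chebyshev_sum[of "\<lambda>i y. (0 + y)\<^sup>2" "\<lambda>i. 0\<^sup>2 + 1" "r * sqrt (real p)",
      OF std_square_shift_var(3) std_square_shift_var(1) std_square_shift_var(4)]
  have "\<P>(x in stdn p. real p + r * sqrt (real p) < (\<Sum>i<p. (x i)\<^sup>2)) \<le> measure (stdn p) ?A"
    using assms by (intro N.finite_measure_mono c(2)) auto
  also have "\<dots> \<le> (\<Sum>i<p. \<integral>y. ((0 + y)\<^sup>2 - (0\<^sup>2 + 1))\<^sup>2 \<partial>std) / (r * sqrt (real p))\<^sup>2"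
    using assms by (intro c(1)) auto
  also have "\<dots> = 2 / r\<^sup>2"
    unfolding std_square_shift_var(2) using assms by (simp add: power_mult_distrib)
  finally show ?thesis .
qed

lemma chi2_power:
  assumes C: "1 \<le> C" and p: "1 \<le> p" and signal: "C\<^sup>2 * sqrt (real p) \<le> (\<Sum>i<p. (\<mu> i)\<^sup>2)"
  shows "\<P>(x in stdn p. (\<Sum>i<p. (\<mu> i + x i)\<^sup>2) \<le> real p + C\<^sup>2 / 2 * sqrt (real p)) \<le> 24 / C\<^sup>2"
proof -
  interpret N: finite_product_prob_space "\<lambda>_. std" "{..<p}" by (rule finite_product_prob_space_std)
  define A where "A = (\<Sum>i<p. (\<mu> i)\<^sup>2)"
  have sp: "1 \<le> sqrt (real p)" using p by simp
  have C2: "1 \<le> C\<^sup>2" using C by simp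
  have "C\<^sup>2 * 1 \<le> C\<^sup>2 * sqrt (real p)" using sp by (intro mult_left_mono) auto
  then have AC: "C\<^sup>2 * sqrt (real p) \<le> A" "C\<^sup>2 \<le> A" using signal by (auto simp: A_def)
  then have A0: "0 < A" using C2 by linarith
  let ?A = "{x \<in> space (stdn p). A / 2 \<le> \<bar>(\<Sum>i<p. (\<mu> i + x i)\<^sup>2) - (\<Sum>i<p. (\<mu> i)\<^sup>2 + 1)\<bar>}"
  note c = N.Chebyshev_sum[of "\<lambda>i y. (\<mu> i + y)\<^sup>2" "\<lambda>i. (\<mu> i)\<^sup>2 + 1" "A / 2",
      OF std_square_shift_var(3) std_square_shift_var(1) std_square_shift_var(4)]
  have s: "(\<Sum>i<p. (\<mu> i)\<^sup>2 + 1) = A + real p" by (simp add: A_def sum.distrib)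
  have "\<P>(x in stdn p. (\<Sum>i<p. (\<mu> i + x i)\<^sup>2) \<le> real p + C\<^sup>2 / 2 * sqrt (real p)) \<le> measure (stdn p) ?A"
    using A0 AC by (intro N.finite_measure_mono c(2)) (auto simp: s)
  also have "\<dots> \<le> (\<Sum>i<p. \<integral>y. ((\<mu> i + y)\<^sup>2 - ((\<mu> i)\<^sup>2 + 1))\<^sup>2 \<partial>std) / (A / 2)\<^sup>2"
    using A0 by (intro c(1)) auto
  also have "\<dots> = (4 * A + 2 * real p) / (A / 2)\<^sup>2"
    unfolding std_square_shift_var(2) by (simp add: A_def sum.distrib sum_distrib_left)
  also have "\<dots> = 16 / A + 8 * (real p / A\<^sup>2)" using A0 by (simp add: field_simps power2_eq_square)
  also have "\<dots> \<le> 16 / C\<^sup>2 + 8 * (1 / C\<^sup>2)"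
  proof (intro add_mono mult_left_mono)
    have "0 < A * C\<^sup>2" using A0 C2 by (intro mult_pos_pos) auto
    then show "16 / A \<le> 16 / C\<^sup>2" using AC by (intro divide_left_mono) auto
    have "C\<^sup>2 * real p \<le> (C\<^sup>2)\<^sup>2 * real p"
      using C2 by (intro mult_right_mono self_le_power) auto
    also have "\<dots> = (C\<^sup>2 * sqrt (real p))\<^sup>2" by (simp add: power_mult_distrib)
    also have "\<dots> \<le> A\<^sup>2" using AC by (intro power_mono) auto
    finally show "real p / A\<^sup>2 \<le> 1 / C\<^sup>2" using A0 C by (simp add: field_simps)
  qed simp
  finally show ?thesis by simp
qed

section \<open>The adaptive test\<close>

lemma Y_stat_eq: "Y_stat p \<gamma> t \<omega> = thr_sum p t (X_tilde p \<gamma> \<omega>)"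
  by (simp add: Y_stat_def thr_sum_def thr_def)

lemma phi_chi2_eq:
  "phi_chi2 p \<gamma> r \<omega> = of_bool (real p + r * sqrt (real p) < (\<Sum>i<p. (X_tilde p \<gamma> \<omega> i)\<^sup>2))"
  by (simp add: phi_chi2_def L2_set_def sum_nonneg)

lemma phi_ones_eq: "phi_ones p \<gamma> r \<omega> = of_bool ((1 - \<gamma> + \<gamma> * real p) * (1 + r) < (mean_proj p \<omega>)\<^sup>2)"
  by (simp add: phi_ones_def mean_proj_def)

lemma phi_adaptive_eq_0_iff:
  "phi_adaptive C p \<gamma> \<omega> = 0 \<longleftrightarrow>
    (\<forall>s. 1 \<le> s \<and> real s < sqrt (real p) \<longrightarrow> thr_sum p (t_sparse p s) (X_tilde p \<gamma> \<omega>) \<le> r_sparse C p s) \<and>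
    (\<Sum>i<p. (X_tilde p \<gamma> \<omega> i)\<^sup>2) \<le> real p + C\<^sup>2 / 2 * sqrt (real p) \<and>
    (\<forall>s. real p - sqrt (real p) < real s \<and> s < p \<longrightarrow> thr_sum p (t_dense p s) (X_tilde p \<gamma> \<omega>) \<le> r_dense C p s) \<and>
    (mean_proj p \<omega>)\<^sup>2 \<le> (1 - \<gamma> + \<gamma> * real p) * (1 + C\<^sup>2 / 2)"
proof -
  have Max0: "Max (insert 0 (f ` S)) = 0 \<longleftrightarrow> (\<forall>s\<in>S. f s = 0)" if "finite S" for f :: "nat \<Rightarrow> nat" and S
  proof -
    have "Max (insert 0 (f ` S)) = 0 \<longleftrightarrow> Max (insert 0 (f ` S)) \<le> 0" by (simp only: le_zero_eq)
    also have "\<dots> \<longleftrightarrow> (\<forall>s\<in>S. f s = 0)" using that by (subst Max_le_iff) auto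
    finally show ?thesis .
  qed
  have f1: "finite {s. 1 \<le> s \<and> real s < sqrt (real p)}"
  proof (rule finite_subset)
    show "{s. 1 \<le> s \<and> real s < sqrt (real p)} \<subseteq> {..nat \<lceil>sqrt (real p)\<rceil>}"
      by auto linarith
  qed simp
  have f2: "finite {s. real p - sqrt (real p) < real s \<and> s < p}"
    by (rule finite_subset[of _ "{..<p}"]) auto
  have max0: "max a b = 0 \<longleftrightarrow> a = 0 \<and> b = 0" for a b :: nat by auto
  have of_bool0: "of_bool b = (0 :: nat) \<longleftrightarrow> \<not> b" for b by simp
  show ?thesis
    unfolding phi_adaptive_def max0 Max0[OF f1] Max0[OF f2] phi_chi2_eq phi_ones_eq phi_def Y_stat_eq of_bool0 not_less
    by blast
qed

lemma thr_sum_restrict: "thr_sum p t (restrict x {..<p}) = thr_sum p t x"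
  by (simp add: thr_sum_def)

lemma t_dense_eq: "s \<le> p \<Longrightarrow> t_dense p s = t_sparse p (p - s)"
  by (simp add: t_dense_def t_sparse_def of_nat_diff)

lemma r_dense_eq: "s \<le> p \<Longrightarrow> r_dense C p s = 4 * r_sparse C p (p - s)"
  by (simp add: r_dense_def r_sparse_def of_nat_diff)

lemma r_sparse_nonneg: "0 \<le> r_sparse C p s"
  unfolding r_sparse_def by (intro mult_nonneg_nonneg ln_ge_zero) auto

text \<open>
  The tests of the dense range need no separate treatment: the one at \<open>s\<close> uses the level of the sparse
  test at \<open>p - s\<close> with a four times larger critical value.
\<close>

lemma adaptive_null:
  assumes p: "1 \<le> p" and \<gamma>: "0 \<le> \<gamma>" "\<gamma> < 1" and C: "1 \<le> C"
  shows "\<P>(\<omega> in sample_law p \<gamma> (zero_vector p). phi_adaptive C p \<gamma> \<omega> = 1) \<le> 11534346 / C\<^sup>2"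
proof -
  define \<theta> where "\<theta> = zero_vector p"
  define V where "V = 1 - \<gamma> + \<gamma> * real p"
  have V: "0 < V" using \<gamma> unfolding V_def by (intro add_pos_nonneg) auto
  let ?P = "sample_law p \<gamma> \<theta>"
  interpret S: prob_space ?P by (rule prob_space_sample_law[OF p \<gamma>])
  have \<theta>0: "(\<Sum>i<p. \<theta> i) = 0" by (simp add: \<theta>_def zero_vector_def)
  have ms: "mean_shift p \<gamma> \<theta> i = 0" if "i < p" for i
    using that unfolding mean_shift_def \<theta>0 by (simp add: \<theta>_def zero_vector_def)
  let ?Q1 = "\<lambda>x. \<exists>s. 1 \<le> s \<and> real s < sqrt (real p) \<and> r_sparse C p s < thr_sum p (t_sparse p s) x"
  let ?Q2 = "\<lambda>x. real p + C\<^sup>2 / 2 * sqrt (real p) < (\<Sum>i<p. (x i)\<^sup>2)"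
  let ?E1 = "{\<omega> \<in> space ?P. ?Q1 (X_tilde p \<gamma> \<omega>)}"
  let ?E2 = "{\<omega> \<in> space ?P. ?Q2 (X_tilde p \<gamma> \<omega>)}"
  define a where "a = sqrt (V * (1 + C\<^sup>2 / 2))"
  let ?E3 = "{\<omega> \<in> space ?P. a \<le> \<bar>mean_proj p \<omega> - (\<Sum>i<p. \<theta> i) / sqrt (real p)\<bar>}"
  have a2: "a\<^sup>2 = V * (1 + C\<^sup>2 / 2)" "0 < a"
    unfolding a_def using V by (auto intro!: mult_pos_pos add_pos_nonneg)
  have upd: "thr_sum p t (\<lambda>i. mean_shift p \<gamma> \<theta> i + x i) = thr_sum p t x" for t x
    by (simp add: thr_sum_def ms)
  have upd2: "(\<Sum>i<p. (mean_shift p \<gamma> \<theta> i + x i)\<^sup>2) = (\<Sum>i<p. (x i)\<^sup>2)" for x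
    by (simp add: ms)
  have m1: "{x \<in> space (boreln p). ?Q1 x} \<in> sets (boreln p)"
    by measurable
  have m2: "{x \<in> space (boreln p). ?Q2 x} \<in> sets (boreln p)"
    by measurable
  note e1 = measure_X_tilde[OF p \<gamma> m1, of \<theta>, unfolded thr_sum_restrict, OF refl]
  have r2: "(\<Sum>i<p. (restrict x {..<p} i)\<^sup>2) = (\<Sum>i<p. (x i)\<^sup>2)" for x :: "nat \<Rightarrow> real" by simp
  note e2 = measure_X_tilde[OF p \<gamma> m2, of \<theta>, unfolded r2, OF refl]
  note e3 = mean_proj_tail[OF p \<gamma> a2(2), of \<theta>]
  have b1: "measure ?P ?E1 \<le> 11534336 / C ^ 4"
    unfolding e1(1) upd using thr_sum_null_tail[of C p] C by simp
  have b2: "measure ?P ?E2 \<le> 8 / C ^ 4"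
    unfolding e2(1) upd2 using chi2_null_tail[of "C\<^sup>2 / 2" p] C p by (simp add: power_divide flip: power_mult)
  have b3: "measure ?P ?E3 \<le> 2 / C\<^sup>2"
  proof -
    have "measure ?P ?E3 \<le> V / a\<^sup>2" using e3(1) by (simp add: V_def)
    also have "\<dots> = 1 / (1 + C\<^sup>2 / 2)" using V by (simp add: a2(1))
    also have "\<dots> \<le> 1 / (C\<^sup>2 / 2)" using C by (intro divide_left_mono) (auto intro!: mult_pos_pos add_pos_nonneg)
    finally show ?thesis by simp
  qed
  have "\<P>(\<omega> in ?P. phi_adaptive C p \<gamma> \<omega> = 1) \<le> measure ?P (?E1 \<union> ?E2 \<union> ?E3)"
  proof (rule S.finite_measure_mono)
    show "?E1 \<union> ?E2 \<union> ?E3 \<in> sets ?P" using e1(2) e2(2) e3(2) by (intro sets.Un)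
    show "{\<omega> \<in> space ?P. phi_adaptive C p \<gamma> \<omega> = 1} \<subseteq> ?E1 \<union> ?E2 \<union> ?E3"
    proof (rule subsetI, rule ccontr)
      fix \<omega> assume w: "\<omega> \<in> {\<omega> \<in> space ?P. phi_adaptive C p \<gamma> \<omega> = 1}"
        and n: "\<omega> \<notin> ?E1 \<union> ?E2 \<union> ?E3"
      let ?X = "X_tilde p \<gamma> \<omega>"
      have x: "\<omega> \<in> space ?P" and ne: "phi_adaptive C p \<gamma> \<omega> \<noteq> 0" using w by auto
      have n1: "\<not> ?Q1 ?X" and n2: "\<not> ?Q2 ?X" and n3: "\<not> a \<le> \<bar>mean_proj p \<omega> - (\<Sum>i<p. \<theta> i) / sqrt (real p)\<bar>"
        using n x by blast+
      have "\<not> V * (1 + C\<^sup>2 / 2) < (mean_proj p \<omega>)\<^sup>2"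
      proof
        assume "V * (1 + C\<^sup>2 / 2) < (mean_proj p \<omega>)\<^sup>2"
        then have "a\<^sup>2 \<le> (mean_proj p \<omega>)\<^sup>2" by (simp add: a2)
        then have "\<bar>a\<bar> \<le> \<bar>mean_proj p \<omega>\<bar>" by (simp only: abs_le_square_iff)
        then show False using n3 a2(2) by (simp add: \<theta>0)
      qed
      then have "(\<exists>s. 1 \<le> s \<and> real s < sqrt (real p) \<and> r_sparse C p s < thr_sum p (t_sparse p s) ?X) \<or>
         (\<exists>s. real p - sqrt (real p) < real s \<and> s < p \<and> r_dense C p s < thr_sum p (t_dense p s) ?X)"
        using ne n2 unfolding phi_adaptive_eq_0_iff V_def not_less[symmetric] by blast
      then have "?Q1 ?X"
      proof
        assume "\<exists>s. real p - sqrt (real p) < real s \<and> s < p \<and> r_dense C p s < thr_sum p (t_dense p s) ?X"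
        then obtain s where s: "real p - sqrt (real p) < real s" "s < p" "r_dense C p s < thr_sum p (t_dense p s) ?X"
          by auto
        have "r_sparse C p (p - s) < thr_sum p (t_sparse p (p - s)) ?X"
          using s r_sparse_nonneg[of C p "p - s"] by (simp add: t_dense_eq r_dense_eq)
        moreover have "1 \<le> p - s" "real (p - s) < sqrt (real p)" using s by (auto simp: of_nat_diff)
        ultimately show ?thesis by blast
      qed
      with n1 show False ..
    qed
  qed
  also have "\<dots> \<le> measure ?P ?E1 + measure ?P ?E2 + measure ?P ?E3"
    using e1(2) e2(2) e3(2)
    by (intro order_trans[OF measure_Un_le] add_right_mono measure_Un_le sets.Un)
  also have "\<dots> \<le> 11534336 / C ^ 4 + 8 / C ^ 4 + 2 / C\<^sup>2" using b1 b2 b3 by linarith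
  also have "\<dots> = 11534344 / C ^ 4 + 2 / C\<^sup>2" by (simp add: add_divide_distrib[symmetric])
  also have "11534344 / C ^ 4 \<le> 11534344 / C\<^sup>2"
    using C by (intro divide_left_mono power_increasing) auto
  also have "11534344 / C\<^sup>2 + 2 / C\<^sup>2 = 11534346 / C\<^sup>2" by (simp add: add_divide_distrib[symmetric])
  finally show ?thesis by (simp add: \<theta>_def)
qed

text \<open>
  The type II error of the adaptive test is bounded by that of any one of its components. The hypothesis
  \<open>sub\<close> covers the component tests of both the sparse and the dense range.
\<close>

lemma detect_thr_sum:
  assumes p: "1 \<le> p" and \<gamma>: "0 \<le> \<gamma>" "\<gamma> < 1" and k: "1 \<le> k" "real k < sqrt (real p)"
    and T: "T \<subseteq> {..<p}" "card T \<le> k" and B: "16 \<le> B"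
    and signal: "B * real k * ln (1 + real p / (real k)\<^sup>2) \<le> (\<Sum>i\<in>T. (mean_shift p \<gamma> \<theta> i)\<^sup>2)"
    and sub: "\<And>\<omega>. phi_adaptive C p \<gamma> \<omega> = 0 \<Longrightarrow>
      thr_sum p (t_sparse p k) (X_tilde p \<gamma> \<omega>) \<le> B / 8 * real k * ln (1 + real p / (real k)\<^sup>2)"
  shows "\<P>(\<omega> in sample_law p \<gamma> \<theta>. phi_adaptive C p \<gamma> \<omega> = 0) \<le> 100000 / B"
proof -
  let ?P = "sample_law p \<gamma> \<theta>"
  interpret S: prob_space ?P by (rule prob_space_sample_law[OF p \<gamma>])
  let ?Q = "\<lambda>x. thr_sum p (t_sparse p k) x \<le> B / 8 * real k * ln (1 + real p / (real k)\<^sup>2)"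
  have m: "{x \<in> space (boreln p). ?Q x} \<in> sets (boreln p)"
    by measurable
  note e = measure_X_tilde[OF p \<gamma> m, of \<theta>, unfolded thr_sum_restrict, OF refl]
  have "\<P>(\<omega> in ?P. phi_adaptive C p \<gamma> \<omega> = 0) \<le> \<P>(\<omega> in ?P. ?Q (X_tilde p \<gamma> \<omega>))"
    by (rule S.finite_measure_mono[OF _ e(2)]) (use sub in blast)
  also have "\<dots> \<le> 100000 / B"
    unfolding e(1) unfolding t_sparse_def by (rule thr_sum_power[OF k T B signal])
  finally show ?thesis .
qed

lemma detect_chi2:
  assumes p: "1 \<le> p" and \<gamma>: "0 \<le> \<gamma>" "\<gamma> < 1" and C: "1 \<le> C"
    and signal: "C\<^sup>2 * sqrt (real p) \<le> (\<Sum>i<p. (mean_shift p \<gamma> \<theta> i)\<^sup>2)"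
  shows "\<P>(\<omega> in sample_law p \<gamma> \<theta>. phi_adaptive C p \<gamma> \<omega> = 0) \<le> 24 / C\<^sup>2"
proof -
  let ?P = "sample_law p \<gamma> \<theta>"
  interpret S: prob_space ?P by (rule prob_space_sample_law[OF p \<gamma>])
  let ?Q = "\<lambda>x. (\<Sum>i<p. (x i)\<^sup>2) \<le> real p + C\<^sup>2 / 2 * sqrt (real p)"
  have m: "{x \<in> space (boreln p). ?Q x} \<in> sets (boreln p)"
    by measurable
  have r2: "(\<Sum>i<p. (restrict x {..<p} i)\<^sup>2) = (\<Sum>i<p. (x i)\<^sup>2)" for x :: "nat \<Rightarrow> real" by simp
  note e = measure_X_tilde[OF p \<gamma> m, of \<theta>, unfolded r2, OF refl]
  have "\<P>(\<omega> in ?P. phi_adaptive C p \<gamma> \<omega> = 0) \<le> \<P>(\<omega> in ?P. ?Q (X_tilde p \<gamma> \<omega>))"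
    by (rule S.finite_measure_mono[OF _ e(2)]) (use phi_adaptive_eq_0_iff in blast)
  also have "\<dots> \<le> 24 / C\<^sup>2"
    unfolding e(1) by (rule chi2_power[OF C p signal])
  finally show ?thesis .
qed

lemma detect_mean:
  assumes p: "1 \<le> p" and \<gamma>: "0 \<le> \<gamma>" "\<gamma> < 1" and C: "4 \<le> C"
    and signal: "C\<^sup>2 * (1 - \<gamma> + \<gamma> * real p) \<le> (\<Sum>i<p. \<theta> i)\<^sup>2 / real p"
  shows "\<P>(\<omega> in sample_law p \<gamma> \<theta>. phi_adaptive C p \<gamma> \<omega> = 0) \<le> 16 / C\<^sup>2"
proof -
  let ?P = "sample_law p \<gamma> \<theta>"
  interpret S: prob_space ?P by (rule prob_space_sample_law[OF p \<gamma>])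
  define V where "V = 1 - \<gamma> + \<gamma> * real p"
  have V: "0 < V" using \<gamma> unfolding V_def by (intro add_pos_nonneg) auto
  define a where "a = C * sqrt V"
  define M where "M = (\<Sum>i<p. \<theta> i) / sqrt (real p)"
  have a: "0 < a" using C V by (simp add: a_def)
  have a2: "a\<^sup>2 = C\<^sup>2 * V" using V by (simp add: a_def power_mult_distrib)
  have "a\<^sup>2 \<le> M\<^sup>2" using signal by (simp add: a2 M_def V_def power_divide)
  then have "\<bar>a\<bar> \<le> \<bar>M\<bar>" by (simp only: abs_le_square_iff)
  then have aM: "a \<le> \<bar>M\<bar>" using a by simp
  have a4: "0 < a / 4" using a by simp
  note e = mean_proj_tail[OF p \<gamma> a4, of \<theta>, folded M_def V_def]
  have "\<P>(\<omega> in ?P. phi_adaptive C p \<gamma> \<omega> = 0)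
      \<le> \<P>(\<omega> in ?P. a / 4 \<le> \<bar>mean_proj p \<omega> - M\<bar>)"
  proof (rule S.finite_measure_mono[OF _ e(2)], rule subsetI)
    fix \<omega> assume w: "\<omega> \<in> {\<omega> \<in> space ?P. phi_adaptive C p \<gamma> \<omega> = 0}"
    then have "(mean_proj p \<omega>)\<^sup>2 \<le> V * (1 + C\<^sup>2 / 2)" by (simp add: phi_adaptive_eq_0_iff V_def)
    \<comment> \<open>\<open>1 + C\<^sup>2 / 2 \<le> 9 / 16 * C\<^sup>2\<close> is \<open>C\<^sup>2 \<ge> 16\<close>.\<close>
    also have "\<dots> \<le> V * (9 / 16 * C\<^sup>2)"
      using V power_mono[OF C, of 2] by (intro mult_left_mono) auto
    also have "\<dots> = (3 / 4 * a)\<^sup>2" by (simp only: power_mult_distrib a2) (simp add: power2_eq_square)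
    finally have "\<bar>mean_proj p \<omega>\<bar> \<le> \<bar>3 / 4 * a\<bar>" by (simp only: abs_le_square_iff)
    then have "\<bar>mean_proj p \<omega>\<bar> \<le> 3 / 4 * a" using a by simp
    then have "a / 4 \<le> \<bar>mean_proj p \<omega> - M\<bar>" using aM by linarith
    then show "\<omega> \<in> {\<omega> \<in> space ?P. a / 4 \<le> \<bar>mean_proj p \<omega> - M\<bar>}" using w by auto
  qed
  also have "\<dots> \<le> V / (a / 4)\<^sup>2" by (rule e(1))
  also have "\<dots> = 16 / C\<^sup>2" using V C by (simp add: power_divide a2)
  finally show ?thesis .
qed

lemma sum_mean_shift_square:
  assumes p: "1 \<le> p" and \<gamma>: "\<gamma> < 1"
  shows "(1 - \<gamma>) * (\<Sum>i<p. (mean_shift p \<gamma> \<theta> i)\<^sup>2) + (\<Sum>i<p. \<theta> i)\<^sup>2 / real p = (\<Sum>i<p. (\<theta> i)\<^sup>2)"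
proof -
  define m where "m = (\<Sum>j<p. \<theta> j) / real p"
  have "(1 - \<gamma>) * (\<Sum>i<p. (mean_shift p \<gamma> \<theta> i)\<^sup>2) = (\<Sum>i<p. (\<theta> i - m)\<^sup>2)"
    unfolding sum_distrib_left using \<gamma> by (intro sum.cong) (auto simp: mean_shift_def m_def power_divide)
  also have "\<dots> = (\<Sum>i<p. (\<theta> i)\<^sup>2 - 2 * m * \<theta> i + m\<^sup>2)"
    by (intro sum.cong) (auto simp: power2_eq_square algebra_simps)
  also have "\<dots> = (\<Sum>i<p. (\<theta> i)\<^sup>2) - 2 * m * (\<Sum>i<p. \<theta> i) + real p * m\<^sup>2"
    by (simp add: sum.distrib sum_subtractf sum_distrib_left)
  also have "real p * m\<^sup>2 = (\<Sum>i<p. \<theta> i)\<^sup>2 / real p" using p by (simp add: m_def power_divide power2_eq_square)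
  also have "2 * m * (\<Sum>i<p. \<theta> i) = 2 * ((\<Sum>i<p. \<theta> i)\<^sup>2 / real p)" by (simp add: m_def power2_eq_square)
  finally show ?thesis by simp
qed

text \<open>
  If at most half of the coordinates of \<open>\<theta>\<close> are non-zero, centring leaves a quarter of its squared norm
  on the support. By the Cauchy--Schwarz inequality the fraction left is at least \<open>(1 - n / p)\<^sup>2\<close> for a
  support of size \<open>n\<close>.
\<close>

lemma mean_shift_support_ge:
  assumes p: "1 \<le> p" and \<gamma>: "\<gamma> < 1" and c: "2 * card {i \<in> {..<p}. \<theta> i \<noteq> 0} \<le> p"
  shows "(\<Sum>i<p. (\<theta> i)\<^sup>2) / 4 \<le> (1 - \<gamma>) * (\<Sum>i | i \<in> {..<p} \<and> \<theta> i \<noteq> 0. (mean_shift p \<gamma> \<theta> i)\<^sup>2)"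
proof -
  define T where "T = {i \<in> {..<p}. \<theta> i \<noteq> 0}"
  define n where "n = real (card T)"
  define S where "S = (\<Sum>i<p. \<theta> i)"
  define Q where "Q = (\<Sum>i<p. (\<theta> i)\<^sup>2)"
  have T: "T \<subseteq> {..<p}" "finite T" by (auto simp: T_def)
  have ST: "S = (\<Sum>i\<in>T. \<theta> i)" unfolding S_def T_def by (intro sum.mono_neutral_right) auto
  have QT: "Q = (\<Sum>i\<in>T. (\<theta> i)\<^sup>2)" unfolding Q_def T_def by (intro sum.mono_neutral_right) auto
  have n: "0 \<le> n" "2 * n \<le> real p" using c by (auto simp: n_def T_def)
  have CS: "S\<^sup>2 \<le> n * Q"
    using Cauchy_Schwarz_ineq_sum[of "\<lambda>_. 1" \<theta> T] by (simp add: ST QT n_def)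
  have Q0: "0 \<le> Q" unfolding Q_def by (intro sum_nonneg) auto
  have pr: "0 < real p" using p by simp
  have "(1 - \<gamma>) * (\<Sum>i\<in>T. (mean_shift p \<gamma> \<theta> i)\<^sup>2) = (\<Sum>i\<in>T. (\<theta> i - S / real p)\<^sup>2)"
    unfolding sum_distrib_left S_def using \<gamma> by (intro sum.cong) (auto simp: mean_shift_def power_divide)
  also have "\<dots> = (\<Sum>i\<in>T. (\<theta> i)\<^sup>2 - 2 * (S / real p) * \<theta> i + (S / real p)\<^sup>2)"
    by (intro sum.cong) (auto simp: power2_eq_square algebra_simps)
  also have "\<dots> = Q - 2 * (S / real p) * S + n * (S / real p)\<^sup>2"
    by (simp add: sum.distrib sum_subtractf sum_distrib_left QT ST n_def)
  also have "\<dots> = Q - S\<^sup>2 * ((2 * real p - n) / (real p)\<^sup>2)"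
    using pr by (simp add: power2_eq_square field_simps)
  also have "\<dots> \<ge> Q - n * Q * ((2 * real p - n) / (real p)\<^sup>2)"
    using CS n by (intro diff_left_mono mult_right_mono) auto
  also have "Q - n * Q * ((2 * real p - n) / (real p)\<^sup>2) = Q * (1 - n / real p)\<^sup>2"
    using pr by (simp add: power2_eq_square field_simps)
  also have "Q * (1 - n / real p)\<^sup>2 \<ge> Q * (1 / 2)\<^sup>2"
  proof (intro mult_left_mono power_mono Q0)
    show "1 / 2 \<le> 1 - n / real p" using n pr by (simp add: field_simps)
  qed simp
  finally show ?thesis by (simp add: T_def Q_def power2_eq_square)
qed

lemma adaptive_power:
  assumes p: "1 \<le> s" "s \<le> p" and \<gamma>: "0 \<le> \<gamma>" "\<gamma> < 1" and C: "8 \<le> C"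
    and \<theta>: "\<theta> \<in> Theta p s (C * psi p \<gamma> s)"
  shows "\<P>(\<omega> in sample_law p \<gamma> \<theta>. phi_adaptive C p \<gamma> \<omega> = 0) \<le> 400000 / C\<^sup>2"
proof -
  let ?goal = "\<P>(\<omega> in sample_law p \<gamma> \<theta>. phi_adaptive C p \<gamma> \<omega> = 0)"
  define V where "V = 1 - \<gamma> + \<gamma> * real p"
  have V: "0 < V" using \<gamma> unfolding V_def by (intro add_pos_nonneg) auto
  have p1: "1 \<le> p" using p by simp
  have g: "0 < 1 - \<gamma>" using \<gamma> by simp
  have C0: "0 < C\<^sup>2" "8\<^sup>2 \<le> C\<^sup>2" using C power_mono[OF C, of 2] by auto
  have weaken: "?goal \<le> 400000 / C\<^sup>2" if "?goal \<le> b / C\<^sup>2" "b \<le> 400000" for b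
    using that(1) by (rule order_trans) (use that(2) in \<open>auto intro: divide_right_mono\<close>)
  define Q where "Q = (\<Sum>i<p. (\<theta> i)\<^sup>2)"
  define \<mu> where "\<mu> = mean_shift p \<gamma> \<theta>"
  define A where "A = (\<Sum>i<p. (\<mu> i)\<^sup>2)"
  define m2 where "m2 = ((\<Sum>i<p. \<theta> i) / real p)\<^sup>2"
  have supp: "card {i \<in> {..<p}. \<theta> i \<noteq> 0} \<le> s" using \<theta> by (simp add: Theta_def)
  have norm: "C * psi p \<gamma> s \<le> sqrt Q" using \<theta> by (simp add: Theta_def L2_set_def Q_def)
  have Q0: "0 \<le> Q" unfolding Q_def by (intro sum_nonneg) auto
  have QC: "C\<^sup>2 * psi2 p \<gamma> s \<le> Q" if "0 \<le> psi2 p \<gamma> s"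
  proof -
    have "(C * psi p \<gamma> s)\<^sup>2 \<le> (sqrt Q)\<^sup>2" using norm C that by (intro power_mono) (auto simp: psi_def)
    then show ?thesis using that Q0 by (simp add: psi_def power_mult_distrib)
  qed
  have split: "Q = (1 - \<gamma>) * A + real p * m2"
    using sum_mean_shift_square[OF p1 \<gamma>(2), of \<theta>] p1
    by (simp add: Q_def A_def \<mu>_def m2_def power_divide power2_eq_square)
  have m2S: "(\<Sum>i<p. \<theta> i)\<^sup>2 / real p = real p * m2"
    using p1 by (simp add: m2_def power_divide power2_eq_square)
  let ?Z = "{i \<in> {..<p}. \<theta> i = 0}"
  have cardZ: "p - s \<le> card ?Z"
  proof -
    have "card ?Z + card {i \<in> {..<p}. \<theta> i \<noteq> 0} = card (?Z \<union> {i \<in> {..<p}. \<theta> i \<noteq> 0})"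
      by (rule card_Un_disjoint[symmetric]) auto
    also have "?Z \<union> {i \<in> {..<p}. \<theta> i \<noteq> 0} = {..<p}" by auto
    finally have "card ?Z + card {i \<in> {..<p}. \<theta> i \<noteq> 0} = p" by simp
    then show ?thesis using supp by simp
  qed
  have muZ: "(\<mu> i)\<^sup>2 = m2 / (1 - \<gamma>)" if "\<theta> i = 0" for i
    using that g by (simp add: \<mu>_def mean_shift_def m2_def power_divide power_mult_distrib)
  consider (sparse) "real s < sqrt (real p)" | (chi) "C\<^sup>2 * sqrt (real p) \<le> A" | (mean) "C\<^sup>2 * V \<le> real p * m2"
    | (rest) "\<not> real s < sqrt (real p)" "\<not> C\<^sup>2 * sqrt (real p) \<le> A" "\<not> C\<^sup>2 * V \<le> real p * m2"
    by blast
  then show ?thesis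
  proof cases
    case sparse
    define L where "L = ln (1 + real p / (real s)\<^sup>2)"
    have L0: "0 \<le> L" unfolding L_def by (intro ln_ge_zero) auto
    have psi: "psi2 p \<gamma> s = (1 - \<gamma>) * real s * L" using sparse by (simp add: psi2_def L_def)
    have "(real s)\<^sup>2 < (sqrt (real p))\<^sup>2" using sparse by (intro power_strict_mono) auto
    then have "real (s\<^sup>2) < real p" by simp
    then have "s\<^sup>2 < p" by (simp only: of_nat_less_iff)
    \<comment> \<open>Hence \<open>2 s \<le> p\<close>, so the support is at most half of the coordinates.\<close>
    moreover have "2 * s \<le> s\<^sup>2 + 1"
    proof -
      have "2 * int s \<le> (int s)\<^sup>2 + 1" using zero_le_power2[of "int s - 1"] by (simp add: power2_diff)
      then have "int (2 * s) \<le> int (s\<^sup>2 + 1)" by simp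
      then show ?thesis by (simp only: of_nat_le_iff)
    qed
    ultimately have c: "2 * card {i \<in> {..<p}. \<theta> i \<noteq> 0} \<le> p" using supp by linarith
    have "C\<^sup>2 * ((1 - \<gamma>) * real s * L) \<le> Q" using QC g L0 by (simp add: psi)
    also have "Q / 4 \<le> (1 - \<gamma>) * (\<Sum>i | i \<in> {..<p} \<and> \<theta> i \<noteq> 0. (mean_shift p \<gamma> \<theta> i)\<^sup>2)"
      unfolding Q_def by (rule mean_shift_support_ge[OF p1 \<gamma>(2) c])
    finally have "(1 - \<gamma>) * (C\<^sup>2 / 4 * real s * L) \<le> (1 - \<gamma>) * (\<Sum>i | i \<in> {..<p} \<and> \<theta> i \<noteq> 0. (mean_shift p \<gamma> \<theta> i)\<^sup>2)"
      by (simp add: ac_simps)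
    then have sig: "C\<^sup>2 / 4 * real s * L \<le> (\<Sum>i | i \<in> {..<p} \<and> \<theta> i \<noteq> 0. (mean_shift p \<gamma> \<theta> i)\<^sup>2)"
      using g by simp
    have "?goal \<le> 100000 / (C\<^sup>2 / 4)"
    proof (rule detect_thr_sum[OF p1 \<gamma> p(1) sparse _ supp _ sig[unfolded L_def]])
      fix \<omega> assume "phi_adaptive C p \<gamma> \<omega> = 0"
      then have "thr_sum p (t_sparse p s) (X_tilde p \<gamma> \<omega>) \<le> r_sparse C p s"
        using p(1) sparse by (simp add: phi_adaptive_eq_0_iff)
      then show "thr_sum p (t_sparse p s) (X_tilde p \<gamma> \<omega>) \<le> C\<^sup>2 / 4 / 8 * real s * ln (1 + real p / (real s)\<^sup>2)"
        by (simp add: r_sparse_def)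
    qed (use C0 in auto)
    then show ?thesis by simp
  next
    case chi
    have "?goal \<le> 24 / C\<^sup>2"
      by (rule detect_chi2[OF p1 \<gamma>]) (use C chi in \<open>auto simp: A_def \<mu>_def\<close>)
    then show ?thesis by (rule weaken) simp
  next
    case mean
    have "?goal \<le> 16 / C\<^sup>2"
      by (rule detect_mean[OF p1 \<gamma>]) (use C mean in \<open>auto simp: m2S V_def\<close>)
    then show ?thesis by (rule weaken) simp
  next
    case rest
    note notsparse = rest(1) and notchi = rest(2) and notmean = rest(3)
    \<comment> \<open>Both other tests failing, the first term of the minimum in \<open>psi2\<close> is a lower bound for the mean.\<close>
    have signal: "C\<^sup>2 * b \<le> real p * m2"
      if b: "psi2 p \<gamma> s = (1 - \<gamma>) * sqrt (real p) + min b V" "0 \<le> b" for b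
    proof -
      have "0 \<le> psi2 p \<gamma> s" unfolding b(1) using g V b(2) by (intro add_nonneg_nonneg mult_nonneg_nonneg) auto
      then have "C\<^sup>2 * ((1 - \<gamma>) * sqrt (real p) + min b V) \<le> (1 - \<gamma>) * A + real p * m2"
        using QC unfolding split b(1) by simp
      moreover have "(1 - \<gamma>) * A \<le> (1 - \<gamma>) * (C\<^sup>2 * sqrt (real p))"
        using notchi g by (intro mult_left_mono) auto
      ultimately have "C\<^sup>2 * min b V \<le> real p * m2" by (simp add: algebra_simps)
      then show ?thesis using notmean by (cases "b \<le> V") (auto simp: min_def)
    qed
    show ?thesis
    proof (cases "real s \<le> real p - sqrt (real p)")
      case True
      have ps: "0 < real p - real s" proof -
        have "0 < sqrt (real p)" using p1 by simp
        then show ?thesis using True by linarith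
      qed
      define b where "b = (1 - \<gamma>) * real p powr (3/2) / (real p - real s)"
      have b0: "0 \<le> b" using g ps by (simp add: b_def)
      have "C\<^sup>2 * b \<le> real p * m2"
        by (rule signal) (use True notsparse b0 in \<open>simp_all add: psi2_def b_def V_def\<close>)
      moreover have "real p powr (3/2) = real p * sqrt (real p)"
      proof -
        have "real p powr (3/2) = real p powr (1 + 1/2)" by simp
        also have "\<dots> = real p powr 1 * real p powr (1/2)" by (rule powr_add)
        finally show ?thesis by (simp add: powr_half_sqrt)
      qed
      ultimately have "real p * (C\<^sup>2 * ((1 - \<gamma>) * sqrt (real p) / (real p - real s))) \<le> real p * m2"
        by (simp add: b_def ac_simps)
      then have "C\<^sup>2 * ((1 - \<gamma>) * sqrt (real p) / (real p - real s)) \<le> m2"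
        by (rule mult_left_le_imp_le) (use p1 in simp)
      then have "C\<^sup>2 * sqrt (real p) \<le> (real p - real s) * (m2 / (1 - \<gamma>))"
        using ps g by (simp add: field_simps)
      also have "\<dots> \<le> real (card ?Z) * (m2 / (1 - \<gamma>))"
        using cardZ p g by (intro mult_right_mono) (auto simp: m2_def)
      also have "\<dots> = (\<Sum>i\<in>?Z. (\<mu> i)\<^sup>2)" by (simp add: muZ)
      also have "\<dots> \<le> A" unfolding A_def by (intro sum_mono2) auto
      \<comment> \<open>The zeros of \<open>\<theta>\<close> alone would let the chi-square test succeed.\<close>
      finally show ?thesis using notchi by simp
    next
      case False
      then have dense: "real p - sqrt (real p) < real s" by simp
      have sp: "s < p"
      proof (rule ccontr)
        assume "\<not> s < p"
        then have "s = p" using p by simp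
        then have "psi2 p \<gamma> s = (1 - \<gamma>) * sqrt (real p) + min V V"
          using notsparse False by (simp add: psi2_def V_def)
        from signal[OF this] V notmean show False by simp
      qed
      define k where "k = p - s"
      have k: "1 \<le> k" "real k < sqrt (real p)" "real k = real p - real s"
        using sp dense by (auto simp: k_def of_nat_diff)
      define L where "L = ln (1 + real p / (real k)\<^sup>2)"
      have L0: "0 \<le> L" unfolding L_def by (intro ln_ge_zero) auto
      have "C\<^sup>2 * ((1 - \<gamma>) * real p * L) \<le> real p * m2"
        by (rule signal) (use False notsparse sp g L0 in \<open>simp_all add: psi2_def V_def L_def k(3)\<close>)
      then have "real p * (C\<^sup>2 * ((1 - \<gamma>) * L)) \<le> real p * m2" by (simp add: ac_simps)
      then have "C\<^sup>2 * ((1 - \<gamma>) * L) \<le> m2" by (rule mult_left_le_imp_le) (use p1 in simp)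
      then have m2: "C\<^sup>2 * L \<le> m2 / (1 - \<gamma>)" using g by (simp add: field_simps)
      have "k \<le> card ?Z" using cardZ by (simp add: k_def)
      then obtain T where T: "T \<subseteq> ?Z" "card T = k" by (rule obtain_subset_with_card_n)
      have "C\<^sup>2 * real k * L \<le> real k * (m2 / (1 - \<gamma>))"
        using mult_left_mono[OF m2, of "real k"] by (simp add: ac_simps)
      also have "\<dots> = (\<Sum>i\<in>T. m2 / (1 - \<gamma>))" using T by simp
      also have "\<dots> = (\<Sum>i\<in>T. (\<mu> i)\<^sup>2)" using T by (intro sum.cong) (auto simp: muZ)
      finally have sig: "C\<^sup>2 * real k * L \<le> (\<Sum>i\<in>T. (mean_shift p \<gamma> \<theta> i)\<^sup>2)" by (simp add: \<mu>_def)
      have "?goal \<le> 100000 / C\<^sup>2"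
      proof (rule detect_thr_sum[OF p1 \<gamma> k(1,2) _ _ _ sig[unfolded L_def]])
        fix \<omega> assume "phi_adaptive C p \<gamma> \<omega> = 0"
        then have "thr_sum p (t_dense p s) (X_tilde p \<gamma> \<omega>) \<le> r_dense C p s"
          using dense sp by (simp add: phi_adaptive_eq_0_iff)
        then show "thr_sum p (t_sparse p k) (X_tilde p \<gamma> \<omega>) \<le> C\<^sup>2 / 8 * real k * ln (1 + real p / (real k)\<^sup>2)"
          using sp by (simp add: t_dense_eq r_dense_def k_def of_nat_diff)
      qed (use T C0 in auto)
      then show ?thesis by (rule weaken) simp
    qed
  qed
qed

lemma Theta_nonempty:
  assumes "1 \<le> s" "s \<le> p" shows "Theta p s a \<noteq> {}"
proof -
  define \<theta> where "\<theta> = (\<lambda>i\<in>{..<p}. if i = 0 then a else 0)"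
  have "(\<Sum>i<p. (\<theta> i)\<^sup>2) = (\<Sum>i<p. if i = 0 then a\<^sup>2 else 0)"
    unfolding \<theta>_def by (intro sum.cong) auto
  then have "(\<Sum>i<p. (\<theta> i)\<^sup>2) = a\<^sup>2" using assms by simp
  then have "L2_set \<theta> {..<p} = \<bar>a\<bar>" by (simp add: L2_set_def)
  moreover have "card {i \<in> {..<p}. \<theta> i \<noteq> 0} \<le> card {0::nat}"
    by (intro card_mono) (auto simp: \<theta>_def)
  moreover have "\<theta> \<in> {..<p} \<rightarrow>\<^sub>E UNIV" by (simp add: \<theta>_def)
  ultimately have "\<theta> \<in> Theta p s a" unfolding Theta_def using assms by simp
  then show ?thesis by blast
qed

theorem theorem8:
  fixes \<eta> :: real
  assumes "0 < \<eta>" and "\<eta> < 1"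
  shows "\<exists>C\<^sub>\<eta>>0. \<forall>C>C\<^sub>\<eta>. \<forall>(p::nat) (s::nat) (\<gamma>::real).
           1 \<le> s \<and> s \<le> p \<and> 0 \<le> \<gamma> \<and> \<gamma> < 1 \<longrightarrow>
             \<P>(\<omega> in sample_law p \<gamma> (zero_vector p). phi_adaptive C p \<gamma> \<omega> = 1)
             + (SUP \<theta> \<in> Theta p s (C * psi p \<gamma> s).
                  \<P>(\<omega> in sample_law p \<gamma> \<theta>. phi_adaptive C p \<gamma> \<omega> = 0)) \<le> \<eta>"
proof (intro exI conjI allI impI)
  let ?C = "sqrt (12000000 / \<eta>)"
  show "0 < ?C" using assms by simp
  fix C :: real and p s :: nat and \<gamma> :: real
  assume C: "?C < C" and asm: "1 \<le> s \<and> s \<le> p \<and> 0 \<le> \<gamma> \<and> \<gamma> < 1"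
  have "8\<^sup>2 \<le> 12000000 / \<eta>" using assms by (simp add: field_simps)
  then have "8 \<le> ?C" by (rule real_le_rsqrt)
  then have C8: "8 \<le> C" using C by simp
  have "?C\<^sup>2 \<le> C\<^sup>2" using C assms by (intro power_mono) auto
  then have "12000000 / \<eta> \<le> C\<^sup>2" using assms by simp
  then have "12000000 / C\<^sup>2 \<le> \<eta>" using assms C8 by (simp add: field_simps)
  moreover have "\<P>(\<omega> in sample_law p \<gamma> (zero_vector p). phi_adaptive C p \<gamma> \<omega> = 1) \<le> 11534346 / C\<^sup>2"
    using asm C8 by (intro adaptive_null) auto
  moreover have "(SUP \<theta> \<in> Theta p s (C * psi p \<gamma> s). \<P>(\<omega> in sample_law p \<gamma> \<theta>. phi_adaptive C p \<gamma> \<omega> = 0)) \<le> 400000 / C\<^sup>2"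
    using asm C8 by (intro cSUP_least Theta_nonempty adaptive_power) auto
  moreover have "11534346 / C\<^sup>2 + 400000 / C\<^sup>2 \<le> 12000000 / C\<^sup>2"
    by (simp add: add_divide_distrib[symmetric] divide_right_mono)
  ultimately show "\<P>(\<omega> in sample_law p \<gamma> (zero_vector p). phi_adaptive C p \<gamma> \<omega> = 1)
             + (SUP \<theta> \<in> Theta p s (C * psi p \<gamma> s).
                  \<P>(\<omega> in sample_law p \<gamma> \<theta>. phi_adaptive C p \<gamma> \<omega> = 0)) \<le> \<eta>" by linarith
qed

end
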